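(* Let $t>5$ and let $f,g\in L^\infty(\overline{\mathbb{D}})$. Suppose that $g\in C^\infty(\overline{\mathbb{D}})$ and that there is $\epsilon>0$ with $$\inf\{\,|z-\xi| : z\in\operatorname{supp} f,\ \xi\in\operatorname{supp} g\,\}>\epsilon .$$ Then both $T_fT_g$ and $T_gT_f$ are trace class operators on $\mathcal{H}_t$, and $\operatorname{Tr}([T_f,T_g])=0$.
   Context: $\mathbb{D}$ is the open unit disc in $\mathbb{C}$. For $t\in\mathbb{R}$ let $d\mu_t(z)=(1-|z|^2)^{t-2}\,d\bar z\,dz$ and let $\mathcal{H}_t$ be the closed subspace of $L^2(\mathbb{D},d\mu_t)$ consisting of holomorphic functions, with orthogonal projection $\mathcal{P}_t$. For $f\in L^\infty(\mathbb{D})$, $T_f=\mathcal{P}_t\mathcal{M}_f\mathcal{P}_t$ (with $\mathcal{M}_f$ multiplication by $f$) is the Toeplitz operator on $\mathcal{H}_t$ with symbol $f$. $\operatorname{Tr}$ denotes the usual trace and $[A,B]=AB-BA$. *)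

theory Defs
  imports "HOL-Analysis.Analysis"
begin

text \<open>mu_t = (1-|z|^2)^(t-2) dA on the open unit disc (the constant factor coming
 from d zbar dz is irrelevant for projections, trace class and traces).\<close>
definition mu :: "real \<Rightarrow> complex measure" where
  "mu t = density (lebesgue_on (ball 0 1)) (\<lambda>z. ennreal ((1 - (cmod z)^2) powr (t - 2)))"

definition Bergman :: "real \<Rightarrow> (complex \<Rightarrow> complex) set" where
  "Bergman t = {h. h holomorphic_on ball 0 1 \<and> (\<forall>z. z \<notin> ball 0 1 \<longrightarrow> h z = 0)
      \<and> h \<in> borel_measurable (mu t) \<and> integrable (mu t) (\<lambda>z. (cmod (h z))^2)}"

definition ip :: "real \<Rightarrow> (complex \<Rightarrow> complex) \<Rightarrow> (complex \<Rightarrow> complex) \<Rightarrow> complex" where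
  "ip t h k = (\<integral>z. h z * cnj (k z) \<partial>mu t)"

definition nrm :: "real \<Rightarrow> (complex \<Rightarrow> complex) \<Rightarrow> real" where
  "nrm t h = sqrt (Re (ip t h h))"

text \<open>Toeplitz operator T_f = P_t M_f on H_t: T_f h is the unique u in H_t with
 ip u k = ip (f h) k for all k in H_t (i.e. u = P_t (f h)).\<close>
definition Toeplitz :: "real \<Rightarrow> (complex \<Rightarrow> complex) \<Rightarrow> (complex \<Rightarrow> complex) \<Rightarrow> (complex \<Rightarrow> complex)" where
  "Toeplitz t f h = (THE u. u \<in> Bergman t \<and>
      (\<forall>k \<in> Bergman t. ip t u k = (\<integral>z. f z * h z * cnj (k z) \<partial>mu t)))"

definition orthonormal_seq :: "real \<Rightarrow> (nat \<Rightarrow> complex \<Rightarrow> complex) \<Rightarrow> bool" where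
  "orthonormal_seq t e \<longleftrightarrow> (\<forall>n. e n \<in> Bergman t) \<and>
      (\<forall>m n. ip t (e m) (e n) = (if m = n then 1 else 0))"

definition onb :: "real \<Rightarrow> (nat \<Rightarrow> complex \<Rightarrow> complex) \<Rightarrow> bool" where
  "onb t e \<longleftrightarrow> orthonormal_seq t e \<and>
      (\<forall>h \<in> Bergman t. (\<forall>n. ip t h (e n) = 0) \<longrightarrow> h = (\<lambda>z. 0))"

text \<open>Trace class operators on H_t (compact operators with summable singular
 values), via their Schmidt expansion A h = sum_n s_n <h,u_n> v_n, with u, v
 orthonormal sequences and (s_n) nonnegative and summable; the series converges in H_t.\<close>
definition trace_class :: "real \<Rightarrow> ((complex \<Rightarrow> complex) \<Rightarrow> (complex \<Rightarrow> complex)) \<Rightarrow> bool" where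
  "trace_class t A \<longleftrightarrow> (\<forall>h \<in> Bergman t. A h \<in> Bergman t) \<and>
     (\<exists>u v (s :: nat \<Rightarrow> real). orthonormal_seq t u \<and> orthonormal_seq t v \<and>
        (\<forall>n. 0 \<le> s n) \<and> summable s \<and>
        (\<forall>h \<in> Bergman t. (\<lambda>N. nrm t (\<lambda>z. A h z -
             (\<Sum>n<N. complex_of_real (s n) * ip t h (u n) * v n z))) \<longlonglongrightarrow> 0))"

text \<open>Trace: sum of diagonal entries w.r.t. an (arbitrarily chosen) orthonormal basis;
 independent of the basis for trace class operators.\<close>
definition trace :: "real \<Rightarrow> ((complex \<Rightarrow> complex) \<Rightarrow> (complex \<Rightarrow> complex)) \<Rightarrow> complex" where
  "trace t A = (let e = (SOME e. onb t e) in (\<Sum>n. ip t (A (e n)) (e n)))"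

definition commutator :: "(('a \<Rightarrow> 'b) \<Rightarrow> ('a \<Rightarrow> 'b::ab_group_add)) \<Rightarrow> (('a \<Rightarrow> 'b) \<Rightarrow> ('a \<Rightarrow> 'b))
    \<Rightarrow> (('a \<Rightarrow> 'b) \<Rightarrow> ('a \<Rightarrow> 'b))" where
  "commutator A B = (\<lambda>h. (\<lambda>z. A (B h) z - B (A h) z))"

definition Linf_cdisc :: "(complex \<Rightarrow> complex) \<Rightarrow> bool" where
  "Linf_cdisc f \<longleftrightarrow> f \<in> borel_measurable (lebesgue_on (cball 0 1)) \<and>
     (\<exists>B. AE z in lebesgue_on (cball 0 1). cmod (f z) \<le> B)"

fun Ck_on :: "nat \<Rightarrow> complex set \<Rightarrow> (complex \<Rightarrow> complex) \<Rightarrow> bool" where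
  "Ck_on 0 U G \<longleftrightarrow> continuous_on U G"
| "Ck_on (Suc k) U G \<longleftrightarrow> (\<exists>Gx Gy. (\<forall>z \<in> U. (G has_derivative (\<lambda>w. Re w *\<^sub>R Gx z + Im w *\<^sub>R Gy z)) (at z))
      \<and> Ck_on k U Gx \<and> Ck_on k U Gy)"

definition Cinf_cdisc :: "(complex \<Rightarrow> complex) \<Rightarrow> bool" where
  "Cinf_cdisc g \<longleftrightarrow> (\<exists>U G. open U \<and> cball 0 1 \<subseteq> U \<and> (\<forall>k. Ck_on k U G) \<and>
      (\<forall>z \<in> cball 0 1. G z = g z))"

definition supp :: "(complex \<Rightarrow> complex) \<Rightarrow> complex set" where
  "supp f = {z \<in> cball 0 1. \<forall>e>0. \<not> (AE w in lebesgue_on (cball 0 1 \<inter> ball z e). f w = 0)}"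

end

theory Submission
  imports Defs "HOL-Complex_Analysis.Cauchy_Integral_Formula" "HOL-Library.Function_Algebras"
    "HOL-Library.Diagonal_Subsequence"
begin

text \<open>
  The reproducing kernel of the Bergman space is \<open>K(z,w) = c (1 - z cnj w)\<^sup>-\<^sup>t\<close>, and
  \<open>|1 - z cnj w| \<ge> |z - w|\<close> on the closed disc. If \<open>f\<close> lives on a disc of radius
  \<open>d\<close> about \<open>a\<close> and \<open>g\<close> at distance at least \<open>2d\<close> from \<open>a\<close>, expanding in powers of \<open>z - a\<close> gives
  \<open>K(z,w) = \<Sum>\<^sub>i (z - a)\<^sup>i \<psi>\<^sub>i(w)\<close> with \<open>\<Sum>\<^sub>i sup |(z - a)\<^sup>i| sup |\<psi>\<^sub>i| < \<infinity>\<close>, so \<open>T\<^sub>f T\<^sub>g\<close> is nuclear; finitely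
  many such discs cover the support of \<open>f\<close>. The trace of \<open>T\<^sub>f T\<^sub>g\<close> is the integral of
  \<open>f(z) g(w) K(z,w) K(w,z)\<close>, and \<open>T\<^sub>g T\<^sub>f\<close> is the adjoint of the same product formed with the conjugate
  symbols, so its trace is the same integral. A nuclear operator has a Schmidt expansion with summable
  coefficients: choose unit vectors maximising \<open>|A x|\<close> successively on the orthogonal complements of
  those already chosen.
\<close>

section \<open>Nuclear operators on a complex Hilbert space\<close>

text \<open>Close to the unit circle a single kernel is unbounded. On the product of two separated
  supports, however, both the kernel and its expansion about \<open>a\<close> are bounded uniformly
  up to the circle, and this is what separation buys. A disc of radius \<open>d\<close> at distance
  \<open>2 * d\<close> gives the ratio 1/2, against which the coefficients of \<open>(1 - x)\<close>
  to the power \<open>- t\<close> are summable; a cover with \<open>d\<close> equal to half the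
  separation achieves this. Only \<open>f\<close> is cut into pieces, and every quantity involved is
  additive in \<open>f\<close>. Dominated convergence yields the expansion of the product merely
  tested against vectors, with non-orthogonal terms. \<open>trace_class\<close> asks for infinite
  orthonormal sequences and convergence in norm. The abstract first part bridges this gap, starting
  from the weak form alone.\<close>

lemma sums_if_complex:
  fixes f g :: "nat \<Rightarrow> complex"
  assumes "g sums x" "f sums y"
  shows "(\<lambda>n. if even n then f (n div 2) else g ((n - 1) div 2)) sums (x + y)"
  using sums_if[of "\<lambda>n. Re (g n)" "Re x" "\<lambda>n. Re (f n)" "Re y"]
    sums_if[of "\<lambda>n. Im (g n)" "Im x" "\<lambda>n. Im (f n)" "Im y"] assms
  unfolding sums_complex_iff by (simp add: if_distrib)

text \<open>Vectors are taken from a carrier set because the spaces in question are sets of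
  functions depending on \<open>t\<close>. The form is only semidefinite: \<open>L2 t\<close>
  consists of functions, not of classes modulo null sets. The lemmas proved here thus serve both
  \<open>L2 t\<close> and \<open>Bergman t\<close>.\<close>

locale cip_space = vector_space scale
  for scale :: "complex \<Rightarrow> 'v::ab_group_add \<Rightarrow> 'v" (infixr \<open>*\<^sub>C\<close> 75) +
  fixes V :: "'v set" and inn :: "'v \<Rightarrow> 'v \<Rightarrow> complex"
  assumes subspace_V: "subspace V"
    and inn_add_left: "x \<in> V \<Longrightarrow> y \<in> V \<Longrightarrow> z \<in> V \<Longrightarrow> inn (x + y) z = inn x z + inn y z"
    and inn_scale_left: "x \<in> V \<Longrightarrow> y \<in> V \<Longrightarrow> inn (c *\<^sub>C x) y = c * inn x y"
    and inn_cnj: "x \<in> V \<Longrightarrow> y \<in> V \<Longrightarrow> inn y x = cnj (inn x y)"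
    and inn_self_ge0: "x \<in> V \<Longrightarrow> 0 \<le> Re (inn x x)"
begin

section \<open>Semidefinite inner products: Cauchy-Schwarz and Bessel\<close>

definition nm :: "'v \<Rightarrow> real" where
  "nm x = sqrt (Re (inn x x))"

definition orthonormal :: "(nat \<Rightarrow> 'v) \<Rightarrow> bool" where
  "orthonormal e \<longleftrightarrow> (\<forall>n. e n \<in> V) \<and> (\<forall>m n. inn (e m) (e n) = (if m = n then 1 else 0))"

lemma V_closed [simp]:
  "0 \<in> V"
  "x \<in> V \<Longrightarrow> y \<in> V \<Longrightarrow> x + y \<in> V"
  "x \<in> V \<Longrightarrow> y \<in> V \<Longrightarrow> x - y \<in> V"
  "x \<in> V \<Longrightarrow> c *\<^sub>C x \<in> V"
  using subspace_V by (auto simp: subspace_0 subspace_add subspace_diff subspace_scale)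

lemma V_sum [simp]: "(\<And>i. i \<in> I \<Longrightarrow> x i \<in> V) \<Longrightarrow> (\<Sum>i\<in>I. x i) \<in> V"
  using subspace_V by (rule subspace_sum)

lemma inn_zero [simp]: "x \<in> V \<Longrightarrow> inn 0 x = 0" "x \<in> V \<Longrightarrow> inn x 0 = 0"
proof -
  assume x: "x \<in> V"
  show "inn 0 x = 0" using inn_scale_left[of x x 0] x by simp
  then show "inn x 0 = 0" using inn_cnj[of 0 x] x by simp
qed

lemma inn_add_right: "x \<in> V \<Longrightarrow> y \<in> V \<Longrightarrow> z \<in> V \<Longrightarrow> inn x (y + z) = inn x y + inn x z"
  using inn_add_left[of y z x] by (simp add: inn_cnj[of _ x])

lemma inn_scale_right: "x \<in> V \<Longrightarrow> y \<in> V \<Longrightarrow> inn x (c *\<^sub>C y) = cnj c * inn x y"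
  using inn_scale_left[of y x c] by (simp add: inn_cnj[of _ x])

lemma inn_diff_left: "x \<in> V \<Longrightarrow> y \<in> V \<Longrightarrow> z \<in> V \<Longrightarrow> inn (x - y) z = inn x z - inn y z"
  using inn_add_left[of "x - y" y z] by simp

lemma inn_diff_right: "x \<in> V \<Longrightarrow> y \<in> V \<Longrightarrow> z \<in> V \<Longrightarrow> inn x (y - z) = inn x y - inn x z"
  using inn_add_right[of x "y - z" z] by simp

lemma inn_sum_left:
  "(\<And>i. i \<in> I \<Longrightarrow> x i \<in> V) \<Longrightarrow> y \<in> V \<Longrightarrow> inn (\<Sum>i\<in>I. x i) y = (\<Sum>i\<in>I. inn (x i) y)"
  by (induction I rule: infinite_finite_induct) (auto simp: inn_add_left)

lemma inn_sum_right:
  "(\<And>i. i \<in> I \<Longrightarrow> x i \<in> V) \<Longrightarrow> y \<in> V \<Longrightarrow> inn y (\<Sum>i\<in>I. x i) = (\<Sum>i\<in>I. inn y (x i))"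
  by (induction I rule: infinite_finite_induct) (auto simp: inn_add_right)

lemmas inn_simps = inn_add_left inn_add_right inn_diff_left inn_diff_right inn_scale_left inn_scale_right

lemma nm_ge0 [simp]: "x \<in> V \<Longrightarrow> 0 \<le> nm x"
  by (simp add: nm_def inn_self_ge0)

lemma inn_self: "x \<in> V \<Longrightarrow> inn x x = of_real ((nm x)\<^sup>2)"
  using inn_cnj[of x x] inn_self_ge0[of x] by (simp add: nm_def complex_eq_iff)

lemma nm_square: "x \<in> V \<Longrightarrow> (nm x)\<^sup>2 = Re (inn x x)"
  by (simp add: nm_def inn_self_ge0)

lemma nm_zero [simp]: "nm 0 = 0"
  by (simp add: nm_def)

lemma nm_scale: "x \<in> V \<Longrightarrow> nm (c *\<^sub>C x) = cmod c * nm x"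
proof -
  assume x: "x \<in> V"
  have "(nm (c *\<^sub>C x))\<^sup>2 = (cmod c * nm x)\<^sup>2"
  proof -
    have "inn (c *\<^sub>C x) (c *\<^sub>C x) = of_real ((cmod c * nm x)\<^sup>2)"
      using x inn_self[OF x] complex_norm_square[of c] by (simp add: inn_simps power_mult_distrib mult.commute)
    then show ?thesis using x by (simp add: nm_square)
  qed
  then show ?thesis using x by (simp add: power2_eq_iff_nonneg)
qed

lemma nm_minus_commute: "x \<in> V \<Longrightarrow> y \<in> V \<Longrightarrow> nm (x - y) = nm (y - x)"
  using nm_scale[of "y - x" "-1"] by (simp add: scale_minus_left)

lemma nm_diff_square:
  assumes "x \<in> V" "y \<in> V"
  shows "(nm (x - y))\<^sup>2 = (nm x)\<^sup>2 - 2 * Re (inn x y) + (nm y)\<^sup>2"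
  using assms inn_cnj[of x y] by (simp add: nm_square inn_simps)

lemma nm_add_square:
  assumes "x \<in> V" "y \<in> V"
  shows "(nm (x + y))\<^sup>2 = (nm x)\<^sup>2 + 2 * Re (inn x y) + (nm y)\<^sup>2"
  using assms inn_cnj[of x y] by (simp add: nm_square inn_simps)

lemma Cauchy_Schwarz:
  assumes x: "x \<in> V" and y: "y \<in> V"
  shows "cmod (inn x y) \<le> nm x * nm y"
proof -
  define c where "c = inn x y"
  \<comment> \<open>Expanding the squared norm of \<open>x - (r * c) y\<close> gives a family of
    inequalities in the real parameter \<open>r\<close>; a suitable \<open>r\<close> is chosen in
    each case below.\<close>
  have *: "2 * r * (cmod c)\<^sup>2 \<le> (nm x)\<^sup>2 + r\<^sup>2 * (cmod c)\<^sup>2 * (nm y)\<^sup>2" for r :: real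
  proof -
    have "0 \<le> (nm (x - (of_real r * c) *\<^sub>C y))\<^sup>2" by simp
    also have "\<dots> = (nm x)\<^sup>2 - 2 * r * (cmod c)\<^sup>2 + (cmod (of_real r * c) * nm y)\<^sup>2"
      using x y by (simp add: nm_diff_square nm_scale inn_simps c_def[symmetric])
        (simp add: cmod_def power2_eq_square algebra_simps)
    finally show ?thesis by (simp add: norm_mult power_mult_distrib)
  qed
  have "(cmod c)\<^sup>2 \<le> (nm x * nm y)\<^sup>2"
  proof (cases "nm y = 0")
    case True
    \<comment> \<open>A nonzero \<open>y\<close> can have norm 0. The inequality is then linear in
      \<open>r\<close> and fails once \<open>r\<close> is large.\<close>
    have "(cmod c)\<^sup>2 = 0"
    proof (rule ccontr)
      assume "(cmod c)\<^sup>2 \<noteq> 0"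
      then show False
        using *[of "((nm x)\<^sup>2 + 1) / (2 * (cmod c)\<^sup>2)"] True by (simp add: field_simps)
    qed
    then show ?thesis by simp
  next
    case False
    have "2 * (1 / (nm y)\<^sup>2) * (cmod c)\<^sup>2 \<le> (nm x)\<^sup>2 + (1 / (nm y)\<^sup>2)\<^sup>2 * (cmod c)\<^sup>2 * (nm y)\<^sup>2"
      by (rule *)
    then have "(cmod c)\<^sup>2 * (1 / (nm y)\<^sup>2) \<le> (nm x)\<^sup>2"
      using False by (simp add: power2_eq_square)
    then show ?thesis using False by (simp add: divide_le_eq power_mult_distrib)
  qed
  then show ?thesis
    unfolding c_def using x y by (simp add: abs_le_square_iff[symmetric] abs_mult)
qed

lemma nm_triangle:
  assumes "x \<in> V" "y \<in> V"
  shows "nm (x + y) \<le> nm x + nm y"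
proof -
  have "Re (inn x y) \<le> nm x * nm y"
    using Cauchy_Schwarz[OF assms] complex_Re_le_cmod[of "inn x y"] by linarith
  then have "(nm (x + y))\<^sup>2 \<le> (nm x + nm y)\<^sup>2"
    using assms by (simp add: nm_add_square power2_sum)
  then show ?thesis
    using assms by (simp add: abs_le_square_iff[symmetric])
qed

lemma nm_triangle_diff:
  assumes "x \<in> V" "y \<in> V" "z \<in> V"
  shows "nm (x - z) \<le> nm (x - y) + nm (y - z)"
  using nm_triangle[of "x - y" "y - z"] assms by simp

lemma nm_reverse_triangle:
  assumes "x \<in> V" "y \<in> V"
  shows "\<bar>nm x - nm y\<bar> \<le> nm (x - y)"
  using nm_triangle[of "x - y" y] nm_triangle[of "y - x" x] nm_minus_commute[of x y] assms by simp

lemma tendsto_inn_left: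
  assumes "\<And>n. X n \<in> V" "x \<in> V" "y \<in> V" "(\<lambda>n. nm (X n - x)) \<longlonglongrightarrow> 0"
  shows "(\<lambda>n. inn (X n) y) \<longlonglongrightarrow> inn x y"
proof -
  have "(\<lambda>n. inn (X n) y - inn x y) \<longlonglongrightarrow> 0"
  proof (rule Lim_null_comparison)
    show "\<forall>\<^sub>F n in sequentially. norm (inn (X n) y - inn x y) \<le> nm (X n - x) * nm y"
      using Cauchy_Schwarz[of "X _ - x" y] assms by (auto simp: inn_diff_left)
    show "(\<lambda>n. nm (X n - x) * nm y) \<longlonglongrightarrow> 0"
      using tendsto_mult_right[OF assms(4), of "nm y"] by simp
  qed
  then show ?thesis by (simp add: LIM_zero_iff)
qed

lemma tendsto_inn_right:
  assumes "\<And>n. X n \<in> V" "x \<in> V" "y \<in> V" "(\<lambda>n. nm (X n - x)) \<longlonglongrightarrow> 0"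
  shows "(\<lambda>n. inn y (X n)) \<longlonglongrightarrow> inn y x"
  using tendsto_cnj[OF tendsto_inn_left[OF assms]] assms(1-3) by (simp add: inn_cnj[of _ y])

lemma tendsto_nm:
  assumes "\<And>n. X n \<in> V" "x \<in> V" "(\<lambda>n. nm (X n - x)) \<longlonglongrightarrow> 0"
  shows "(\<lambda>n. nm (X n)) \<longlonglongrightarrow> nm x"
proof -
  have "(\<lambda>n. nm (X n) - nm x) \<longlonglongrightarrow> 0"
    by (rule Lim_null_comparison[OF _ assms(3)]) (use nm_reverse_triangle assms in auto)
  then show ?thesis by (simp add: LIM_zero_iff)
qed

lemma orthonormal_V: "orthonormal e \<Longrightarrow> e n \<in> V"
  by (simp add: orthonormal_def)

lemma orthonormal_inn: "orthonormal e \<Longrightarrow> inn (e m) (e n) = (if m = n then 1 else 0)"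
  by (simp add: orthonormal_def)

text \<open>Orthonormality is only assumed of the members of the finite index set, since the
  Schmidt decomposition is built one vector at a time.\<close>

lemma
  fixes e :: "nat \<Rightarrow> 'v"
  assumes fin: "finite I" and e: "\<And>i. i \<in> I \<Longrightarrow> e i \<in> V"
    and on: "\<And>i j. i \<in> I \<Longrightarrow> j \<in> I \<Longrightarrow> inn (e i) (e j) = (if i = j then 1 else 0)"
    and x: "x \<in> V"
  defines "p \<equiv> \<Sum>i\<in>I. inn x (e i) *\<^sub>C e i"
  shows residual_orthogonal: "j \<in> I \<Longrightarrow> inn (x - p) (e j) = 0"
    and residual_nm: "(nm (x - p))\<^sup>2 = (nm x)\<^sup>2 - (\<Sum>i\<in>I. (cmod (inn x (e i)))\<^sup>2)"
proof -
  have p: "p \<in> V" unfolding p_def using e by simp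
  have pj: "inn p (e j) = inn x (e j)" if "j \<in> I" for j
  proof -
    have "inn p (e j) = (\<Sum>i\<in>I. inn x (e i) * (if i = j then 1 else 0))"
      unfolding p_def using e on that by (subst inn_sum_left) (auto simp: inn_scale_left intro!: sum.cong)
    then show ?thesis using that fin by (simp add: if_distrib cong: if_cong)
  qed
  then show "j \<in> I \<Longrightarrow> inn (x - p) (e j) = 0" for j
    using x p e by (simp add: inn_diff_left)
  have 1: "inn x p = (\<Sum>i\<in>I. (cmod (inn x (e i)))\<^sup>2)"
    unfolding p_def using e x
    by (subst inn_sum_right) (auto simp: inn_scale_right of_real_sum complex_norm_square mult.commute
        simp del: of_real_power intro!: sum.cong)
  have 2: "inn p p = (\<Sum>i\<in>I. (cmod (inn x (e i)))\<^sup>2)"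
  proof -
    have "inn p p = (\<Sum>i\<in>I. cnj (inn x (e i)) * inn p (e i))"
      by (subst (2) p_def) (use e p in \<open>auto simp: inn_sum_right inn_scale_right intro!: sum.cong\<close>)
    then show ?thesis
      using pj by (simp add: of_real_sum complex_norm_square mult.commute del: of_real_power)
  qed
  show "(nm (x - p))\<^sup>2 = (nm x)\<^sup>2 - (\<Sum>i\<in>I. (cmod (inn x (e i)))\<^sup>2)"
    using x p by (subst nm_diff_square) (auto simp: 1 nm_square[of p] 2)
qed

lemma Bessel_finite:
  fixes e :: "nat \<Rightarrow> 'v"
  assumes "finite I" "\<And>i. i \<in> I \<Longrightarrow> e i \<in> V"
    and "\<And>i j. i \<in> I \<Longrightarrow> j \<in> I \<Longrightarrow> inn (e i) (e j) = (if i = j then 1 else 0)" "x \<in> V"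
  shows "(\<Sum>i\<in>I. (cmod (inn x (e i)))\<^sup>2) \<le> (nm x)\<^sup>2"
  using residual_nm[OF assms] zero_le_power2[of "nm (x - (\<Sum>i\<in>I. inn x (e i) *\<^sub>C e i))"] by linarith

lemma Bessel:
  assumes "orthonormal e" "x \<in> V"
  shows "(\<Sum>i<n. (cmod (inn x (e i)))\<^sup>2) \<le> (nm x)\<^sup>2"
  using assms by (intro Bessel_finite) (auto simp: orthonormal_def)

text \<open>The Cauchy-Schwarz inequality for finite sums reduces this to Bessel for each sequence.
  The bound does not depend on \<open>N\<close>; it supplies the domination for the trace and the
  summability of the singular values.\<close>

lemma Bessel_pairing:
  assumes u: "orthonormal u" and v: "orthonormal v" and "x \<in> V" "y \<in> V"
  shows "(\<Sum>n<N. cmod (inn (u n) x * inn y (v n))) \<le> nm x * nm y"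
proof -
  note [simp] = orthonormal_V[OF u] orthonormal_V[OF v]
  have "(\<Sum>n<N. \<bar>cmod (inn (u n) x)\<bar> * \<bar>cmod (inn y (v n))\<bar>)
      \<le> L2_set (\<lambda>n. cmod (inn (u n) x)) {..<N} * L2_set (\<lambda>n. cmod (inn y (v n))) {..<N}"
    by (rule L2_set_mult_ineq)
  also have "\<dots> \<le> nm x * nm y"
  proof (intro mult_mono)
    have "cmod (inn (u n) x) = cmod (inn x (u n))" for n
      using assms by (simp add: inn_cnj[of x "u n"])
    then show "L2_set (\<lambda>n. cmod (inn (u n) x)) {..<N} \<le> nm x"
      unfolding L2_set_def using Bessel[OF u] assms by (intro real_le_lsqrt) (auto intro: sum_nonneg)
    show "L2_set (\<lambda>n. cmod (inn y (v n))) {..<N} \<le> nm y"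
      unfolding L2_set_def using Bessel[OF v] assms by (intro real_le_lsqrt) (auto intro: sum_nonneg)
  qed (use assms in \<open>auto simp: L2_set_nonneg\<close>)
  finally show ?thesis by (simp add: norm_mult)
qed

text \<open>By Pythagoras the squared distance of two partial sums is the difference of two members
  of a bounded increasing sequence. Completeness is left to the application, where \<open>x\<close>
  lies in \<open>L2 t\<close> and the \<open>e i\<close> in the Bergman space.\<close>

lemma Bessel_tail_Cauchy:
  assumes e: "orthonormal e" and x: "x \<in> V" and "\<epsilon> > 0"
  shows "\<exists>M. \<forall>m\<ge>M. \<forall>n\<ge>M. nm ((\<Sum>i<m. inn x (e i) *\<^sub>C e i) - (\<Sum>i<n. inn x (e i) *\<^sub>C e i)) < \<epsilon>"
proof -
  note [simp] = orthonormal_V[OF e] orthonormal_inn[OF e]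
  define S where "S = (\<lambda>n. \<Sum>i<n. (cmod (inn x (e i)))\<^sup>2)"
  define p where "p = (\<lambda>n. \<Sum>i<n. inn x (e i) *\<^sub>C e i)"
  have pV: "p n \<in> V" for n unfolding p_def by simp
  have nmd: "(nm (p n - p m))\<^sup>2 = S n - S m" if "m \<le> n" for m n
  proof -
    have "p n - p m = (\<Sum>i\<in>{m..<n}. inn x (e i) *\<^sub>C e i)"
      unfolding p_def using sum_diff_nat_ivl[of 0 m n "\<lambda>i. inn x (e i) *\<^sub>C e i"] that
      by (simp add: lessThan_atLeast0)
    moreover have "inn (\<Sum>i\<in>{m..<n}. inn x (e i) *\<^sub>C e i) (\<Sum>i\<in>{m..<n}. inn x (e i) *\<^sub>C e i)
       = of_real (\<Sum>i\<in>{m..<n}. (cmod (inn x (e i)))\<^sup>2)"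
      by (simp add: inn_sum_left inn_sum_right inn_scale_left inn_scale_right if_distrib complex_norm_square
          of_real_sum mult.commute del: of_real_power cong: if_cong)
    moreover have "(\<Sum>i\<in>{m..<n}. (cmod (inn x (e i)))\<^sup>2) = S n - S m"
      unfolding S_def using sum_diff_nat_ivl[of 0 m n "\<lambda>i. (cmod (inn x (e i)))\<^sup>2"] that
      by (simp add: lessThan_atLeast0)
    moreover have "(nm (p n - p m))\<^sup>2 = Re (inn (p n - p m) (p n - p m))"
      using pV by (intro nm_square) simp
    ultimately show ?thesis by simp
  qed
  have "incseq S" unfolding S_def by (intro incseq_SucI) simp
  moreover have "\<forall>n. S n \<le> (nm x)\<^sup>2" unfolding S_def using Bessel[OF e x] by blast
  ultimately have "convergent S" by (meson incseq_convergent convergentI)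
  then have "Cauchy S" by (rule convergent_Cauchy)
  then obtain M where M: "\<And>m n. m \<ge> M \<Longrightarrow> n \<ge> M \<Longrightarrow> norm (S m - S n) < \<epsilon>\<^sup>2"
    using \<open>\<epsilon> > 0\<close> unfolding Cauchy_iff by (metis zero_less_power)
  have "nm (p m - p n) < \<epsilon>" if "m \<ge> M" "n \<ge> M" for m n
  proof -
    have "(nm (p m - p n))\<^sup>2 < \<epsilon>\<^sup>2"
      using nmd[of m n] nmd[of n m] M[OF that] nm_minus_commute[OF pV pV, of m n]
      by (cases "m \<le> n") auto
    then show ?thesis using \<open>\<epsilon> > 0\<close> by (simp add: power_less_imp_less_base)
  qed
  then show ?thesis unfolding p_def by blast
qed

end

section \<open>Complete spaces: Fourier expansion and Parseval\<close>

locale chilbert_space = cip_space +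
  assumes inn_definite: "x \<in> V \<Longrightarrow> inn x x = 0 \<Longrightarrow> x = 0"
    and complete: "(\<And>n. X n \<in> V) \<Longrightarrow> (\<And>\<epsilon>. \<epsilon> > 0 \<Longrightarrow> \<exists>M. \<forall>m\<ge>M. \<forall>n\<ge>M. nm (X m - X n) < \<epsilon>)
      \<Longrightarrow> \<exists>x\<in>V. (\<lambda>n. nm (X n - x)) \<longlonglongrightarrow> 0"
begin

definition orthonormal_basis :: "(nat \<Rightarrow> 'a) \<Rightarrow> bool" where
  "orthonormal_basis e \<longleftrightarrow> orthonormal e \<and> (\<forall>x\<in>V. (\<forall>n. inn x (e n) = 0) \<longrightarrow> x = 0)"

lemma nm_eq_0: "x \<in> V \<Longrightarrow> nm x = 0 \<Longrightarrow> x = 0"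
  by (simp add: inn_definite inn_self)

lemma eq_if_inn_eq:
  assumes "x \<in> V" "y \<in> V" "\<And>k. k \<in> V \<Longrightarrow> inn x k = inn y k"
  shows "x = y"
proof -
  have "inn (x - y) (x - y) = 0"
    using assms by (simp add: inn_diff_left)
  then show ?thesis using inn_definite[of "x - y"] assms by simp
qed

lemma fourier_limit:
  assumes e: "orthonormal e" and u: "u \<in> V"
    and lim: "(\<lambda>n. nm ((\<Sum>i<n. c i *\<^sub>C e i) - u)) \<longlonglongrightarrow> 0"
  shows "inn u (e j) = c j"
proof -
  note [simp] = orthonormal_V[OF e] orthonormal_inn[OF e]
  have "(\<lambda>n. inn (\<Sum>i<n. c i *\<^sub>C e i) (e j)) \<longlonglongrightarrow> inn u (e j)"
    by (rule tendsto_inn_left) (use u lim in auto)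
  moreover have "(\<lambda>n. inn (\<Sum>i<n. c i *\<^sub>C e i) (e j)) \<longlonglongrightarrow> c j"
  proof (rule tendsto_eventually)
    have "inn (\<Sum>i<n. c i *\<^sub>C e i) (e j) = c j" if "n > j" for n
      using that by (simp add: inn_sum_left inn_scale_left if_distrib cong: if_cong)
    then show "\<forall>\<^sub>F n in sequentially. inn (\<Sum>i<n. c i *\<^sub>C e i) (e j) = c j"
      unfolding eventually_sequentially by (metis Suc_le_eq)
  qed
  ultimately show ?thesis by (rule LIMSEQ_unique)
qed

lemma fourier_expansion:
  assumes e: "orthonormal_basis e" and x: "x \<in> V"
  shows "(\<lambda>n. nm ((\<Sum>i<n. inn x (e i) *\<^sub>C e i) - x)) \<longlonglongrightarrow> 0"
proof -
  have on: "orthonormal e" using e by (simp add: orthonormal_basis_def)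
  note [simp] = orthonormal_V[OF on]
  obtain u where u: "u \<in> V" "(\<lambda>n. nm ((\<Sum>i<n. inn x (e i) *\<^sub>C e i) - u)) \<longlonglongrightarrow> 0"
    using complete[of "\<lambda>n. \<Sum>i<n. inn x (e i) *\<^sub>C e i", OF _ Bessel_tail_Cauchy[OF on x]] by auto
  have "inn (u - x) (e n) = 0" for n
    using fourier_limit[OF on u] u x by (simp add: inn_diff_left)
  then have "u - x = 0"
    using e u x V_closed(3)[of u x] unfolding orthonormal_basis_def by blast
  then show ?thesis using u by simp
qed

lemma Parseval:
  assumes e: "orthonormal_basis e" and x: "x \<in> V" and y: "y \<in> V"
  shows "(\<lambda>n. inn x (e n) * inn (e n) y) sums inn x y"
proof -
  have on: "orthonormal e" using e by (simp add: orthonormal_basis_def)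
  note [simp] = orthonormal_V[OF on]
  have "(\<lambda>n. inn (\<Sum>i<n. inn x (e i) *\<^sub>C e i) y) \<longlonglongrightarrow> inn x y"
    by (rule tendsto_inn_left) (use x y fourier_expansion[OF e x] in auto)
  then show ?thesis
    using y by (simp add: inn_sum_left inn_scale_left sums_def)
qed

text \<open>The sequence \<open>w\<close> expresses infinite dimension. If every residual of
  \<open>w 0\<close>, ..., \<open>w n\<close> against the \<open>n\<close> vectors
  \<open>e i\<close> vanished, then counting the sum of all \<open>|<w j, e i>|^2\<close> by
  \<open>j\<close> would give \<open>n + 1\<close>, whereas counting it by \<open>i\<close> gives at
  most \<open>n\<close> by Bessel. A nonzero residual is normalised.\<close>

lemma ex_unit_orthogonal:
  fixes e :: "nat \<Rightarrow> 'a"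
  assumes w: "orthonormal w"
    and e: "\<And>i. i < n \<Longrightarrow> e i \<in> V"
    and on: "\<And>i j. i < n \<Longrightarrow> j < n \<Longrightarrow> inn (e i) (e j) = (if i = j then 1 else 0)"
  shows "\<exists>x\<in>V. nm x = 1 \<and> (\<forall>i<n. inn x (e i) = 0)"
proof -
  note [simp] = orthonormal_V[OF w] orthonormal_inn[OF w]
  define r where "r j = w j - (\<Sum>i<n. inn (w j) (e i) *\<^sub>C e i)" for j
  have rV: "r j \<in> V" for j unfolding r_def by (auto intro!: V_closed V_sum e)
  have nmr: "(nm (r j))\<^sup>2 = 1 - (\<Sum>i<n. (cmod (inn (w j) (e i)))\<^sup>2)" for j
    unfolding r_def using e on by (subst residual_nm) (auto simp: nm_square)
  have "\<exists>j. nm (r j) \<noteq> 0"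
  proof (rule ccontr)
    assume "\<nexists>j. nm (r j) \<noteq> 0"
    then have *: "(\<Sum>i<n. (cmod (inn (w j) (e i)))\<^sup>2) = 1" for j
      using nmr[of j] by simp
    have "real (Suc n) = (\<Sum>j<Suc n. \<Sum>i<n. (cmod (inn (w j) (e i)))\<^sup>2)"
      by (simp add: *)
    also have "\<dots> = (\<Sum>i<n. \<Sum>j<Suc n. (cmod (inn (w j) (e i)))\<^sup>2)"
      by (rule sum.swap)
    also have "\<dots> = (\<Sum>i<n. \<Sum>j<Suc n. (cmod (inn (e i) (w j)))\<^sup>2)"
    proof (intro sum.cong refl)
      fix i j assume "i \<in> {..<n}"
      then have "inn (w j) (e i) = cnj (inn (e i) (w j))" by (intro inn_cnj) (auto intro: e)
      then show "(cmod (inn (w j) (e i)))\<^sup>2 = (cmod (inn (e i) (w j)))\<^sup>2" by simp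
    qed
    also have "\<dots> \<le> (\<Sum>i<n. (nm (e i))\<^sup>2)"
      by (intro sum_mono Bessel w e) simp
    also have "\<dots> = (\<Sum>i<n. 1)"
      using e on by (intro sum.cong refl) (simp add: nm_square)
    finally show False by simp
  qed
  then obtain j where j: "nm (r j) \<noteq> 0" by blast
  have "inn (r j) (e i) = 0" if "i < n" for i
    unfolding r_def using e on that by (intro residual_orthogonal) auto
  then show ?thesis
    using j rV[of j] e
    by (intro bexI[of _ "of_real (1 / nm (r j)) *\<^sub>C r j"]) (auto simp: nm_scale inn_scale_left norm_divide)
qed

text \<open>The operator is the sum of the rank one maps taking \<open>h\<close> to
  \<open><h, a i> b i\<close>. Convergence is required only for each matrix coefficient, which is
  what termwise integration provides; linearity, norm bounds and compactness are derived from
  it.\<close>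

definition nuclear :: "('a \<Rightarrow> 'a) \<Rightarrow> (nat \<Rightarrow> 'a) \<Rightarrow> (nat \<Rightarrow> 'a) \<Rightarrow> bool" where
  "nuclear A a b \<longleftrightarrow> (\<forall>h\<in>V. A h \<in> V) \<and> (\<forall>i. a i \<in> V) \<and> (\<forall>i. b i \<in> V) \<and>
     summable (\<lambda>i. nm (a i) * nm (b i)) \<and>
     (\<forall>h\<in>V. \<forall>k\<in>V. (\<lambda>i. inn h (a i) * inn (b i) k) sums inn (A h) k)"

text \<open>The two expansions are interleaved: the terms of \<open>A\<close> take the even indices
  and those of \<open>B\<close> the odd ones.\<close>

lemma nuclear_sum:
  assumes A: "nuclear A a b" and B: "nuclear B c d"
    and C: "\<And>h. h \<in> V \<Longrightarrow> C h = A h + B h"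
  shows "\<exists>a b. nuclear C a b"
proof -
  define p where "p i = (if even i then a (i div 2) else c (i div 2))" for i
  define q where "q i = (if even i then b (i div 2) else d (i div 2))" for i
  have "nuclear C p q"
    unfolding nuclear_def
  proof (intro conjI ballI allI)
    show "C h \<in> V" if "h \<in> V" for h using A B C that by (simp add: nuclear_def)
    show "p i \<in> V" "q i \<in> V" for i using A B by (simp_all add: nuclear_def p_def q_def)
    have "(\<lambda>i. if even i then nm (a (i div 2)) * nm (b (i div 2)) else nm (c ((i - 1) div 2)) * nm (d ((i - 1) div 2)))
       sums ((\<Sum>i. nm (c i) * nm (d i)) + (\<Sum>i. nm (a i) * nm (b i)))"
      using A B by (intro sums_if) (auto simp: nuclear_def summable_sums)
    moreover have "(\<lambda>i. if even i then nm (a (i div 2)) * nm (b (i div 2)) else nm (c ((i - 1) div 2)) * nm (d ((i - 1) div 2)))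
       = (\<lambda>i. nm (p i) * nm (q i))"
      by (auto simp: p_def q_def fun_eq_iff elim!: oddE)
    ultimately show "summable (\<lambda>i. nm (p i) * nm (q i))"
      using sums_summable by metis
    fix h k assume hk: "h \<in> V" "k \<in> V"
    have "(\<lambda>i. if even i then inn h (a (i div 2)) * inn (b (i div 2)) k else inn h (c ((i - 1) div 2)) * inn (d ((i - 1) div 2)) k)
       sums (inn (B h) k + inn (A h) k)"
      using A B hk by (intro sums_if_complex[of "\<lambda>i. inn h (c i) * inn (d i) k" _ "\<lambda>i. inn h (a i) * inn (b i) k"])
        (auto simp: nuclear_def)
    moreover have "(\<lambda>i. if even i then inn h (a (i div 2)) * inn (b (i div 2)) k else inn h (c ((i - 1) div 2)) * inn (d ((i - 1) div 2)) k)
       = (\<lambda>i. inn h (p i) * inn (q i) k)"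
      by (auto simp: p_def q_def fun_eq_iff elim!: oddE)
    ultimately show "(\<lambda>i. inn h (p i) * inn (q i) k) sums inn (C h) k"
      using A B C hk by (simp add: nuclear_def inn_add_left add.commute)
  qed
  then show ?thesis by blast
qed

text \<open>For each fixed \<open>i\<close>, Parseval gives the limit \<open><b i, a i>\<close> of
  the partial sums over the basis. The pairing bound dominates them uniformly in \<open>N\<close>,
  so Tannery's theorem exchanges the two limits. The value does not involve \<open>e\<close>, which
  makes the choice of basis in \<open>trace\<close> immaterial.\<close>

lemma nuclear_trace:
  assumes A: "nuclear A a b" and e: "orthonormal_basis e"
  shows "(\<lambda>n. inn (A (e n)) (e n)) sums (\<Sum>i. inn (b i) (a i))"
proof -
  have on: "orthonormal e" using e by (simp add: orthonormal_basis_def)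
  note eV = orthonormal_V[OF on]
  have aV: "a i \<in> V" and bV: "b i \<in> V" for i using A by (auto simp: nuclear_def)
  define S where "S i N = (\<Sum>n<N. inn (e n) (a i) * inn (b i) (e n))" for i N
  have lim: "S i \<longlonglongrightarrow> inn (b i) (a i)" for i
    using Parseval[OF e bV aV, of i i] unfolding S_def sums_def by (simp add: mult.commute)
  have bound: "cmod (S i N) \<le> nm (a i) * nm (b i)" for i N
    unfolding S_def by (rule order_trans[OF norm_sum Bessel_pairing[OF on on aV bV]])
  have "(\<lambda>N. \<Sum>i. S i N) \<longlonglongrightarrow> (\<Sum>i. inn (b i) (a i))"
    by (rule tannerys_theorem[where M = "\<lambda>i. nm (a i) * nm (b i)", THEN conjunct2, THEN conjunct2])
      (use A lim bound in \<open>auto simp: nuclear_def case_prod_unfold\<close>)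
  moreover have "(\<Sum>i. S i N) = (\<Sum>n<N. inn (A (e n)) (e n))" for N
  proof (rule sums_unique[symmetric])
    show "(\<lambda>i. S i N) sums (\<Sum>n<N. inn (A (e n)) (e n))"
      unfolding S_def by (intro sums_sum) (use A eV in \<open>auto simp: nuclear_def\<close>)
  qed
  ultimately show ?thesis by (simp add: sums_def)
qed

section \<open>Linearity, compactness and the attained norm of a nuclear operator\<close>

context
  fixes A a b
  assumes nuc: "nuclear A a b"
begin

lemma
  shows nuclear_range [simp]: "h \<in> V \<Longrightarrow> A h \<in> V"
    and nuclear_left [simp]: "a i \<in> V"
    and nuclear_right [simp]: "b i \<in> V"
    and nuclear_summable: "summable (\<lambda>i. nm (a i) * nm (b i))"
    and nuclear_sums: "h \<in> V \<Longrightarrow> k \<in> V \<Longrightarrow> (\<lambda>i. inn h (a i) * inn (b i) k) sums inn (A h) k"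
  using nuc by (auto simp: nuclear_def)

text \<open>Against every \<open>k\<close> both sides have the same convergent series, and a vector
  is determined by its inner products.\<close>

lemma nuclear_lincomb:
  assumes "x \<in> V" "y \<in> V"
  shows "A (x + c *\<^sub>C y) = A x + c *\<^sub>C A y"
proof (rule eq_if_inn_eq)
  fix k assume k: "k \<in> V"
  have "(\<lambda>i. inn x (a i) * inn (b i) k + c * (inn y (a i) * inn (b i) k)) sums (inn (A x) k + c * inn (A y) k)"
    by (intro sums_add sums_mult nuclear_sums assms k)
  moreover have "(\<lambda>i. inn (x + c *\<^sub>C y) (a i) * inn (b i) k) sums inn (A (x + c *\<^sub>C y)) k"
    using assms k by (intro nuclear_sums) auto
  ultimately show "inn (A (x + c *\<^sub>C y)) k = inn (A x + c *\<^sub>C A y) k"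
    using assms k by (simp add: inn_simps algebra_simps sums_unique2)
qed (use assms in auto)

lemma nuclear_add: "x \<in> V \<Longrightarrow> y \<in> V \<Longrightarrow> A (x + y) = A x + A y"
  using nuclear_lincomb[of x y 1] by simp

lemma nuclear_diff: "x \<in> V \<Longrightarrow> y \<in> V \<Longrightarrow> A (x - y) = A x - A y"
  using nuclear_lincomb[of x y "-1"] by (simp add: scale_minus_left)

lemma nuclear_zero [simp]: "A 0 = 0"
  using nuclear_diff[of 0 0] by simp

lemma nuclear_scale: "x \<in> V \<Longrightarrow> A (c *\<^sub>C x) = c *\<^sub>C A x"
  using nuclear_lincomb[of 0 x c] by simp

lemma nuclear_image_sum: "(\<And>i. i \<in> I \<Longrightarrow> x i \<in> V) \<Longrightarrow> A (\<Sum>i\<in>I. x i) = (\<Sum>i\<in>I. A (x i))"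
  by (induction I rule: infinite_finite_induct) (auto simp: nuclear_add)

text \<open>The weak expansion is tested against \<open>A x\<close> itself; cancelling one factor
  \<open>nm (A x)\<close> turns it into a norm estimate. Keeping the numbers
  \<open>inn x (a i)\<close>, rather than bounding them by \<open>nm x\<close>, is what makes the
  compactness argument possible.\<close>

lemma nuclear_nm_le_suminf:
  assumes x: "x \<in> V" and s: "summable (\<lambda>i. cmod (inn x (a i)) * nm (b i))"
  shows "nm (A x) \<le> (\<Sum>i. cmod (inn x (a i)) * nm (b i))"
proof -
  define S where "S = (\<Sum>i. cmod (inn x (a i)) * nm (b i))"
  have le: "cmod (inn x (a i) * inn (b i) (A x)) \<le> cmod (inn x (a i)) * nm (b i) * nm (A x)" for i
    using Cauchy_Schwarz[of "b i" "A x"] x by (simp add: norm_mult mult.assoc mult_left_mono)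
  have sm: "summable (\<lambda>i. cmod (inn x (a i)) * nm (b i) * nm (A x))"
    using s by (rule summable_mult2)
  have sn: "summable (\<lambda>i. cmod (inn x (a i) * inn (b i) (A x)))"
    using le by (intro summable_comparison_test'[OF sm]) auto
  have "inn (A x) (A x) = (\<Sum>i. inn x (a i) * inn (b i) (A x))"
    using nuclear_sums[of x "A x"] x sums_unique by simp
  then have "(nm (A x))\<^sup>2 \<le> cmod (\<Sum>i. inn x (a i) * inn (b i) (A x))"
    using x complex_Re_le_cmod[of "inn (A x) (A x)"] by (simp add: nm_square)
  also have "\<dots> \<le> (\<Sum>i. cmod (inn x (a i) * inn (b i) (A x)))"
    by (rule summable_norm[OF sn])
  also have "\<dots> \<le> (\<Sum>i. cmod (inn x (a i)) * nm (b i) * nm (A x))"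
    by (rule suminf_le[OF le sn sm])
  also have "\<dots> = S * nm (A x)"
    unfolding S_def by (rule suminf_mult2[OF s, symmetric])
  finally have *: "nm (A x) * nm (A x) \<le> S * nm (A x)" by (simp add: power2_eq_square)
  have "0 \<le> S" unfolding S_def using s by (intro suminf_nonneg) auto
  show ?thesis
  proof (cases "nm (A x) = 0")
    case True
    then show ?thesis using \<open>0 \<le> S\<close> by (simp add: S_def)
  next
    case False
    then have "nm (A x) > 0" using x by (simp add: order_less_le)
    then show ?thesis using * by (simp add: S_def)
  qed
qed

lemma nuclear_nm_le: "x \<in> V \<Longrightarrow> nm (A x) \<le> (\<Sum>i. nm (a i) * nm (b i)) * nm x"
proof -
  assume x: "x \<in> V"
  have le: "cmod (inn x (a i)) * nm (b i) \<le> nm (a i) * nm (b i) * nm x" for i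
    using mult_right_mono[OF Cauchy_Schwarz[of x "a i"], of "nm (b i)"] x by (simp add: mult_ac)
  have s2: "summable (\<lambda>i. nm (a i) * nm (b i) * nm x)"
    using nuclear_summable by (rule summable_mult2)
  have s1: "summable (\<lambda>i. cmod (inn x (a i)) * nm (b i))"
    using le by (intro summable_comparison_test'[OF s2]) auto
  show ?thesis
    using order_trans[OF nuclear_nm_le_suminf[OF x s1] suminf_le[OF le s1 s2]]
    by (simp add: suminf_mult2[OF nuclear_summable])
qed

text \<open>A diagonal subsequence makes \<open>inn (X (r n)) (a i)\<close> converge for every
  \<open>i\<close>. Each term of the series that dominates
  \<open>nm (A (X (r m)) - A (X (r n)))\<close> then tends to 0, and Tannery's theorem carries this
  over to the sum.\<close>

lemma nuclear_compact:
  assumes X: "\<And>n. X n \<in> V" and bound: "\<And>n. nm (X n) \<le> 1"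
  obtains r where "strict_mono (r :: nat \<Rightarrow> nat)"
    "\<And>\<epsilon>. \<epsilon> > 0 \<Longrightarrow> \<exists>M. \<forall>m\<ge>M. \<forall>n\<ge>M. nm (A (X (r m)) - A (X (r n))) < \<epsilon>"
proof -
  interpret subseqs "\<lambda>i s. convergent (\<lambda>n. inn (X (s n)) (a i))"
  proof
    fix i and s :: "nat \<Rightarrow> nat"
    have "cmod (inn (X (s n)) (a i)) \<le> nm (a i)" for n
    proof -
      have "cmod (inn (X (s n)) (a i)) \<le> nm (X (s n)) * nm (a i)" using X by (intro Cauchy_Schwarz) auto
      also have "\<dots> \<le> 1 * nm (a i)" using bound by (intro mult_right_mono) auto
      finally show ?thesis by simp
    qed
    then have "bounded (range (\<lambda>n. inn (X (s n)) (a i)))"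
      unfolding bounded_iff by auto
    then obtain l q where "strict_mono q" "((\<lambda>n. inn (X (s n)) (a i)) \<circ> q) \<longlonglongrightarrow> l"
      using bounded_imp_convergent_subsequence by blast
    then show "\<exists>r'. strict_mono r' \<and> convergent (\<lambda>n. inn (X ((s \<circ> r') n)) (a i))"
      unfolding convergent_def by (auto simp: o_def)
  qed
  define r where "r = diagseq"
  have r: "strict_mono r" unfolding r_def by (rule subseq_diagseq)
  \<comment> \<open>The diagonal sequence is a subsequence of the \<open>i\<close>-th stage only
    from index \<open>Suc i\<close> on; a shift of the index does not affect convergence.\<close>
  have conv: "convergent (\<lambda>n. inn (X (r n)) (a i))" for i
  proof -
    have "convergent (\<lambda>n. inn (X ((diagseq \<circ> (+) (Suc i)) n)) (a i))"
    proof (rule diagseq_holds)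
      fix q s :: "nat \<Rightarrow> nat" and n
      assume "strict_mono q" "convergent (\<lambda>k. inn (X (s k)) (a n))"
      then show "convergent (\<lambda>k. inn (X ((s \<circ> q) k)) (a n))"
        using convergent_subseq_convergent[of "\<lambda>k. inn (X (s k)) (a n)" q] by (simp add: o_def)
    qed
    then show ?thesis
      using convergent_ignore_initial_segment[of "\<lambda>n. inn (X (r n)) (a i)" "Suc i"]
      by (simp add: r_def add.commute)
  qed
  define D where "D i p = cmod (inn (X (r (fst p)) - X (r (snd p))) (a i)) * nm (b i)" for i and p :: "nat \<times> nat"
  \<comment> \<open>The Cauchy condition lets both indices grow independently, hence the limit is
    taken along the product filter.\<close>
  define F where "F = (sequentially \<times>\<^sub>F sequentially :: (nat \<times> nat) filter)"
  have Dlim: "((\<lambda>p. D i p) \<longlongrightarrow> 0) F" for i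
  proof -
    obtain l where l: "(\<lambda>n. inn (X (r n)) (a i)) \<longlonglongrightarrow> l" using conv[of i] by (auto simp: convergent_def)
    have "((\<lambda>p. inn (X (r (fst p))) (a i)) \<longlongrightarrow> l) F" "((\<lambda>p. inn (X (r (snd p))) (a i)) \<longlongrightarrow> l) F"
      unfolding F_def by (auto intro!: filterlim_compose[OF l] filterlim_fst filterlim_snd)
    then have "((\<lambda>p. cmod (inn (X (r (fst p))) (a i) - inn (X (r (snd p))) (a i)) * nm (b i)) \<longlongrightarrow> cmod (l - l) * nm (b i)) F"
      by (intro tendsto_intros)
    then show ?thesis unfolding D_def using X by (simp add: inn_diff_left)
  qed
  have Dle: "D i p \<le> 2 * (nm (a i) * nm (b i))" for i p
  proof -
    have "nm (X (r (fst p)) - X (r (snd p))) \<le> 2"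
      using nm_triangle_diff[of "X (r (fst p))" 0 "X (r (snd p))"] bound[of "r (fst p)"] bound[of "r (snd p)"]
        nm_minus_commute[of 0 "X (r (snd p))"] X by simp
    then have "cmod (inn (X (r (fst p)) - X (r (snd p))) (a i)) \<le> 2 * nm (a i)"
      using Cauchy_Schwarz[of "X (r (fst p)) - X (r (snd p))" "a i"] X
        mult_right_mono[of "nm (X (r (fst p)) - X (r (snd p)))" 2 "nm (a i)"] by simp
    then show ?thesis unfolding D_def mult.assoc[symmetric] by (intro mult_right_mono) auto
  qed
  have Dge: "0 \<le> D i p" for i p unfolding D_def by simp
  have summ: "summable (\<lambda>i. 2 * (nm (a i) * nm (b i)))" using nuclear_summable by (rule summable_mult)
  have tan: "((\<lambda>p. \<Sum>i. D i p) \<longlongrightarrow> (\<Sum>i. 0)) F"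
    by (rule tannerys_theorem[where M = "\<lambda>i. 2 * (nm (a i) * nm (b i))", THEN conjunct2, THEN conjunct2])
      (use Dlim Dle Dge summ in \<open>auto simp: case_prod_unfold F_def prod_filter_eq_bot\<close>)
  have "\<exists>M. \<forall>m\<ge>M. \<forall>n\<ge>M. nm (A (X (r m)) - A (X (r n))) < \<epsilon>" if "\<epsilon> > 0" for \<epsilon>
  proof -
    have "\<forall>\<^sub>F p in F. (\<Sum>i. D i p) < \<epsilon>"
      using order_tendstoD(2)[OF tan, of \<epsilon>] that by simp
    then obtain P Q where PQ: "\<forall>\<^sub>F n in sequentially. P n" "\<forall>\<^sub>F n in sequentially. Q n"
      "\<And>m n. P m \<Longrightarrow> Q n \<Longrightarrow> (\<Sum>i. D i (m, n)) < \<epsilon>"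
      unfolding F_def eventually_prod_filter by auto
    from PQ(1,2) have "\<forall>\<^sub>F n in sequentially. P n \<and> Q n" by (rule eventually_conj)
    then obtain M where M: "\<And>n. n \<ge> M \<Longrightarrow> P n \<and> Q n" unfolding eventually_sequentially by blast
    have "nm (A (X (r m)) - A (X (r n))) < \<epsilon>" if "m \<ge> M" "n \<ge> M" for m n
    proof -
      have "summable (\<lambda>i. D i (m, n))"
        using Dle Dge by (intro summable_comparison_test'[OF summ]) auto
      then have "nm (A (X (r m) - X (r n))) \<le> (\<Sum>i. D i (m, n))"
        using nuclear_nm_le_suminf[of "X (r m) - X (r n)"] X by (simp add: D_def)
      also have "\<dots> < \<epsilon>" using PQ(3) M that by blast
      finally show ?thesis using X by (simp add: nuclear_diff)
    qed
    then show ?thesis by blast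
  qed
  with r that show thesis by blast
qed

text \<open>If \<open>A (x\<^sub>m)\<close> is Cauchy along a maximising sequence of unit vectors, the parallelogram law forces
  \<open>x\<^sub>m\<close> itself to be Cauchy; hence the norm of a compact operator is attained.\<close>

lemma nuclear_norm_attained:
  assumes cV: "\<And>j. j < n \<Longrightarrow> c j \<in> V"
    and x0: "x0 \<in> V" "nm x0 = 1" "\<And>j. j < (n::nat) \<Longrightarrow> inn x0 (c j) = 0"
  shows "\<exists>u\<in>V. nm u = 1 \<and> (\<forall>j<n. inn u (c j) = 0) \<and>
    (\<forall>x\<in>V. (\<forall>j<n. inn x (c j) = 0) \<longrightarrow> nm (A x) \<le> nm (A u) * nm x)"
proof -
  define W where "W = {x \<in> V. \<forall>j<n. inn x (c j) = 0}"
  define T where "T = (\<lambda>x. nm (A x)) ` {x \<in> W. nm x = 1}"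
  define s where "s = Sup T"
  have x0W: "x0 \<in> W" using x0 by (simp add: W_def)
  have "nm (A x0) \<in> T" using x0 x0W by (auto simp: T_def)
  have bdd: "bdd_above T"
    unfolding T_def W_def using nuclear_nm_le by (intro bdd_aboveI2[of _ _ "\<Sum>i. nm (a i) * nm (b i)"]) fastforce
  have W_V: "x \<in> W \<Longrightarrow> x \<in> V" for x by (simp add: W_def)
  have W_add: "x \<in> W \<Longrightarrow> y \<in> W \<Longrightarrow> x + y \<in> W" for x y
    using cV by (simp add: W_def inn_add_left)
  have W_scale: "x \<in> W \<Longrightarrow> k *\<^sub>C x \<in> W" for x k
    using cV by (simp add: W_def inn_scale_left)
  have s_ge: "nm (A x) \<le> s * nm x" if "x \<in> W" for x
  proof (cases "nm x = 0")
    case True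
    then show ?thesis using nm_eq_0[of x] W_V[OF that] by simp
  next
    case False
    then have pos: "nm x > 0" using W_V[OF that] by (simp add: order_less_le)
    define y where "y = of_real (1 / nm x) *\<^sub>C x"
    have "nm (A y) \<in> T"
      unfolding T_def using that pos W_scale[OF that] W_V[OF that]
      by (auto simp: y_def nm_scale norm_divide)
    then have "nm (A y) \<le> s" unfolding s_def using bdd by (rule cSup_upper)
    moreover have "nm (A y) = nm (A x) / nm x"
      unfolding y_def using W_V[OF that] pos by (simp add: nuclear_scale nm_scale norm_divide)
    ultimately show ?thesis using pos by (simp add: divide_le_eq)
  qed
  have "0 \<le> s" using cSup_upper[OF \<open>nm (A x0) \<in> T\<close> bdd] x0 unfolding s_def by (meson nuclear_range nm_ge0 order_trans)
  have "\<exists>u\<in>W. nm u = 1 \<and> nm (A u) = s"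
  \<comment> \<open>If \<open>s = 0\<close>, every unit vector of \<open>W\<close> attains the
    supremum. Otherwise the Cauchy estimate for the maximising sequence divides by \<open>s\<close>
    squared.\<close>
  proof (cases "s = 0")
    case True
    then show ?thesis using s_ge[OF x0W] x0 x0W by (intro bexI[of _ x0]) (auto intro: antisym)
  next
    case False
    then have s: "s > 0" using \<open>0 \<le> s\<close> by simp
    have "\<exists>x. x \<in> W \<and> nm x = 1 \<and> s - 1 / Suc k < nm (A x)" for k
    proof -
      have "s - 1 / Suc k < Sup T" by (simp add: s_def)
      then show ?thesis using less_cSup_iff[OF _ bdd, of "s - 1 / Suc k"] \<open>nm (A x0) \<in> T\<close>
        unfolding T_def by auto
    qed
    then obtain X where X: "\<And>k. X k \<in> W" "\<And>k. nm (X k) = 1" "\<And>k. s - 1 / Suc k < nm (A (X k))" by metis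
    have XV: "X k \<in> V" for k using X W_V by blast
    have AXlim: "(\<lambda>k. nm (A (X k))) \<longlonglongrightarrow> s"
    proof (rule tendsto_sandwich)
      show "\<forall>\<^sub>F k in sequentially. s - 1 / Suc k \<le> nm (A (X k))" using X(3) by (intro always_eventually allI less_imp_le)
      show "\<forall>\<^sub>F k in sequentially. nm (A (X k)) \<le> s" using s_ge[OF X(1)] X(2) by auto
      show "(\<lambda>k. s - 1 / Suc k) \<longlonglongrightarrow> s"
        using tendsto_diff[OF tendsto_const LIMSEQ_Suc[OF lim_1_over_n], of s] by simp
    qed auto
    obtain r where r: "strict_mono (r :: nat \<Rightarrow> nat)"
      and rC: "\<And>\<epsilon>. \<epsilon> > 0 \<Longrightarrow> \<exists>M. \<forall>m\<ge>M. \<forall>n\<ge>M. nm (A (X (r m)) - A (X (r n))) < \<epsilon>"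
      using nuclear_compact[of X] XV X(2) by (metis order_refl)
    define Y where "Y = X \<circ> r"
    have YW: "Y k \<in> W" and YV: "Y k \<in> V" and nmY: "nm (Y k) = 1" for k
      using X XV by (auto simp: Y_def)
    have AYlim: "(\<lambda>k. nm (A (Y k))) \<longlonglongrightarrow> s"
      using LIMSEQ_subseq_LIMSEQ[OF AXlim r] by (simp add: Y_def o_def)
    have parallelogram: "(nm (x + y))\<^sup>2 + (nm (x - y))\<^sup>2 = 2 * (nm x)\<^sup>2 + 2 * (nm y)\<^sup>2"
      if "x \<in> V" "y \<in> V" for x y using that by (simp add: nm_add_square nm_diff_square)
    have "\<exists>M. \<forall>m\<ge>M. \<forall>n\<ge>M. nm (Y m - Y n) < \<epsilon>" if "\<epsilon> > 0" for \<epsilon>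
    proof -
      \<comment> \<open>The parallelogram law for the images gives
        \<open>s^2 * nm (Y m + Y k)^2 > 4 * s^2 - 5 * \<eta>\<close>. The law for the vectors
        themselves then leaves less than \<open>8 * \<eta> = s^2 * \<epsilon>^2\<close> for
        \<open>s^2 * nm (Y m - Y k)^2\<close>.\<close>
      define \<eta> where "\<eta> = s\<^sup>2 * \<epsilon>\<^sup>2 / 8"
      have \<eta>: "\<eta> > 0" using s that by (simp add: \<eta>_def)
      obtain M1 where M1: "\<And>m n. m \<ge> M1 \<Longrightarrow> n \<ge> M1 \<Longrightarrow> nm (A (Y m) - A (Y n)) < sqrt \<eta>"
        using rC[of "sqrt \<eta>"] \<eta> by (auto simp: Y_def)
      have "(\<lambda>k. (nm (A (Y k)))\<^sup>2) \<longlonglongrightarrow> s\<^sup>2" using AYlim by (intro tendsto_intros)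
      then have "\<forall>\<^sub>F k in sequentially. s\<^sup>2 - \<eta> < (nm (A (Y k)))\<^sup>2"
        using \<eta> by (intro order_tendstoD) auto
      then obtain M2 where M2: "\<And>k. k \<ge> M2 \<Longrightarrow> s\<^sup>2 - \<eta> < (nm (A (Y k)))\<^sup>2"
        unfolding eventually_sequentially by blast
      have "nm (Y m - Y k) < \<epsilon>" if mk: "m \<ge> max M1 M2" "k \<ge> max M1 M2" for m k
      proof -
        have "(nm (A (Y m) - A (Y k)))\<^sup>2 < (sqrt \<eta>)\<^sup>2"
          using M1[of m k] mk YV by (intro power_strict_mono) auto
        then have 1: "(nm (A (Y m) - A (Y k)))\<^sup>2 < \<eta>" using \<eta> by simp
        have 2: "(nm (A (Y m) + A (Y k)))\<^sup>2 + (nm (A (Y m) - A (Y k)))\<^sup>2 > 4 * s\<^sup>2 - 4 * \<eta>"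
          using parallelogram[of "A (Y m)" "A (Y k)"] M2[of m] M2[of k] mk YV by simp
        have "nm (A (Y m + Y k)) \<le> s * nm (Y m + Y k)" by (intro s_ge W_add YW)
        then have "(nm (A (Y m) + A (Y k)))\<^sup>2 \<le> (s * nm (Y m + Y k))\<^sup>2"
          using YV by (intro power_mono) (auto simp: nuclear_add)
        then have 3: "4 * s\<^sup>2 - 5 * \<eta> < s\<^sup>2 * (nm (Y m + Y k))\<^sup>2"
          using 1 2 by (simp add: power_mult_distrib)
        have "s\<^sup>2 * (nm (Y m + Y k))\<^sup>2 + s\<^sup>2 * (nm (Y m - Y k))\<^sup>2 = 4 * s\<^sup>2"
          using parallelogram[OF YV YV, of m k] nmY by (simp add: distrib_left[symmetric])
        then have "s\<^sup>2 * (nm (Y m - Y k))\<^sup>2 < 8 * \<eta>" using 3 \<eta> by linarith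
        then have "(nm (Y m - Y k))\<^sup>2 < \<epsilon>\<^sup>2" using s by (simp add: \<eta>_def)
        then show ?thesis using \<open>\<epsilon> > 0\<close> by (simp add: power_less_imp_less_base)
      qed
      then show ?thesis by blast
    qed
    then obtain u where u: "u \<in> V" "(\<lambda>n. nm (Y n - u)) \<longlonglongrightarrow> 0"
      using complete[of Y] YV by blast
    have "inn u (c j) = 0" if "j < n" for j
      using tendsto_inn_left[OF YV u(1) cV[OF that] u(2)] YW that
      by (simp add: W_def LIMSEQ_const_iff)
    moreover have "nm u = 1"
      using tendsto_nm[OF YV u] nmY by (simp add: LIMSEQ_const_iff)
    moreover have "nm (A u) = s"
    proof -
      have "(\<lambda>n. nm (A (Y n) - A u)) \<longlonglongrightarrow> 0"
      proof (rule Lim_null_comparison)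
        show "\<forall>\<^sub>F n in sequentially. norm (nm (A (Y n) - A u)) \<le> (\<Sum>i. nm (a i) * nm (b i)) * nm (Y n - u)"
          using nuclear_nm_le[of "Y _ - u"] YV u by (simp add: nuclear_diff)
        show "(\<lambda>n. (\<Sum>i. nm (a i) * nm (b i)) * nm (Y n - u)) \<longlonglongrightarrow> 0"
          using tendsto_mult_left[OF u(2)] by simp
      qed
      then have "(\<lambda>n. nm (A (Y n))) \<longlonglongrightarrow> nm (A u)"
        using YV u by (intro tendsto_nm) auto
      then show ?thesis using AYlim LIMSEQ_unique by blast
    qed
    ultimately show ?thesis using u by (auto simp: W_def)
  qed
  then show ?thesis using s_ge by (auto simp: W_def)
qed

text \<open>A first variation. Put \<open>c = r * \<gamma>\<close> with
  \<open>\<gamma> = <A u, A x>\<close>: the squared norm of the image grows at least by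
  \<open>2 * r * |\<gamma>|^2\<close>, whereas that of \<open>u + c x\<close> changes only by a
  multiple of \<open>r^2\<close>. For the small value \<open>r = 1 / (M + 1)\<close> this
  contradicts maximality unless \<open>\<gamma> = 0\<close>.\<close>

lemma nuclear_orthogonal_images:
  assumes x: "x \<in> V" and u: "u \<in> V" "nm u = 1" and xu: "inn x u = 0"
    and max: "\<And>c. nm (A (u + c *\<^sub>C x)) \<le> nm (A u) * nm (u + c *\<^sub>C x)"
  shows "inn (A x) (A u) = 0"
proof (rule ccontr)
  define \<gamma> where "\<gamma> = inn (A u) (A x)"
  assume "inn (A x) (A u) \<noteq> 0"
  then have \<gamma>: "\<gamma> \<noteq> 0" using inn_cnj[of "A u" "A x"] x u by (auto simp: \<gamma>_def)
  define M where "M = (nm (A u))\<^sup>2 * (nm x)\<^sup>2"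
  have ux: "inn u x = 0" using inn_cnj[of x u] x u xu by simp
  have *: "2 * r * (cmod \<gamma>)\<^sup>2 \<le> r\<^sup>2 * (cmod \<gamma>)\<^sup>2 * M" for r :: real
  proof -
    define c where "c = of_real r * \<gamma>"
    have "(nm (A (u + c *\<^sub>C x)))\<^sup>2 \<le> (nm (A u) * nm (u + c *\<^sub>C x))\<^sup>2"
      using max x u by (intro power_mono) auto
    moreover have "(nm (A (u + c *\<^sub>C x)))\<^sup>2 \<ge> (nm (A u))\<^sup>2 + 2 * r * (cmod \<gamma>)\<^sup>2"
    proof -
      have "Re (inn (A u) (c *\<^sub>C A x)) = r * (cmod \<gamma>)\<^sup>2"
        using x u by (simp add: inn_scale_right \<gamma>_def[symmetric] c_def) (simp add: cmod_def power2_eq_square algebra_simps)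
      then show ?thesis using x u by (simp add: nuclear_lincomb nm_add_square)
    qed
    moreover have "(nm (u + c *\<^sub>C x))\<^sup>2 = 1 + r\<^sup>2 * (cmod \<gamma>)\<^sup>2 * (nm x)\<^sup>2"
      using x u ux by (simp add: nm_add_square inn_scale_right nm_scale c_def norm_mult power_mult_distrib)
    ultimately show ?thesis by (simp add: M_def power_mult_distrib algebra_simps)
  qed
  have M: "M \<ge> 0" by (simp add: M_def)
  have "2 * (1 / (M + 1)) * (cmod \<gamma>)\<^sup>2 \<le> (1 / (M + 1))\<^sup>2 * (cmod \<gamma>)\<^sup>2 * M" by (rule *)
  then have "(cmod \<gamma>)\<^sup>2 * (2 * (M + 1)) \<le> (cmod \<gamma>)\<^sup>2 * M"
    using M by (simp add: power2_eq_square divide_simps mult_ac)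
  then show False using M \<gamma> by simp
qed

end

declare nuclear_range [simp del] nuclear_left [simp del] nuclear_right [simp del] nuclear_zero [simp del]

text \<open>The singular value \<open>s n\<close> is the norm of \<open>A\<close> on the orthogonal
  complement of \<open>u 0\<close>, ..., \<open>u (n - 1)\<close>, attained at \<open>u n\<close>,
  and \<open>v n\<close> is the direction of the image. Orthogonality of the images comes from the
  first variation, summability of \<open>s\<close> from pairing \<open>u\<close> with
  \<open>v\<close> in the given expansion, and convergence from the maximality of each
  \<open>s n\<close>. The sequence \<open>w\<close> keeps the construction from running out of
  dimensions.\<close>

theorem nuclear_Schmidt_decomposition:
  assumes nuc: "nuclear A a b" and w: "orthonormal w"
  obtains u v and s :: "nat \<Rightarrow> real"
  where "orthonormal u" "orthonormal v" "\<And>n. 0 \<le> s n" "summable s"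
    "\<And>h. h \<in> V \<Longrightarrow> (\<lambda>N. nm (A h - (\<Sum>n<N. (of_real (s n) * inn h (u n)) *\<^sub>C v n))) \<longlonglongrightarrow> 0"
proof -
  \<comment> \<open>\<open>P f n r\<close> says that the triple \<open>r\<close> is admissible at
    stage \<open>n\<close>, given the triples \<open>f j\<close> for \<open>j < n\<close>.\<close>
  define P where "P f n r \<longleftrightarrow> (case r of (u, v, s) \<Rightarrow>
     u \<in> V \<and> v \<in> V \<and> nm u = 1 \<and> nm v = 1 \<and> 0 \<le> s \<and> A u = of_real s *\<^sub>C v \<and>
     (\<forall>j<n. inn u (fst (f j)) = 0) \<and> (\<forall>j<n. inn v (fst (snd (f j))) = 0) \<and>
     (\<forall>x\<in>V. (\<forall>j<n. inn x (fst (f j)) = 0) \<longrightarrow> nm (A x) \<le> s * nm x))"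
    for f :: "nat \<Rightarrow> 'a \<times> 'a \<times> real" and n r
  have AV: "x \<in> V \<Longrightarrow> A x \<in> V" for x using nuclear_range[OF nuc] by simp
  have kron: "inn (g i) (g j) = (if i = j then 1 else 0)"
    if g: "\<And>m. m < n \<Longrightarrow> g m \<in> V \<and> nm (g m) = 1" and orth: "\<And>m j. m < n \<Longrightarrow> j < m \<Longrightarrow> inn (g m) (g j) = 0"
      and ij: "i < n" "j < n" for g :: "nat \<Rightarrow> 'a" and i j n
  proof (cases i j rule: linorder_cases)
    case less
    then show ?thesis using orth[of j i] g ij inn_cnj[of "g j" "g i"] by auto
  next
    case equal
    then show ?thesis using g[OF ij(1)] by (simp add: inn_self)
  next
    case greater
    then show ?thesis using orth[of i j] ij by auto
  qed
  have step: "\<exists>r. P f n r" if prev: "\<And>m. m < n \<Longrightarrow> P f m (f m)" for f n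
  proof -
    define u where "u j = fst (f j)" for j
    define v where "v j = fst (snd (f j))" for j
    define s where "s j = snd (snd (f j))" for j
    have p: "u m \<in> V" "v m \<in> V" "nm (u m) = 1" "nm (v m) = 1" "0 \<le> s m" "A (u m) = of_real (s m) *\<^sub>C v m"
        "\<And>j. j < m \<Longrightarrow> inn (u m) (u j) = 0" "\<And>j. j < m \<Longrightarrow> inn (v m) (v j) = 0"
        "\<And>x. x \<in> V \<Longrightarrow> (\<And>j. j < m \<Longrightarrow> inn x (u j) = 0) \<Longrightarrow> nm (A x) \<le> s m * nm x" if "m < n" for m
      using prev[OF that] by (auto simp: P_def u_def v_def s_def case_prod_unfold)
    obtain x0 where x0: "x0 \<in> V" "nm x0 = 1" "\<And>j. j < n \<Longrightarrow> inn x0 (u j) = 0"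
    proof -
      have "inn (u i) (u j) = (if i = j then 1 else 0)" if "i < n" "j < n" for i j
        by (rule kron[of n u]) (use p(1,3,7) that in auto)
      then have "\<exists>x\<in>V. nm x = 1 \<and> (\<forall>i<n. inn x (u i) = 0)"
        using p(1) by (intro ex_unit_orthogonal[OF w])
      with that show thesis by blast
    qed
    obtain y0 where y0: "y0 \<in> V" "nm y0 = 1" "\<And>j. j < n \<Longrightarrow> inn y0 (v j) = 0"
    proof -
      have "inn (v i) (v j) = (if i = j then 1 else 0)" if "i < n" "j < n" for i j
        by (rule kron[of n v]) (use p(2,4,8) that in auto)
      then have "\<exists>x\<in>V. nm x = 1 \<and> (\<forall>i<n. inn x (v i) = 0)"
        using p(2) by (intro ex_unit_orthogonal[OF w])
      with that show thesis by blast
    qed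
    obtain x where x: "x \<in> V" "nm x = 1" "\<And>j. j < n \<Longrightarrow> inn x (u j) = 0"
      and max: "\<forall>y\<in>V. (\<forall>j<n. inn y (u j) = 0) \<longrightarrow> nm (A y) \<le> nm (A x) * nm y"
    proof -
      have "\<exists>x\<in>V. nm x = 1 \<and> (\<forall>j<n. inn x (u j) = 0) \<and>
          (\<forall>y\<in>V. (\<forall>j<n. inn y (u j) = 0) \<longrightarrow> nm (A y) \<le> nm (A x) * nm y)"
        by (rule nuclear_norm_attained[OF nuc p(1) x0])
      then show thesis by (elim bexE conjE) (rule that, auto)
    qed
    show ?thesis
    proof (cases "nm (A x) = 0")
      case True
      have "A x = 0" using True nm_eq_0 AV[OF x(1)] by blast
      \<comment> \<open>With singular value 0 the vector \<open>v n\<close> does not affect the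
        expansion, but the sequence must stay orthonormal, so \<open>y0\<close> is used.\<close>
      then have "P f n (x, y0, 0)"
        using x y0 max True by (auto simp: P_def u_def v_def)
      then show ?thesis by blast
    next
      case False
      define y where "y = of_real (1 / nm (A x)) *\<^sub>C A x"
      have Ax: "nm (A x) > 0" using False AV[OF x(1)] by (simp add: order_less_le)
      have y: "y \<in> V" "nm y = 1" "A x = of_real (nm (A x)) *\<^sub>C y"
        using Ax AV[OF x(1)] by (auto simp: y_def nm_scale norm_divide)
      have "inn y (v j) = 0" if j: "j < n" for j
      proof -
        \<comment> \<open>\<open>x\<close> also competed at the earlier stage \<open>j\<close>.
          Consequently \<open>s j\<close> is positive and can be cancelled at the end.\<close>
        have le: "nm (A x) \<le> s j"
          using p(9)[OF j, of x] x j by simp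
        have nmAu: "nm (A (u j)) = s j"
          using p[OF j] by (simp add: nm_scale)
        have "inn (A x) (A (u j)) = 0"
        proof (rule nuclear_orthogonal_images[OF nuc])
          fix c
          show "nm (A (u j + c *\<^sub>C x)) \<le> nm (A (u j)) * nm (u j + c *\<^sub>C x)"
            unfolding nmAu
          proof (rule p(9)[OF j])
            fix i assume i: "i < j"
            show "inn (u j + c *\<^sub>C x) (u i) = 0"
              using p(7)[OF j i] p(1)[OF j] p(1)[of i] x i j by (simp add: inn_simps)
          qed (use p(1)[OF j] x in auto)
        qed (use p[OF j] x j in auto)
        then have "of_real (s j) * inn (A x) (v j) = 0"
          using p[OF j] AV[OF x(1)] by (simp add: inn_scale_right)
        then have "inn (A x) (v j) = 0" using le Ax by auto
        then show ?thesis using p[OF j] AV[OF x(1)] by (simp add: y_def inn_scale_left)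
      qed
      then have "P f n (x, y, nm (A x))"
        using x y max Ax by (auto simp: P_def u_def v_def)
      then show ?thesis by blast
    qed
  qed
  \<comment> \<open>Each triple depends on all earlier ones, not just on its predecessor; hence
    dependent choice along a well-order.\<close>
  have "\<exists>f. \<forall>n. P f n (f n)"
  proof (rule dependent_wellorder_choice)
    show "P f n r = P g n r" if "\<And>m. m < n \<Longrightarrow> f m = g m" for r f g n
      using that by (simp add: P_def case_prod_unfold)
    show "\<exists>r. P f n r" if "\<And>m. m < n \<Longrightarrow> P f m (f m)" for n f
      using step that by blast
  qed
  then obtain f where f: "\<And>n. P f n (f n)" by blast
  define u where "u j = fst (f j)" for j
  define v where "v j = fst (snd (f j))" for j
  define s where "s j = snd (snd (f j))" for j
  have p: "u m \<in> V" "v m \<in> V" "nm (u m) = 1" "nm (v m) = 1" "0 \<le> s m" "A (u m) = of_real (s m) *\<^sub>C v m"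
      "\<And>j. j < m \<Longrightarrow> inn (u m) (u j) = 0" "\<And>j. j < m \<Longrightarrow> inn (v m) (v j) = 0"
      "\<And>x. x \<in> V \<Longrightarrow> (\<And>j. j < m \<Longrightarrow> inn x (u j) = 0) \<Longrightarrow> nm (A x) \<le> s m * nm x" for m
    using f[of m] by (auto simp: P_def u_def v_def s_def case_prod_unfold)
  have u: "orthonormal u"
    unfolding orthonormal_def
  proof (intro conjI allI)
    show "inn (u i) (u j) = (if i = j then 1 else 0)" for i j
      by (rule kron[of "Suc (max i j)" u]) (use p(1,3,7) in auto)
  qed (rule p)
  have v: "orthonormal v"
    unfolding orthonormal_def
  proof (intro conjI allI)
    show "inn (v i) (v j) = (if i = j then 1 else 0)" for i j
      by (rule kron[of "Suc (max i j)" v]) (use p(2,4,8) in auto)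
  qed (rule p)
  have "summable s"
  proof (rule summableI_nonneg_bounded)
    fix N
    \<comment> \<open>The partial sum of \<open>s\<close> is the sum of the
      \<open><A (u n), v n>\<close>. Expanding each of these by nuclearity and summing over
      \<open>n\<close> first allows the pairing bound to be applied for every
      \<open>i\<close>.\<close>
    have sums: "(\<lambda>i. \<Sum>n<N. inn (u n) (a i) * inn (b i) (v n)) sums (\<Sum>n<N. inn (A (u n)) (v n))"
      by (intro sums_sum nuclear_sums[OF nuc] p)
    have "(\<Sum>n<N. inn (A (u n)) (v n)) = of_real (\<Sum>n<N. s n)"
      using orthonormal_inn[OF v] p by (simp add: inn_scale_left)
    then have "(\<Sum>n<N. s n) = Re (\<Sum>i. \<Sum>n<N. inn (u n) (a i) * inn (b i) (v n))"
      using sums_unique[OF sums] by (metis Re_complex_of_real)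
    also have "\<dots> \<le> cmod (\<Sum>i. \<Sum>n<N. inn (u n) (a i) * inn (b i) (v n))"
      by (rule complex_Re_le_cmod)
    also have "\<dots> \<le> (\<Sum>i. nm (a i) * nm (b i))"
    proof -
      have le: "cmod (\<Sum>n<N. inn (u n) (a i) * inn (b i) (v n)) \<le> nm (a i) * nm (b i)" for i
        by (rule order_trans[OF norm_sum Bessel_pairing[OF u v nuclear_left[OF nuc] nuclear_right[OF nuc]]])
      then show ?thesis by (intro norm_suminf_le nuclear_summable[OF nuc])
    qed
    finally show "(\<Sum>n<N. s n) \<le> (\<Sum>i. nm (a i) * nm (b i))" .
  qed (use p in auto)
  moreover have "(\<lambda>N. nm (A h - (\<Sum>n<N. (of_real (s n) * inn h (u n)) *\<^sub>C v n))) \<longlonglongrightarrow> 0" if h: "h \<in> V" for h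
  proof (rule Lim_null_comparison)
    show "(\<lambda>N. s N * nm h) \<longlonglongrightarrow> 0"
      using tendsto_mult_right[OF summable_LIMSEQ_zero[OF \<open>summable s\<close>], of "nm h"] by simp
    \<comment> \<open>The remainder after \<open>N\<close> terms is the image of a vector orthogonal
      to \<open>u 0\<close>, ..., \<open>u (N - 1)\<close>, so the maximality at stage
      \<open>N\<close> bounds it.\<close>
    have "nm (A h - (\<Sum>n<N. (of_real (s n) * inn h (u n)) *\<^sub>C v n)) \<le> s N * nm h" for N
    proof -
      define x where "x = h - (\<Sum>n<N. inn h (u n) *\<^sub>C u n)"
      have x: "x \<in> V" using h p by (simp add: x_def)
      have "A h - (\<Sum>n<N. (of_real (s n) * inn h (u n)) *\<^sub>C v n) = A x"
        using h p(1,2,6) by (simp add: x_def nuclear_diff[OF nuc] nuclear_image_sum[OF nuc] nuclear_scale[OF nuc] mult.commute)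
      moreover have "nm (A x) \<le> s N * nm x"
        using x unfolding x_def
        by (intro p(9)) (use h p orthonormal_inn[OF u] in \<open>auto intro!: residual_orthogonal\<close>)
      moreover have "nm x \<le> nm h"
      proof -
        have "(nm x)\<^sup>2 \<le> (nm h)\<^sup>2"
          unfolding x_def using h p orthonormal_inn[OF u] by (subst residual_nm) (auto intro: sum_nonneg)
        then show ?thesis by (rule power2_le_imp_le) (use h in auto)
      qed
      ultimately show ?thesis using mult_left_mono[of "nm x" "nm h" "s N"] p(5)[of N] by simp
    qed
    then show "\<forall>\<^sub>F N in sequentially. norm (nm (A h - (\<Sum>n<N. (of_real (s n) * inn h (u n)) *\<^sub>C v n))) \<le> s N * nm h"
      using h p(2) AV by simp
  qed
  ultimately show thesis by (intro that[OF u v p(5)])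
qed

end

section \<open>The weighted measure on the disc\<close>

text \<open>Serves to transport the invariance of Lebesgue measure under orthogonal maps of the real
  plane to the complex plane.\<close>

lemma lborel_complex_of_cart:
  "distr lborel borel (\<lambda>x::real^2. Complex (x $ 1) (x $ 2)) = (lborel :: complex measure)"
proof (rule lborel_eqI[symmetric])
  have [measurable]: "(\<lambda>x::real^2. Complex (x $ 1) (x $ 2)) \<in> borel_measurable borel"
    unfolding Complex_eq by (intro borel_measurable_continuous_onI continuous_intros)
  fix l u :: complex assume le: "\<And>b. b \<in> Basis \<Longrightarrow> l \<bullet> b \<le> u \<bullet> b"
  define l' u' :: "real^2" where "l' = vector [Re l, Im l]" and "u' = vector [Re u, Im u]"
  have le': "Re l \<le> Re u" "Im l \<le> Im u"
    using le[of 1] le[of \<i>] by (auto simp: Basis_complex_def)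
  have eq: "(\<lambda>x::real^2. Complex (x $ 1) (x $ 2)) -` box l u = box l' u'"
    by (auto simp: box_def Basis_complex_def l'_def u'_def Basis_vec_def inner_axis forall_2)
  have "emeasure lborel (box l' u') = (\<Prod>b\<in>Basis. (u' - l') \<bullet> b)"
  proof (rule emeasure_lborel_box)
    have "l' $ i \<le> u' $ i" for i
      using le' exhaust_2[of i] by (auto simp: l'_def u'_def)
    then show "l' \<bullet> b \<le> u' \<bullet> b" if "b \<in> Basis" for b
      using that by (auto simp: Basis_vec_def inner_axis)
  qed
  also have "(\<Prod>b\<in>Basis. (u' - l') \<bullet> b) = (Re u - Re l) * (Im u - Im l)"
    by (simp add: Basis_vec_def prod.UNION_disjoint axis_eq_axis UNIV_2 inner_axis l'_def u'_def)
  also have "\<dots> = (\<Prod>b\<in>Basis. (u - l) \<bullet> b)"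
    by (simp add: Basis_complex_def)
  finally show "emeasure (distr lborel borel (\<lambda>x::real^2. Complex (x $ 1) (x $ 2))) (box l u) = (\<Prod>b\<in>Basis. (u - l) \<bullet> b)"
    by (simp add: emeasure_distr eq)
qed simp

text \<open>Lebesgue measure is determined by its values on boxes. The preimage of a box under
  multiplication by \<open>\<zeta>\<close> is its image under the inverse rotation, multiplication
  by \<open>cnj \<zeta>\<close>, which is the orthogonal map \<open>R\<close> in real
  coordinates.\<close>

lemma lborel_complex_rotate:
  assumes \<zeta>: "cmod \<zeta> = 1"
  shows "distr lborel borel (\<lambda>w. \<zeta> * w) = (lborel :: complex measure)"
proof (rule lborel_eqI[symmetric])
  let ?\<phi> = "\<lambda>x::real^2. Complex (x $ 1) (x $ 2)"
  have [measurable]: "?\<phi> \<in> borel_measurable borel"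
    unfolding Complex_eq by (intro borel_measurable_continuous_onI continuous_intros)
  have [measurable]: "(\<lambda>w. \<zeta> * w) \<in> borel_measurable borel"
    by (intro borel_measurable_continuous_onI continuous_intros)
  define R :: "real^2 \<Rightarrow> real^2" where "R x = vector [Re (cnj \<zeta> * ?\<phi> x), Im (cnj \<zeta> * ?\<phi> x)]" for x
  have \<phi>R: "?\<phi> (R x) = cnj \<zeta> * ?\<phi> x" for x
    by (simp add: R_def complex_eq_iff)
  have \<zeta>\<zeta>: "\<zeta> * cnj \<zeta> = 1"
    using \<zeta> complex_norm_square[of \<zeta>] by simp
  have lin: "linear R"
    by (rule linearI) (simp_all add: R_def vec_eq_iff forall_2 algebra_simps)
  have nrm: "norm x = cmod (?\<phi> x)" for x :: "real^2"
    by (simp add: norm_vec_def L2_set_def UNIV_2 cmod_def)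
  have "norm (R x) = norm x" for x
    unfolding nrm \<phi>R using \<zeta> by (simp add: norm_mult)
  then have R: "orthogonal_transformation R"
    using lin by (simp add: orthogonal_transformation)
  fix l u :: complex assume le: "\<And>b. b \<in> Basis \<Longrightarrow> l \<bullet> b \<le> u \<bullet> b"
  define B where "B = ?\<phi> -` box l u"
  have Bm: "B \<in> sets borel" unfolding B_def using measurable_sets_borel[of ?\<phi> borel "box l u"] by simp
  have Bem: "emeasure lborel B = emeasure lborel (box l u)"
    unfolding B_def by (subst lborel_complex_of_cart[symmetric]) (simp add: emeasure_distr)
  have fin: "emeasure lborel B < \<infinity>"
    unfolding Bem using emeasure_lborel_box_finite[of l u] by simp
  have Bl: "B \<in> lmeasurable" using Bm fin by (simp add: fmeasurable_def)
  have eq: "?\<phi> -` ((\<lambda>w. \<zeta> * w) -` box l u) = R ` B"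
  proof (intro set_eqI iffI)
    fix x assume x: "x \<in> ?\<phi> -` ((\<lambda>w. \<zeta> * w) -` box l u)"
    define y :: "real^2" where "y = vector [Re (\<zeta> * ?\<phi> x), Im (\<zeta> * ?\<phi> x)]"
    have \<phi>y: "?\<phi> y = \<zeta> * ?\<phi> x" by (simp add: y_def complex_eq_iff)
    have "?\<phi> (R y) = ?\<phi> x" unfolding \<phi>R \<phi>y using \<zeta>\<zeta> by (simp add: mult.assoc[symmetric] mult.commute)
    then have "R y = x" by (simp add: vec_eq_iff forall_2)
    moreover have "y \<in> B" using x \<phi>y by (simp add: B_def)
    ultimately show "x \<in> R ` B" by blast
  next
    fix x assume "x \<in> R ` B"
    then obtain y where y: "y \<in> B" "x = R y" by blast
    then have "\<zeta> * ?\<phi> x = ?\<phi> y" unfolding y \<phi>R using \<zeta>\<zeta> by (simp add: mult.assoc[symmetric])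
    then show "x \<in> ?\<phi> -` ((\<lambda>w. \<zeta> * w) -` box l u)" using y by (simp add: B_def)
  qed
  have RBm: "R ` B \<in> sets borel"
    unfolding eq[symmetric] using measurable_sets_borel[of "\<lambda>x. \<zeta> * ?\<phi> x" borel "box l u"]
    by (simp add: vimage_def)
  have "emeasure (distr lborel borel (\<lambda>w. \<zeta> * w)) (box l u) = emeasure lborel ((\<lambda>w. \<zeta> * w) -` box l u)"
    by (simp add: emeasure_distr)
  also have "\<dots> = emeasure lborel (R ` B)"
  proof -
    have "(\<lambda>w. \<zeta> * w) -` box l u \<in> sets borel"
      using measurable_sets_borel[of "\<lambda>w. \<zeta> * w" borel "box l u"] by simp
    then show ?thesis
      by (subst lborel_complex_of_cart[symmetric]) (simp add: emeasure_distr eq)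
  qed
  also have "\<dots> = emeasure lebesgue (R ` B)"
    using RBm by simp
  also have "\<dots> = emeasure lebesgue B"
    using measure_orthogonal_image[OF R Bl] measurable_orthogonal_image[OF R Bl] Bl
    by (simp add: emeasure_eq_measure2)
  also have "\<dots> = emeasure lborel (box l u)"
    using Bm Bem by simp
  also have "\<dots> = (\<Prod>b\<in>Basis. (u - l) \<bullet> b)"
    using le by (rule emeasure_lborel_box)
  finally show "emeasure (distr lborel borel (\<lambda>w. \<zeta> * w)) (box l u) = (\<Prod>b\<in>Basis. (u - l) \<bullet> b)" .
qed simp

section \<open>The distribution of the squared modulus, and the measure \<open>mu t\<close>\<close>

lemma emeasure_lborel_disc:
  assumes "0 \<le> r"
  shows "emeasure lborel (cball (0::complex) r) = ennreal (pi * r\<^sup>2)"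
    and "emeasure lborel (ball (0::complex) r) = ennreal (pi * r\<^sup>2)"
  using emeasure_cball[OF assms, of "0::complex"] emeasure_ball[OF assms, of "0::complex"]
  by (simp_all add: unit_ball_vol_2)

text \<open>Polar coordinates in one stroke: for \<open>0 \<le> x < 1\<close> the annulus
  \<open>x < |w|^2 < 1\<close> has area \<open>pi * (1 - x)\<close>, so \<open>|w|^2\<close> is
  uniformly distributed on the unit interval with total mass \<open>pi\<close>.\<close>

lemma distr_cmod_square_disc:
  "distr (density lborel (indicator (ball (0::complex) 1))) borel (\<lambda>w. (cmod w)\<^sup>2)
    = density lborel (\<lambda>x. ennreal pi * indicator {0..1} x)" (is "?M = ?N")
proof (rule measure_eqI_lessThan)
  have M: "emeasure ?M {x<..} = emeasure lborel ({w. x < (cmod w)\<^sup>2} \<inter> ball 0 1)" for x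
  proof -
    have [measurable]: "{w::complex. x < (cmod w)\<^sup>2} \<in> sets borel" by measurable
    show ?thesis
      by (simp add: emeasure_distr vimage_def emeasure_restricted Int_commute)
  qed
  have N: "emeasure ?N {x<..} = ennreal pi * emeasure lborel ({0..1} \<inter> {x<..})" for x
    by (simp add: emeasure_density nn_integral_cmult mult.assoc indicator_inter_arith[symmetric])
  have eq: "emeasure lborel ({w. x < (cmod w)\<^sup>2} \<inter> ball 0 1) = ennreal (pi * (1 - min 1 (max 0 x)))" for x
  proof -
    have 1: "emeasure lborel ({w. x < (cmod w)\<^sup>2} \<inter> ball 0 1) = ennreal pi" if "x < 0"
    proof -
      have "{w. x < (cmod w)\<^sup>2} \<inter> ball 0 1 = ball (0::complex) 1"
        using that by (auto intro: less_le_trans[OF _ zero_le_power2])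
      then show ?thesis using emeasure_lborel_disc(2)[of 1] by simp
    qed
    have 2: "emeasure lborel ({w. x < (cmod w)\<^sup>2} \<inter> ball 0 1) = ennreal (pi - pi * x)" if "0 \<le> x" "x < 1"
    proof -
      have *: "{w. x < (cmod w)\<^sup>2} \<inter> ball 0 1 = ball (0::complex) 1 - cball 0 (sqrt x)"
        using that real_sqrt_le_iff[of "(cmod _)\<^sup>2" x] by (auto simp: not_le[symmetric] real_le_lsqrt)
      have "sqrt x < 1" using that by simp
      then have sub: "cball (0::complex) (sqrt x) \<subseteq> ball 0 1"
        by (intro subsetI) (simp only: mem_cball mem_ball)
      have "emeasure lborel (ball (0::complex) 1 - cball 0 (sqrt x)) = ennreal pi - ennreal (pi * x)"
        using that emeasure_lborel_disc(2)[of 1] emeasure_lborel_disc(1)[of "sqrt x"]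
        by (subst emeasure_Diff[OF _ _ _ sub]) auto
      then show ?thesis using * that by (simp add: ennreal_minus)
    qed
    have 3: "{w. x < (cmod w)\<^sup>2} \<inter> ball (0::complex) 1 = {}" if "1 \<le> x"
      using that by (auto simp: power_less_one_iff abs_square_less_1) (smt (verit) norm_ge_zero power_le_one)
    consider "x < 0" | "0 \<le> x" "x < 1" | "1 \<le> x" by linarith
    then show ?thesis
      by cases (use 1 2 3 in \<open>auto simp: min_def max_def algebra_simps\<close>)
  qed
  have eq2: "emeasure lborel ({0..1} \<inter> {x<..}) = ennreal (1 - min 1 (max 0 x))" for x :: real
  proof -
    consider "x < 0" | "0 \<le> x" "x \<le> 1" | "1 < x" by linarith
    then show ?thesis
    proof cases
      case 1
      then have "{0..1} \<inter> {x<..} = {0..1}" by auto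
      then show ?thesis using 1 by simp
    next
      case 2
      then have "{0..1} \<inter> {x<..} = {x<..1}" by auto
      then show ?thesis using 2 by simp
    next
      case 3
      then have "{0..1} \<inter> {x<..} = {}" by auto
      then show ?thesis using 3 by simp
    qed
  qed
  show "emeasure ?M {x<..} < \<infinity>" for x unfolding M eq by simp
  show "emeasure ?M {x<..} = emeasure ?N {x<..}" for x
    unfolding M N eq eq2 by (simp add: ennreal_mult)
qed auto

lemma space_mu [simp]: "space (mu t) = ball 0 1"
  by (simp add: mu_def)

lemma sets_mu: "sets (mu t) = sets (lebesgue_on (ball 0 1))"
  by (simp add: mu_def)

lemma measurable_mu: "borel_measurable (mu t) = borel_measurable (lebesgue_on (ball 0 1))"
  by (rule measurable_cong_sets[OF sets_mu refl])

lemma borel_measurable_mu: "F \<in> borel_measurable borel \<Longrightarrow> F \<in> borel_measurable (mu t)"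
  unfolding measurable_mu by (intro measurable_restrict_space1 measurable_completion) simp

lemma measurable_mu_continuous: "continuous_on (ball 0 1) F \<Longrightarrow> F \<in> borel_measurable (mu t)"
  unfolding measurable_mu by (rule continuous_imp_measurable_on_sets_lebesgue) auto

lemma weight_measurable [measurable]: "(\<lambda>z::complex. (1 - (cmod z)\<^sup>2) powr (t - 2)) \<in> borel_measurable borel"
  by measurable

lemma weight_measurable': "(\<lambda>z::complex. (1 - (cmod z)\<^sup>2) powr (t - 2)) \<in> borel_measurable (lebesgue_on (ball 0 1))"
  using borel_measurable_mu[OF weight_measurable] by (simp add: measurable_mu)

text \<open>The weight is strictly positive on the open disc, so the null sets are those of Lebesgue
  measure.\<close>

lemma AE_mu_iff: "(AE z in mu t. P z) \<longleftrightarrow> (AE z in lebesgue_on (ball 0 1). P z)"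
proof -
  have "(AE z in mu t. P z) \<longleftrightarrow> (AE z in lebesgue_on (ball 0 1). 0 < ennreal ((1 - (cmod z)\<^sup>2) powr (t - 2)) \<longrightarrow> P z)"
    unfolding mu_def using weight_measurable' by (intro AE_density) simp
  also have "\<dots> \<longleftrightarrow> (AE z in lebesgue_on (ball 0 1). P z)"
  proof (rule AE_cong)
    fix z :: complex assume "z \<in> space (lebesgue_on (ball 0 1))"
    then have "(cmod z)\<^sup>2 < 1" by (simp add: power_less_one_iff abs_square_less_1)
    then show "(0 < ennreal ((1 - (cmod z)\<^sup>2) powr (t - 2)) \<longrightarrow> P z) = P z" by simp
  qed
  finally show ?thesis .
qed

lemma nn_integral_mu:
  assumes F[measurable]: "F \<in> borel_measurable borel"
  shows "(\<integral>\<^sup>+w. F w \<partial>mu t)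
    = (\<integral>\<^sup>+w. ennreal ((1 - (cmod w)\<^sup>2) powr (t - 2)) * F w * indicator (ball 0 1) w \<partial>lborel)"
proof -
  have "(\<integral>\<^sup>+w. F w \<partial>mu t) = (\<integral>\<^sup>+w. ennreal ((1 - (cmod w)\<^sup>2) powr (t - 2)) * F w \<partial>lebesgue_on (ball 0 1))"
    unfolding mu_def using weight_measurable' borel_measurable_mu[OF F, of t]
    by (intro nn_integral_density) (auto simp: measurable_mu)
  also have "\<dots> = (\<integral>\<^sup>+w. ennreal ((1 - (cmod w)\<^sup>2) powr (t - 2)) * F w * indicator (ball 0 1) w \<partial>lebesgue)"
    by (intro nn_integral_restrict_space) auto
  finally show ?thesis by (simp add: nn_integral_completion)
qed

lemma integral_mu:
  fixes F :: "complex \<Rightarrow> complex"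
  assumes F[measurable]: "F \<in> borel_measurable borel"
  shows "(\<integral>w. F w \<partial>mu t)
    = (\<integral>w. indicator (ball 0 1) w *\<^sub>R (1 - (cmod w)\<^sup>2) powr (t - 2) *\<^sub>R F w \<partial>lborel)"
proof -
  have "(\<integral>w. F w \<partial>mu t) = (\<integral>w. (1 - (cmod w)\<^sup>2) powr (t - 2) *\<^sub>R F w \<partial>lebesgue_on (ball 0 1))"
    unfolding mu_def using weight_measurable' borel_measurable_mu[OF F, of t]
    by (intro integral_density) (auto simp: measurable_mu)
  also have "\<dots> = (\<integral>w. indicator (ball 0 1) w *\<^sub>R (1 - (cmod w)\<^sup>2) powr (t - 2) *\<^sub>R F w \<partial>lebesgue)"
    by (intro integral_restrict_space) auto
  also have "\<dots> = (\<integral>w. indicator (ball 0 1) w *\<^sub>R (1 - (cmod w)\<^sup>2) powr (t - 2) *\<^sub>R F w \<partial>lborel)"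
    by (intro integral_completion borel_measurable_scaleR borel_measurable_indicator) auto
  finally show ?thesis .
qed

lemma integral_mu_rotate:
  fixes F :: "complex \<Rightarrow> complex"
  assumes F[measurable]: "F \<in> borel_measurable borel" and \<zeta>: "cmod \<zeta> = 1"
  shows "(\<integral>w. F (\<zeta> * w) \<partial>mu t) = (\<integral>w. F w \<partial>mu t)"
proof -
  let ?G = "\<lambda>w. indicator (ball 0 1) w *\<^sub>R (1 - (cmod w)\<^sup>2) powr (t - 2) *\<^sub>R F w"
  have [measurable]: "(\<lambda>w. \<zeta> * w) \<in> borel_measurable borel"
    by (intro borel_measurable_continuous_onI continuous_intros)
  have G: "?G \<in> borel_measurable borel"
    by (intro borel_measurable_scaleR borel_measurable_indicator weight_measurable F) auto
  have "(\<integral>w. F w \<partial>mu t) = (\<integral>w. ?G w \<partial>distr lborel borel (\<lambda>w. \<zeta> * w))"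
    unfolding lborel_complex_rotate[OF \<zeta>] by (rule integral_mu[OF F])
  also have "\<dots> = (\<integral>w. ?G (\<zeta> * w) \<partial>lborel)"
    by (rule integral_distr[OF _ G]) simp
  also have "\<dots> = (\<integral>w. indicator (ball 0 1) w *\<^sub>R (1 - (cmod w)\<^sup>2) powr (t - 2) *\<^sub>R F (\<zeta> * w) \<partial>lborel)"
    using \<zeta> by (simp add: indicator_def norm_mult)
  also have "\<dots> = (\<integral>w. F (\<zeta> * w) \<partial>mu t)"
    by (rule integral_mu[symmetric]) measurable
  finally show ?thesis ..
qed

text \<open>The squared norm of \<open>w ^ n\<close>, that is, the integral of
  \<open>|w|^(2 n)\<close>; the substitution \<open>x = |w|^2\<close> turns it into a Beta
  integral.\<close>

definition moment :: "real \<Rightarrow> nat \<Rightarrow> real" where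
  "moment t n = pi * Beta (real n + 1) (t - 1)"

lemma nn_integral_moment:
  assumes t: "t > 1"
  shows "(\<integral>\<^sup>+w. ennreal ((cmod w) ^ (2 * n)) \<partial>mu t) = ennreal (moment t n)"
proof -
  define G where "G x = (1 - x) powr (t - 2) * x ^ n" for x :: real
  have G[measurable]: "G \<in> borel_measurable borel" unfolding G_def by measurable
  have "(\<integral>\<^sup>+w. ennreal ((cmod w) ^ (2 * n)) \<partial>mu t)
      = (\<integral>\<^sup>+w. indicator (ball 0 1) w * ennreal (G ((cmod w)\<^sup>2)) \<partial>lborel)"
    unfolding power_mult by (subst nn_integral_mu) (auto simp: G_def ennreal_mult mult_ac intro!: nn_integral_cong)
  also have "\<dots> = (\<integral>\<^sup>+w. ennreal (G ((cmod w)\<^sup>2)) \<partial>density lborel (indicator (ball (0::complex) 1)))"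
    by (rule nn_integral_density[symmetric]) (auto intro!: borel_measurable_indicator)
  also have "\<dots> = (\<integral>\<^sup>+x. ennreal (G x) \<partial>distr (density lborel (indicator (ball (0::complex) 1))) borel (\<lambda>w. (cmod w)\<^sup>2))"
    by (rule nn_integral_distr[symmetric]) measurable
  also have "\<dots> = (\<integral>\<^sup>+x. ennreal pi * indicator {0..1} x * ennreal (G x) \<partial>lborel)"
    unfolding distr_cmod_square_disc by (rule nn_integral_density) measurable
  also have "\<dots> = (\<integral>\<^sup>+x. ennreal pi * (ennreal (x powr (real n + 1 - 1) * (1 - x) powr (t - 1 - 1)) * indicator {0..1} x) \<partial>lborel)"
  \<comment> \<open>The point 0 is removed because \<open>0 powr 0\<close> is 0, whereas
    \<open>0 ^ 0\<close> is 1, which matters for \<open>n = 0\<close>.\<close>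
  proof (rule nn_integral_cong_AE)
    show "AE x in lborel. ennreal pi * indicator {0..1} x * ennreal (G x)
        = ennreal pi * (ennreal (x powr (real n + 1 - 1) * (1 - x) powr (t - 1 - 1)) * indicator {0..1} x)"
      using AE_lborel_singleton[of "0::real"]
      by eventually_elim (auto simp: G_def indicator_def powr_realpow mult.commute algebra_simps split: if_splits)
  qed
  also have "\<dots> = ennreal pi * (\<integral>\<^sup>+x. ennreal (x powr (real n + 1 - 1) * (1 - x) powr (t - 1 - 1)) * indicator {0..1} x \<partial>lborel)"
    by (rule nn_integral_cmult) measurable
  also have "(\<integral>\<^sup>+x. ennreal (x powr (real n + 1 - 1) * (1 - x) powr (t - 1 - 1)) * indicator {0..1} x \<partial>lborel)
      = ennreal (Beta (real n + 1) (t - 1))"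
    using nn_integral_has_integral_lebesgue[OF _ has_integral_Beta_real[of "real n + 1" "t - 1"]] t
    by (simp add: nn_integral_completion ennreal_mult' ennreal_indicator mult.commute[of "indicator _ _"])
  also have "ennreal pi * ennreal (Beta (real n + 1) (t - 1)) = ennreal (moment t n)"
    unfolding moment_def by (simp add: ennreal_mult')
  finally show ?thesis .
qed

lemma moment_pos: "t > 1 \<Longrightarrow> moment t n > 0"
  by (simp add: moment_def Beta_def Gamma_real_pos)

lemma finite_measure_mu: "t > 1 \<Longrightarrow> finite_measure (mu t)"
  using nn_integral_moment[of t 0] by (intro finite_measureI) simp

text \<open>The reciprocal moments are, up to the factor \<open>(t - 1) / pi\<close>, the binomial
  coefficients of the power \<open>- t\<close>. This is what sums the orthogonal expansion of the
  kernel in closed form.\<close>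

lemma moment_recip:
  assumes t: "t > 1"
  shows "1 / moment t n = (t - 1) / pi * (pochhammer t n / fact n)"
proof -
  have 1: "Gamma (t + real n) = pochhammer t n * Gamma t"
    using t pochhammer_Gamma[of t n] by (simp add: field_simps Gamma_eq_zero_iff nonpos_Ints_def)
  have 2: "Gamma t = (t - 1) * Gamma (t - 1)"
    using t Gamma_plus1[of "t - 1"] by (simp add: nonpos_Ints_def)
  have "Gamma (t - 1) > 0" using t by (simp add: Gamma_real_pos)
  then show ?thesis
    unfolding moment_def Beta_def using 1 2 Gamma_fact[of n, where 'a = real]
    by (simp add: add_ac field_simps)
qed

section \<open>The weighted square-integrable functions and the kernel\<close>

text \<open>All termwise integrations below have a bound that splits into a summable factor in
  \<open>i\<close> and an integrable factor in \<open>x\<close>; this form settles pointwise and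
  integrated summability at once.\<close>

lemma sums_integral_dominated:
  fixes F :: "nat \<Rightarrow> 'a \<Rightarrow> complex"
  assumes F: "\<And>i. F i \<in> borel_measurable M" and k: "integrable M k" and c: "summable c"
    and bound: "\<And>i x. x \<in> space M \<Longrightarrow> cmod (F i x) \<le> c i * k x"
    and sums: "\<And>x. x \<in> space M \<Longrightarrow> (\<lambda>i. F i x) sums G x"
  shows "(\<lambda>i. \<integral>x. F i x \<partial>M) sums (\<integral>x. G x \<partial>M)"
proof -
  have int: "integrable M (F i)" for i
    by (rule Bochner_Integration.integrable_bound[OF integrable_mult_right[OF k, of "c i"] F])
      (use bound in \<open>auto intro!: AE_I2 intro: order_trans[OF _ abs_ge_self]\<close>)
  have "(\<lambda>i. \<integral>x. F i x \<partial>M) sums (\<integral>x. (\<Sum>i. F i x) \<partial>M)"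
  proof (rule sums_integral[OF int])
    show "AE x in M. summable (\<lambda>i. cmod (F i x))"
      by (intro AE_I2 summable_comparison_test'[OF summable_mult2[OF c]]) (auto intro: bound)
    show "summable (\<lambda>i. \<integral>x. cmod (F i x) \<partial>M)"
    proof (rule summable_comparison_test'[OF summable_mult2[OF c]])
      fix i
      have "(\<integral>x. cmod (F i x) \<partial>M) \<le> (\<integral>x. c i * k x \<partial>M)"
        using int k bound by (intro integral_mono) auto
      then show "norm (\<integral>x. cmod (F i x) \<partial>M) \<le> c i * (\<integral>x. k x \<partial>M)"
        by simp
    qed
  qed
  moreover have "(\<integral>x. (\<Sum>i. F i x) \<partial>M) = (\<integral>x. G x \<partial>M)"
    using sums by (intro Bochner_Integration.integral_cong refl) (auto simp: sums_iff)
  ultimately show ?thesis by simp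
qed

section \<open>Square-integrable functions as a semidefinite inner product space\<close>

definition L2 :: "real \<Rightarrow> (complex \<Rightarrow> complex) set" where
  "L2 t = {h. h \<in> borel_measurable (mu t) \<and> integrable (mu t) (\<lambda>z. (cmod (h z))\<^sup>2)}"

definition fscale :: "complex \<Rightarrow> (complex \<Rightarrow> complex) \<Rightarrow> complex \<Rightarrow> complex" where
  "fscale c h = (\<lambda>z. c * h z)"

lemma fscale_apply [simp]: "fscale c h z = c * h z"
  by (simp add: fscale_def)

lemma sum_fun_apply: "(\<Sum>i\<in>I. F i) z = (\<Sum>i\<in>I. F i z)" for F :: "'i \<Rightarrow> 'a \<Rightarrow> 'b::comm_monoid_add"
  by (induction I rule: infinite_finite_induct) auto

lemma borel_measurable_cnj: "h \<in> borel_measurable M \<Longrightarrow> (\<lambda>z. cnj (h z)) \<in> borel_measurable M"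
  by (rule measurable_compose[OF _ borel_measurable_continuous_onI]) (auto intro: continuous_intros)

lemma L2_measurable: "h \<in> L2 t \<Longrightarrow> h \<in> borel_measurable (mu t)"
  by (simp add: L2_def)

lemma L2_integrable_mult:
  assumes "h \<in> L2 t" "k \<in> L2 t"
  shows "integrable (mu t) (\<lambda>z. h z * cnj (k z))"
proof (rule Bochner_Integration.integrable_bound)
  show "integrable (mu t) (\<lambda>z. (cmod (h z))\<^sup>2 + (cmod (k z))\<^sup>2)"
    using assms by (simp add: L2_def)
  show "(\<lambda>z. h z * cnj (k z)) \<in> borel_measurable (mu t)"
    using assms by (intro borel_measurable_times borel_measurable_cnj) (auto simp: L2_def)
  have "a * b \<le> a\<^sup>2 + b\<^sup>2" if "0 \<le> a" "0 \<le> b" for a b :: real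
    using that sum_squares_bound[of a b] mult_nonneg_nonneg[OF that] by linarith
  then show "AE z in mu t. norm (h z * cnj (k z)) \<le> norm ((cmod (h z))\<^sup>2 + (cmod (k z))\<^sup>2)"
    by (auto simp: norm_mult)
qed

lemma L2_add: "h \<in> L2 t \<Longrightarrow> k \<in> L2 t \<Longrightarrow> h + k \<in> L2 t"
proof -
  assume h: "h \<in> L2 t" and k: "k \<in> L2 t"
  have m: "h + k \<in> borel_measurable (mu t)"
    unfolding plus_fun_def using h k by (intro borel_measurable_add) (auto simp: L2_def)
  have "integrable (mu t) (\<lambda>z. (cmod ((h + k) z))\<^sup>2)"
  proof (rule Bochner_Integration.integrable_bound)
    show "integrable (mu t) (\<lambda>z. 2 * (cmod (h z))\<^sup>2 + 2 * (cmod (k z))\<^sup>2)"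
      using h k by (simp add: L2_def)
    show "(\<lambda>z. (cmod ((h + k) z))\<^sup>2) \<in> borel_measurable (mu t)"
      using m unfolding plus_fun_def by simp
    have "(cmod (a + b))\<^sup>2 \<le> 2 * (cmod a)\<^sup>2 + 2 * (cmod b)\<^sup>2" for a b
    proof -
      have "(cmod (a + b))\<^sup>2 \<le> (cmod a + cmod b)\<^sup>2" by (intro power_mono norm_triangle_ineq) auto
      then show ?thesis using sum_squares_bound[of "cmod a" "cmod b"] by (simp add: power2_sum)
    qed
    then show "AE z in mu t. norm ((cmod ((h + k) z))\<^sup>2) \<le> norm (2 * (cmod (h z))\<^sup>2 + 2 * (cmod (k z))\<^sup>2)"
      by auto
  qed
  then show ?thesis using m by (simp add: L2_def)
qed

lemma L2_bounded_mult:
  assumes h: "h \<in> L2 t" and f: "f \<in> borel_measurable (mu t)" and B: "\<And>z. cmod (f z) \<le> B"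
  shows "(\<lambda>z. f z * h z) \<in> L2 t"
proof -
  have m: "(\<lambda>z. f z * h z) \<in> borel_measurable (mu t)"
    using h f by (intro borel_measurable_times) (auto simp: L2_def)
  have "integrable (mu t) (\<lambda>z. (cmod (f z * h z))\<^sup>2)"
  proof (rule Bochner_Integration.integrable_bound)
    show "integrable (mu t) (\<lambda>z. B\<^sup>2 * (cmod (h z))\<^sup>2)" using h by (simp add: L2_def)
    show "(\<lambda>z. (cmod (f z * h z))\<^sup>2) \<in> borel_measurable (mu t)" using m by simp
    have "(cmod (f z) * cmod (h z))\<^sup>2 \<le> (B * cmod (h z))\<^sup>2" for z
      using B by (intro power_mono mult_right_mono) auto
    then show "AE z in mu t. norm ((cmod (f z * h z))\<^sup>2) \<le> norm (B\<^sup>2 * (cmod (h z))\<^sup>2)"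
      by (simp add: norm_mult power_mult_distrib)
  qed
  then show ?thesis using m by (simp add: L2_def)
qed

lemma L2_cnj: "h \<in> L2 t \<Longrightarrow> (\<lambda>z. cnj (h z)) \<in> L2 t"
  by (simp add: L2_def borel_measurable_cnj)

lemma ip_self: "ip t h h = of_real (\<integral>z. (cmod (h z))\<^sup>2 \<partial>mu t)"
  unfolding ip_def by (subst integral_complex_of_real[symmetric])
    (simp add: complex_norm_square del: of_real_power)

lemma nrm_square: "(nrm t h)\<^sup>2 = (\<integral>z. (cmod (h z))\<^sup>2 \<partial>mu t)"
  by (simp add: nrm_def ip_self)

interpretation fun_vs: vector_space fscale
  by standard (auto simp: fun_eq_iff algebra_simps)

interpretation L2: cip_space fscale "L2 t" "ip t" for t
proof
  show "fun_vs.subspace (L2 t)"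
  proof (rule fun_vs.subspaceI)
    show "0 \<in> L2 t" by (simp add: L2_def zero_fun_def)
    show "h + k \<in> L2 t" if "h \<in> L2 t" "k \<in> L2 t" for h k using that by (rule L2_add)
    show "fscale c h \<in> L2 t" if "h \<in> L2 t" for c h
      using L2_bounded_mult[OF that, of "\<lambda>_. c" "cmod c"] by (simp add: fscale_def)
  qed
  fix x y z :: "complex \<Rightarrow> complex" and c
  assume x: "x \<in> L2 t" and y: "y \<in> L2 t"
  show "ip t (fscale c x) y = c * ip t x y"
    by (simp add: ip_def mult.assoc)
  show "ip t y x = cnj (ip t x y)"
    using Bochner_Integration.integral_cnj[of "mu t" "\<lambda>z. x z * cnj (y z)"] by (simp add: ip_def mult.commute)
  show "0 \<le> Re (ip t x x)" by (simp add: ip_self)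
  assume z: "z \<in> L2 t"
  show "ip t (x + y) z = ip t x z + ip t y z"
    unfolding ip_def using L2_integrable_mult[OF x z] L2_integrable_mult[OF y z]
    by (simp add: distrib_right)
qed

lemma nm_eq_nrm: "cip_space.nm (ip t) = nrm t"
  by (simp add: fun_eq_iff L2.nm_def nrm_def)

lemma Bergman_L2: "h \<in> Bergman t \<Longrightarrow> h \<in> L2 t"
  by (simp add: Bergman_def L2_def)

lemma Bergman_iff:
  "h \<in> Bergman t \<longleftrightarrow> h holomorphic_on ball 0 1 \<and> (\<forall>z. z \<notin> ball 0 1 \<longrightarrow> h z = 0) \<and> h \<in> L2 t"
  by (auto simp: Bergman_def L2_def)

lemma subspace_Bergman: "fun_vs.subspace (Bergman t)"
  using L2.subspace_V[of t] unfolding fun_vs.subspace_def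
  by (auto simp: Bergman_iff fscale_def plus_fun_def zero_fun_def intro!: holomorphic_intros)

section \<open>The kernel, its size and its binomial series\<close>

lemma cmod_powr_of_real: "z \<noteq> 0 \<Longrightarrow> cmod (z powr of_real s) = cmod z powr s"
  by (simp add: powr_def norm_exp_eq_Re)

lemma binomial_series_neg:
  fixes x :: complex
  assumes "cmod x < 1"
  shows "(\<lambda>n. of_real (pochhammer t n / fact n) * x ^ n) sums (1 - x) powr (- of_real t)"
proof -
  have "(\<lambda>n. ((- of_real t) gchoose n) * (- x) ^ n) sums (1 + - x) powr (- of_real t)"
    using assms by (intro gen_binomial_complex) simp
  moreover have "((- of_real t) gchoose n) * (- x) ^ n = of_real (pochhammer t n / fact n) * x ^ n" for n
  proof -
    have "(-1) ^ n * (- x) ^ n = x ^ n" by (simp add: power_mult_distrib[symmetric])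
    then show ?thesis by (simp add: gbinomial_pochhammer pochhammer_of_real)
  qed
  ultimately show ?thesis by simp
qed

lemma summable_pochhammer:
  fixes r t :: real
  assumes "0 \<le> r" "r < 1"
  shows "summable (\<lambda>n. pochhammer t n / fact n * r ^ n)"
proof -
  have "summable (\<lambda>n. of_real (pochhammer t n / fact n * r ^ n) :: complex)"
    using sums_summable[OF binomial_series_neg[of "of_real r" t]] assms by simp
  then show ?thesis by (simp only: summable_of_real_iff)
qed

text \<open>The constant \<open>(t - 1) / pi\<close> is \<open>1 / moment t 0\<close>. The principal
  power is the intended branch, because \<open>1 - z * cnj w\<close> has positive real part for
  points of the disc.\<close>

definition kern :: "real \<Rightarrow> complex \<Rightarrow> complex \<Rightarrow> complex" where
  "kern t z w = of_real ((t - 1) / pi) * (1 - z * cnj w) powr (- of_real t)"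

text \<open>The squares of the two sides differ by \<open>(1 - |z|^2) * (1 - |w|^2)\<close>.
  Euclidean separation thereby controls the kernel uniformly up to the boundary.\<close>

lemma cmod_diff_le_kernel:
  assumes "cmod z \<le> 1" "cmod w \<le> 1"
  shows "cmod (z - w) \<le> cmod (1 - z * cnj w)"
proof -
  have "(cmod (1 - z * cnj w))\<^sup>2 = (cmod (z - w))\<^sup>2 + (1 - (cmod z)\<^sup>2) * (1 - (cmod w)\<^sup>2)"
    unfolding cmod_power2 by (simp add: power2_eq_square algebra_simps)
  moreover have "0 \<le> (1 - (cmod z)\<^sup>2) * (1 - (cmod w)\<^sup>2)"
    using assms by (intro mult_nonneg_nonneg) (auto simp: power_le_one)
  ultimately show ?thesis using power2_le_imp_le[of "cmod (z - w)" "cmod (1 - z * cnj w)"] by simp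
qed

lemma Re_kernel_pos:
  assumes "cmod z \<le> 1" "cmod w < 1"
  shows "0 < Re (1 - z * cnj w)"
proof -
  have "Re (z * cnj w) \<le> cmod (z * cnj w)" by (rule complex_Re_le_cmod)
  also have "\<dots> = cmod z * cmod w" by (simp add: norm_mult)
  also have "\<dots> \<le> 1 * cmod w" using assms by (intro mult_right_mono) auto
  finally show ?thesis using assms by simp
qed

lemma cnj_kern:
  assumes "cmod z < 1" "cmod w < 1"
  shows "cnj (kern t z w) = kern t w z"
proof -
  have "cnj ((1 - z * cnj w) powr - of_real t) = cnj (1 - z * cnj w) powr cnj (- of_real t)"
    using Re_kernel_pos[of z w] assms by (intro cnj_powr) auto
  then show ?thesis by (simp add: kern_def mult.commute)
qed

lemma kern_cmod_le:
  assumes "t > 1" "d > 0" "d \<le> cmod (1 - z * cnj w)"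
  shows "cmod (kern t z w) \<le> (t - 1) / pi * d powr (- t)"
proof -
  have nz: "1 - z * cnj w \<noteq> 0" using assms by auto
  then have "cmod (kern t z w) = (t - 1) / pi * cmod (1 - z * cnj w) powr (- t)"
    using assms cmod_powr_of_real[OF nz, of "-t"]
    by (simp add: kern_def norm_mult del: of_real_divide of_real_diff)
  also have "\<dots> \<le> (t - 1) / pi * d powr (- t)"
    using assms by (intro mult_left_mono powr_mono2') auto
  finally show ?thesis .
qed

lemma kern_sums:
  assumes "t > 1" "cmod z < 1" "cmod w \<le> 1"
  shows "(\<lambda>n. z ^ n * cnj w ^ n / of_real (moment t n)) sums kern t z w"
proof -
  have "cmod (z * cnj w) < 1"
    using mult_left_mono[of "cmod w" 1 "cmod z"] assms by (simp add: norm_mult)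
  from sums_mult[OF binomial_series_neg[OF this, of t], of "of_real ((t - 1) / pi)"]
  have "(\<lambda>n. of_real ((t - 1) / pi * (pochhammer t n / fact n)) * (z * cnj w) ^ n) sums kern t z w"
    by (simp add: kern_def mult.assoc)
  moreover have "of_real ((t - 1) / pi * (pochhammer t n / fact n)) * (z * cnj w) ^ n = z ^ n * cnj w ^ n / of_real (moment t n)" for n
    unfolding moment_recip[OF assms(1), symmetric] by (simp add: power_mult_distrib)
  ultimately show ?thesis by simp
qed

lemma summable_moment:
  assumes "t > 1" "0 \<le> r" "r < 1"
  shows "summable (\<lambda>n. r ^ n / moment t n)"
proof -
  have "(\<lambda>n. r ^ n / moment t n) = (\<lambda>n. (t - 1) / pi * (pochhammer t n / fact n * r ^ n))"
    using moment_recip[OF assms(1)] by (simp add: fun_eq_iff divide_inverse mult_ac)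
  then show ?thesis by (simp only: summable_mult[OF summable_pochhammer[OF assms(2,3)]])
qed

section \<open>The Bergman space\<close>

text \<open>Rotation by the angle \<open>pi / (m - n)\<close> preserves the measure and the disc,
  but changes the sign of the integrand. Discs of every radius are included because Taylor series
  are first integrated over smaller discs.\<close>

lemma moment_disc_orthogonal:
  assumes "m \<noteq> n"
  shows "(\<integral>w. indicator (ball 0 r) w * (w ^ m * cnj w ^ n) \<partial>mu t) = 0"
proof -
  define F where "F w = indicator (ball 0 r) w * (w ^ m * cnj w ^ n)" for w :: complex
  define \<zeta> where "\<zeta> = cis (pi / (real m - real n))"
  have "\<zeta> ^ m * cnj \<zeta> ^ n = cis (real m * (pi / (real m - real n))) * cis (- (real n * (pi / (real m - real n))))"
    unfolding \<zeta>_def cis_cnj Complex.DeMoivre by simp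
  also have "\<dots> = cis ((real m - real n) * (pi / (real m - real n)))"
    unfolding cis_mult by (simp only: left_diff_distrib add_uminus_conv_diff)
  also have "\<dots> = -1" using assms by simp
  finally have \<zeta>mn: "\<zeta> ^ m * cnj \<zeta> ^ n = -1" .
  have "F (\<zeta> * w) = - F w" for w
  proof -
    have "(\<zeta> * w) ^ m * cnj (\<zeta> * w) ^ n = (\<zeta> ^ m * cnj \<zeta> ^ n) * (w ^ m * cnj w ^ n)"
      by (simp add: power_mult_distrib)
    moreover have "cmod (\<zeta> * w) = cmod w" by (simp add: \<zeta>_def norm_mult)
    ultimately show ?thesis unfolding F_def \<zeta>mn by (simp add: indicator_def)
  qed
  moreover have "F \<in> borel_measurable borel"
    unfolding F_def
    by (intro borel_measurable_times borel_measurable_indicator borel_measurable_continuous_onI continuous_intros) auto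
  ultimately have "(\<integral>w. - F w \<partial>mu t) = (\<integral>w. F w \<partial>mu t)"
    using integral_mu_rotate[of F \<zeta> t] by (simp add: \<zeta>_def)
  then show ?thesis by (simp add: F_def)
qed

lemma indicator_exhaust:
  fixes w c :: complex
  assumes "w \<in> ball 0 1"
  shows "(\<lambda>j. indicator (ball 0 (1 - 1 / real (Suc j))) w * c) \<longlonglongrightarrow> c"
proof (rule tendsto_eventually)
  have "(\<lambda>j. 1 - 1 / real (Suc j)) \<longlonglongrightarrow> 1 - 0"
    by (intro tendsto_diff tendsto_const LIMSEQ_Suc[OF lim_1_over_n])
  then have "\<forall>\<^sub>F j in sequentially. cmod w < 1 - 1 / real (Suc j)"
    using assms by (intro order_tendstoD) auto
  then show "\<forall>\<^sub>F j in sequentially. indicator (ball 0 (1 - 1 / real (Suc j))) w * c = c"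
    by eventually_elim simp
qed

locale disc_weight =
  fixes t :: real
  assumes t_gt1: "t > 1"
begin

sublocale finite_measure "mu t"
  by (rule finite_measure_mu[OF t_gt1])

lemma integrable_mu_bounded:
  fixes h :: "complex \<Rightarrow> complex"
  assumes "h \<in> borel_measurable (mu t)" "\<And>z. z \<in> ball 0 1 \<Longrightarrow> cmod (h z) \<le> B"
  shows "integrable (mu t) h"
  using assms by (intro integrable_const_bound[of _ B] AE_I2) auto

lemma L2_bounded:
  assumes h: "h \<in> borel_measurable (mu t)" and B: "\<And>z. z \<in> ball 0 1 \<Longrightarrow> cmod (h z) \<le> B"
  shows "h \<in> L2 t" and "nrm t h \<le> B * sqrt (measure (mu t) (ball 0 1))"
proof -
  have B0: "0 \<le> B" using B[of 0] norm_ge_zero[of "h 0"] by (simp add: order_trans del: norm_ge_zero)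
  have sq: "(cmod (h z))\<^sup>2 \<le> B\<^sup>2" if "z \<in> ball 0 1" for z using B[OF that] by (intro power_mono) auto
  have i: "integrable (mu t) (\<lambda>z. (cmod (h z))\<^sup>2)"
    using h sq by (intro integrable_const_bound[of _ "B\<^sup>2"] AE_I2) auto
  then show "h \<in> L2 t" using h by (simp add: L2_def)
  have "(nrm t h)\<^sup>2 \<le> (\<integral>z. B\<^sup>2 \<partial>mu t)"
    unfolding nrm_square using i sq by (intro integral_mono) auto
  also have "\<dots> = (B * sqrt (measure (mu t) (ball 0 1)))\<^sup>2"
    by (simp add: power_mult_distrib mult.commute)
  finally show "nrm t h \<le> B * sqrt (measure (mu t) (ball 0 1))"
    by (rule power2_le_imp_le) (simp add: B0)
qed

lemma L2_integrable: "h \<in> L2 t \<Longrightarrow> integrable (mu t) h"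
  using L2_integrable_mult[of h t "\<lambda>_. 1"] L2_bounded(1)[of "\<lambda>_. 1" 1] by simp

lemma integral_moment: "(\<integral>w. cmod w ^ (2 * n) \<partial>mu t) = moment t n"
  using nn_integral_moment[OF t_gt1, of n] moment_pos[OF t_gt1, of n]
  by (intro integral_eq_nn_integral[THEN trans]) (auto intro!: borel_measurable_mu)

lemma moment_disc_limit:
  "(\<lambda>j. \<integral>w. indicator (ball 0 (1 - 1 / real (Suc j))) w * (w ^ n * cnj w ^ n) \<partial>mu t) \<longlonglongrightarrow> of_real (moment t n)"
proof -
  have wn: "w ^ n * cnj w ^ n = of_real (cmod w ^ (2 * n))" for w
    by (simp add: power_mult_distrib[symmetric] complex_norm_square[symmetric] power_mult)
  have "(\<integral>w. w ^ n * cnj w ^ n \<partial>mu t) = of_real (moment t n)"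
    unfolding wn by (simp only: integral_complex_of_real integral_moment)
  moreover have "(\<lambda>j. \<integral>w. indicator (ball 0 (1 - 1 / real (Suc j))) w * (w ^ n * cnj w ^ n) \<partial>mu t)
      \<longlonglongrightarrow> (\<integral>w. w ^ n * cnj w ^ n \<partial>mu t)"
  proof (rule integral_dominated_convergence[where w = "\<lambda>_. 1"])
    show "(\<lambda>w. w ^ n * cnj w ^ n) \<in> borel_measurable (mu t)"
      by (intro borel_measurable_mu borel_measurable_continuous_onI continuous_intros)
    show "(\<lambda>w. indicator (ball 0 (1 - 1 / real (Suc j))) w * (w ^ n * cnj w ^ n)) \<in> borel_measurable (mu t)" for j
      by (intro borel_measurable_mu borel_measurable_times borel_measurable_indicator borel_measurable_continuous_onI continuous_intros) auto
    show "AE w in mu t. (\<lambda>j. indicator (ball 0 (1 - 1 / real (Suc j))) w * (w ^ n * cnj w ^ n)) \<longlonglongrightarrow> w ^ n * cnj w ^ n"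
      by (intro AE_I2 indicator_exhaust) simp
    show "AE w in mu t. cmod (indicator (ball 0 (1 - 1 / real (Suc j))) w * (w ^ n * cnj w ^ n)) \<le> 1" for j
      by (intro AE_I2) (auto simp: indicator_def norm_mult norm_power intro!: mult_le_one power_le_one)
  qed simp
  ultimately show ?thesis by simp
qed

text \<open>On the smaller disc \<open>D j\<close> the Taylor series may be integrated termwise, and
  orthogonality leaves only the \<open>n\<close>-th term. The discs then exhaust the unit disc, with
  \<open>cmod (h w)\<close> as dominating function.\<close>

lemma taylor_coeff_integral:
  assumes h: "h \<in> Bergman t"
  shows "(\<integral>w. h w * cnj w ^ n \<partial>mu t) = (deriv ^^ n) h 0 / fact n * of_real (moment t n)"
proof -
  define a where "a m = (deriv ^^ m) h 0 / fact m" for m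
  have hol: "h holomorphic_on ball 0 1" using h by (simp add: Bergman_iff)
  have taylor: "(\<lambda>m. a m * w ^ m) sums h w" if "w \<in> ball 0 1" for w
    using holomorphic_power_series[OF hol that] by (simp add: a_def)
  define D where "D j = ball (0::complex) (1 - 1 / real (Suc j))" for j
  define I where "I j k = (\<integral>w. indicator (D j) w * (w ^ k * cnj w ^ n) \<partial>mu t)" for j k
  have Dm: "(\<lambda>w. indicator (D j) w :: complex) \<in> borel_measurable (mu t)" for j
    by (intro borel_measurable_mu borel_measurable_indicator) (simp add: D_def)
  have hm: "h \<in> borel_measurable (mu t)" using h by (simp add: Bergman_def)
  have wm: "(\<lambda>w. w ^ k * cnj w ^ n) \<in> borel_measurable (mu t)" for k
    by (intro borel_measurable_mu borel_measurable_continuous_onI continuous_intros)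
  have cm: "(\<lambda>w. cnj w ^ n) \<in> borel_measurable (mu t)"
    by (intro borel_measurable_mu borel_measurable_continuous_onI continuous_intros)
  have disc: "(\<integral>w. indicator (D j) w * (h w * cnj w ^ n) \<partial>mu t) = a n * I j n" for j
  proof -
    define r where "r = 1 - 1 / real (Suc j)"
    have r: "0 \<le> r" "r < 1" by (auto simp: r_def divide_le_eq)
    \<comment> \<open>Convergence of the power series at a point \<open>s\<close> beyond
      \<open>r\<close> gives absolute convergence at \<open>r\<close>.\<close>
    define s where "s = (r + 1) / 2"
    have s: "r < s" "s < 1" "0 \<le> s" using r by (auto simp: s_def)
    have "summable (\<lambda>m. a m * of_real s ^ m)"
      using taylor[of "of_real s"] s by (auto simp: sums_iff)
    then have summ: "summable (\<lambda>m. cmod (a m * of_real r ^ m))"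
      by (rule powser_insidea) (use r s in auto)
    have "(\<lambda>m. \<integral>w. indicator (D j) w * (a m * w ^ m * cnj w ^ n) \<partial>mu t)
        sums (\<integral>w. indicator (D j) w * (h w * cnj w ^ n) \<partial>mu t)"
    proof (rule sums_integral_dominated[where k = "\<lambda>_. 1", OF _ _ summ])
      show "(\<lambda>w. indicator (D j) w * (a m * w ^ m * cnj w ^ n)) \<in> borel_measurable (mu t)" for m
        using borel_measurable_times[OF borel_measurable_const[of "a m"] wm[of m]]
        by (intro borel_measurable_times[OF Dm]) (simp add: mult.assoc)
      fix w :: complex assume "w \<in> space (mu t)"
      then have w: "cmod w < 1" by simp
      show "(\<lambda>m. indicator (D j) w * (a m * w ^ m * cnj w ^ n)) sums (indicator (D j) w * (h w * cnj w ^ n))"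
        using taylor[of w] w by (intro sums_mult sums_mult2) auto
      fix m
      show "cmod (indicator (D j) w * (a m * w ^ m * cnj w ^ n)) \<le> cmod (a m * of_real r ^ m) * 1"
      proof (cases "w \<in> D j")
        case True
        then have "cmod w \<le> r" by (simp add: D_def r_def)
        then have "cmod w ^ m * cmod w ^ n \<le> r ^ m * 1"
          using w r by (intro mult_mono power_mono power_le_one) auto
        then show ?thesis using True r
          by (simp add: norm_mult norm_power mult.assoc mult_left_mono)
      qed simp
    qed simp
    moreover have "(\<integral>w. indicator (D j) w * (a m * w ^ m * cnj w ^ n) \<partial>mu t) = a m * I j m" for m
    proof -
      have "(\<integral>w. indicator (D j) w * (a m * w ^ m * cnj w ^ n) \<partial>mu t)
          = (\<integral>w. a m * (indicator (D j) w * (w ^ m * cnj w ^ n)) \<partial>mu t)"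
        by (simp add: mult_ac)
      then show ?thesis by (simp add: I_def)
    qed
    moreover have "I j m = 0" if "m \<noteq> n" for m
      using moment_disc_orthogonal[OF that] by (simp add: I_def D_def)
    then have "(\<lambda>m. a m * I j m) = (\<lambda>m. if m = n then a n * I j n else 0)" by auto
    ultimately have "(\<lambda>m. if m = n then a n * I j n else 0) sums (\<integral>w. indicator (D j) w * (h w * cnj w ^ n) \<partial>mu t)"
      by simp
    then show ?thesis using sums_single[of n "\<lambda>_. a n * I j n"] sums_unique2 by blast
  qed
  have "(\<lambda>j. \<integral>w. indicator (D j) w * (h w * cnj w ^ n) \<partial>mu t) \<longlonglongrightarrow> (\<integral>w. h w * cnj w ^ n \<partial>mu t)"
  proof (rule integral_dominated_convergence[where w = "\<lambda>w. cmod (h w)"])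
    show "integrable (mu t) (\<lambda>w. cmod (h w))"
      using L2_integrable[OF Bergman_L2[OF h]] by simp
    show "AE w in mu t. (\<lambda>j. indicator (D j) w * (h w * cnj w ^ n)) \<longlonglongrightarrow> h w * cnj w ^ n"
      unfolding D_def by (intro AE_I2 indicator_exhaust) simp
    show "AE w in mu t. cmod (indicator (D j) w * (h w * cnj w ^ n)) \<le> cmod (h w)" for j
      by (intro AE_I2) (auto simp: indicator_def norm_mult norm_power intro!: mult_left_le power_le_one)
  qed (intro borel_measurable_times Dm hm cm)+
  moreover have "(\<lambda>j. a n * I j n) \<longlonglongrightarrow> a n * of_real (moment t n)"
    using moment_disc_limit[of n] unfolding I_def D_def by (intro tendsto_mult_left)
  ultimately show ?thesis
    unfolding disc a_def using LIMSEQ_unique by blast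
qed

text \<open>The \<open>n\<close>-th term of the kernel series integrates \<open>h\<close> to its
  \<open>n\<close>-th Taylor coefficient times \<open>moment t n\<close>; the moments cancel and the
  Taylor series of \<open>h\<close> at \<open>z\<close> remains.\<close>

lemma reproducing:
  assumes h: "h \<in> Bergman t" and z: "cmod z < 1"
  shows "(\<integral>w. kern t z w * h w \<partial>mu t) = h z"
proof -
  have hol: "h holomorphic_on ball 0 1" using h by (simp add: Bergman_iff)
  have "(\<lambda>n. \<integral>w. z ^ n * cnj w ^ n / of_real (moment t n) * h w \<partial>mu t) sums (\<integral>w. kern t z w * h w \<partial>mu t)"
  proof (rule sums_integral_dominated[where k = "\<lambda>w. cmod (h w)" and c = "\<lambda>n. cmod z ^ n / moment t n"])
    show "(\<lambda>w. z ^ n * cnj w ^ n / of_real (moment t n) * h w) \<in> borel_measurable (mu t)" for n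
    proof (rule borel_measurable_times)
      show "(\<lambda>w. z ^ n * cnj w ^ n / of_real (moment t n)) \<in> borel_measurable (mu t)"
        using moment_pos[OF t_gt1, of n]
        by (intro borel_measurable_mu borel_measurable_continuous_onI continuous_intros) auto
    qed (use h in \<open>simp add: Bergman_def\<close>)
    show "integrable (mu t) (\<lambda>w. cmod (h w))"
      using L2_integrable[OF Bergman_L2[OF h]] by simp
    show "summable (\<lambda>n. cmod z ^ n / moment t n)"
      using z by (intro summable_moment t_gt1) auto
    fix w :: complex assume "w \<in> space (mu t)"
    then have w: "cmod w < 1" by simp
    show "(\<lambda>n. z ^ n * cnj w ^ n / of_real (moment t n) * h w) sums (kern t z w * h w)"
      using kern_sums[OF t_gt1 z, of w] w by (intro sums_mult2) auto
    show "cmod (z ^ n * cnj w ^ n / of_real (moment t n) * h w) \<le> cmod z ^ n / moment t n * cmod (h w)" for n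
    proof -
      have "cmod z ^ n * cmod w ^ n \<le> cmod z ^ n * 1"
        using w by (intro mult_left_mono power_le_one) auto
      then show ?thesis using moment_pos[OF t_gt1, of n]
        by (simp add: norm_mult norm_divide norm_power mult_right_mono divide_right_mono)
    qed
  qed
  moreover have "(\<integral>w. z ^ n * cnj w ^ n / of_real (moment t n) * h w \<partial>mu t) = (deriv ^^ n) h 0 / fact n * (z - 0) ^ n" for n
  proof -
    have "(\<integral>w. z ^ n * cnj w ^ n / of_real (moment t n) * h w \<partial>mu t)
        = (\<integral>w. z ^ n / of_real (moment t n) * (h w * cnj w ^ n) \<partial>mu t)"
      by (simp add: mult_ac)
    also have "\<dots> = z ^ n / of_real (moment t n) * (\<integral>w. h w * cnj w ^ n \<partial>mu t)"
      by (rule integral_mult_right_zero)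
    finally show ?thesis
      using moment_pos[OF t_gt1, of n] by (simp add: taylor_coeff_integral[OF h])
  qed
  ultimately show ?thesis
    using holomorphic_power_series[OF hol, of z] z sums_unique2 by simp
qed

text \<open>The kernel as a vector: it is holomorphic in the first argument of \<open>kern\<close>,
  and it is cut off outside the disc as membership in \<open>Bergman t\<close> demands. The inner
  product with \<open>kfun z\<close> is evaluation at \<open>z\<close>.\<close>

definition kfun :: "complex \<Rightarrow> complex \<Rightarrow> complex" where
  "kfun z w = (if cmod w < 1 then kern t w z else 0)"

lemma kern_cmod_le_disc:
  assumes "cmod z \<le> r" "r < 1" "cmod w < 1"
  shows "cmod (kern t w z) \<le> (t - 1) / pi * (1 - r) powr (- t)"
proof (rule kern_cmod_le[OF t_gt1])
  have "cmod w * cmod z \<le> 1 * r" using assms by (intro mult_mono) auto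
  then show "1 - r \<le> cmod (1 - w * cnj z)"
    using norm_triangle_ineq2[of 1 "w * cnj z"] by (simp add: norm_mult)
qed (use assms in auto)

lemma kfun_Bergman:
  assumes z: "cmod z < 1"
  shows "kfun z \<in> Bergman t"
proof -
  have "(\<lambda>w. kern t w z) holomorphic_on ball 0 1"
    unfolding kern_def
  proof (intro holomorphic_intros)
    fix w :: complex assume "w \<in> ball 0 1"
    then have "0 < Re (1 - w * cnj z)" using z by (intro Re_kernel_pos) auto
    then show "1 - w * cnj z \<notin> \<real>\<^sub>\<le>\<^sub>0" by (auto simp: complex_nonpos_Reals_iff)
  qed
  then have hol: "kfun z holomorphic_on ball 0 1"
    by (rule holomorphic_transform) (simp add: kfun_def)
  have "kfun z \<in> L2 t"
  proof (rule L2_bounded)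
    show "kfun z \<in> borel_measurable (mu t)"
      by (intro measurable_mu_continuous holomorphic_on_imp_continuous_on hol)
    show "cmod (kfun z w) \<le> (t - 1) / pi * (1 - cmod z) powr (- t)" if "w \<in> ball 0 1" for w
      using kern_cmod_le_disc[of z "cmod z" w] z that by (simp add: kfun_def)
  qed
  with hol show ?thesis by (simp add: Bergman_iff kfun_def)
qed

lemma kfun_nrm_le:
  assumes "cmod z \<le> r" "r < 1"
  shows "nrm t (kfun z) \<le> (t - 1) / pi * (1 - r) powr (- t) * sqrt (measure (mu t) (ball 0 1))"
  using kfun_Bergman[of z] kern_cmod_le_disc[OF assms] assms
  by (intro L2_bounded) (auto simp: kfun_def Bergman_def)

lemma ip_kfun:
  assumes "cmod z < 1"
  shows "ip t \<phi> (kfun z) = (\<integral>w. kern t z w * \<phi> w \<partial>mu t)"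
  unfolding ip_def using assms
  by (intro Bochner_Integration.integral_cong refl) (auto simp: kfun_def cnj_kern)

lemma eval_eq_ip: "h \<in> Bergman t \<Longrightarrow> cmod z < 1 \<Longrightarrow> h z = ip t h (kfun z)"
  by (simp add: ip_kfun reproducing)

text \<open>Point evaluations are bounded uniformly on smaller discs, so convergence in norm forces
  locally uniform convergence.\<close>

lemma eval_le:
  assumes h: "h \<in> Bergman t" and z: "cmod z \<le> r" "r < 1"
  shows "cmod (h z) \<le> (t - 1) / pi * (1 - r) powr (- t) * sqrt (measure (mu t) (ball 0 1)) * nrm t h"
proof -
  have z1: "cmod z < 1" using z by simp
  have "cmod (h z) \<le> nrm t h * nrm t (kfun z)"
    using L2.Cauchy_Schwarz[OF Bergman_L2[OF h] Bergman_L2[OF kfun_Bergman[OF z1]]]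
    by (simp add: eval_eq_ip[OF h z1] nm_eq_nrm)
  also have "\<dots> \<le> nrm t h * ((t - 1) / pi * (1 - r) powr (- t) * sqrt (measure (mu t) (ball 0 1)))"
    using kfun_nrm_le[OF z] L2.nm_ge0[OF Bergman_L2[OF h]] by (intro mult_left_mono) (auto simp: nm_eq_nrm)
  finally show ?thesis by (simp add: mult_ac)
qed

lemma Bergman_diff: "h \<in> Bergman t \<Longrightarrow> k \<in> Bergman t \<Longrightarrow> h - k \<in> Bergman t"
  using subspace_Bergman by (rule fun_vs.subspace_diff)

text \<open>The pointwise limit is holomorphic because the convergence is locally uniform; Fatou's
  lemma then turns it into a limit in norm.\<close>

lemma Bergman_complete:
  assumes X: "\<And>n. X n \<in> Bergman t"
    and cauchy: "\<And>\<epsilon>. \<epsilon> > 0 \<Longrightarrow> \<exists>M. \<forall>m\<ge>M. \<forall>n\<ge>M. nrm t (X m - X n) < \<epsilon>"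
  shows "\<exists>x\<in>Bergman t. (\<lambda>n. nrm t (X n - x)) \<longlonglongrightarrow> 0"
proof -
  have unif: "\<exists>M. \<forall>m\<ge>M. \<forall>n\<ge>M. \<forall>z\<in>cball 0 r. cmod (X m z - X n z) < \<epsilon>" if r: "0 \<le> r" "r < 1" and \<epsilon>: "\<epsilon> > 0" for r \<epsilon>
  proof -
    \<comment> \<open>The added 1 only ensures that \<open>C\<close> is positive, so that
      \<open>\<epsilon> / C\<close> can be formed.\<close>
    define C where "C = (t - 1) / pi * (1 - r) powr (- t) * sqrt (measure (mu t) (ball 0 1)) + 1"
    have C: "C > 0" using t_gt1 by (simp add: C_def add_nonneg_pos)
    obtain M where M: "\<And>m n. m \<ge> M \<Longrightarrow> n \<ge> M \<Longrightarrow> nrm t (X m - X n) < \<epsilon> / C"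
      using cauchy[of "\<epsilon> / C"] C \<epsilon> by auto
    have "cmod (X m z - X n z) < \<epsilon>" if "m \<ge> M" "n \<ge> M" "z \<in> cball 0 r" for m n z
    proof -
      have "cmod ((X m - X n) z) \<le> (t - 1) / pi * (1 - r) powr (- t) * sqrt (measure (mu t) (ball 0 1)) * nrm t (X m - X n)"
        using that r by (intro eval_le Bergman_diff X) auto
      also have "\<dots> \<le> C * nrm t (X m - X n)"
        using L2.nm_ge0[OF Bergman_L2[OF Bergman_diff[OF X X]], of m n]
        by (intro mult_right_mono) (auto simp: C_def nm_eq_nrm)
      also have "\<dots> < \<epsilon>" using M[OF that(1,2)] C by (simp add: field_simps)
      finally show ?thesis by simp
    qed
    then show ?thesis by blast
  qed
  have conv: "convergent (\<lambda>n. X n z)" if z: "cmod z < 1" for z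
  proof -
    have "Cauchy (\<lambda>n. X n z)"
      unfolding Cauchy_def dist_norm using unif[of "cmod z"] z by fastforce
    then show ?thesis by (rule Cauchy_convergent)
  qed
  define x where "x z = (if cmod z < 1 then lim (\<lambda>n. X n z) else 0)" for z
  have lim: "(\<lambda>n. X n z) \<longlonglongrightarrow> x z" if "cmod z < 1" for z
    using conv[OF that] that by (simp add: x_def convergent_LIMSEQ_iff)
  have hol: "x holomorphic_on ball 0 1"
  proof (rule holomorphic_uniform_sequence[of _ X])
    show "X n holomorphic_on ball 0 1" for n using X by (simp add: Bergman_iff)
    fix z0 :: complex assume "z0 \<in> ball 0 1"
    then have z0: "cmod z0 < 1" by simp
    define d where "d = (1 - cmod z0) / 2"
    define r where "r = cmod z0 + d"
    have r: "0 \<le> r" "r < 1" "d > 0" using z0 by (auto simp: r_def d_def field_simps)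
    have sub: "cball z0 d \<subseteq> cball 0 r"
      by (simp add: r_def cball_subset_cball_iff)
    have "uniform_limit (cball z0 d) X x sequentially"
    proof (rule uniform_limitI)
      fix \<epsilon> :: real assume \<epsilon>: "\<epsilon> > 0"
      then obtain M where M: "\<And>m n z. m \<ge> M \<Longrightarrow> n \<ge> M \<Longrightarrow> z \<in> cball 0 r \<Longrightarrow> cmod (X m z - X n z) < \<epsilon> / 2"
        using unif[OF r(1,2), of "\<epsilon> / 2"] half_gt_zero[OF \<epsilon>] by blast
      have "dist (X n z) (x z) < \<epsilon>" if n: "n \<ge> M" and z: "z \<in> cball z0 d" for n z
      proof -
        have zr: "z \<in> cball 0 r" using sub z by blast
        then have z1: "cmod z < 1" using r by simp
        have "(\<lambda>m. cmod (X n z - X m z)) \<longlonglongrightarrow> cmod (X n z - x z)"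
          by (intro tendsto_intros lim z1)
        moreover have "\<forall>\<^sub>F m in sequentially. cmod (X n z - X m z) \<le> \<epsilon> / 2"
          unfolding eventually_sequentially using M[OF n _ zr] less_imp_le by blast
        ultimately have "cmod (X n z - x z) \<le> \<epsilon> / 2"
          by (rule tendsto_upperbound) simp
        then show ?thesis using \<epsilon> by (simp add: dist_norm)
      qed
      then show "\<forall>\<^sub>F n in sequentially. \<forall>z\<in>cball z0 d. dist (X n z) (x z) < \<epsilon>"
        unfolding eventually_sequentially by blast
    qed
    moreover have "cball z0 d \<subseteq> ball 0 1" using sub r by force
    ultimately show "\<exists>d>0. cball z0 d \<subseteq> ball 0 1 \<and> uniform_limit (cball z0 d) X x sequentially"
      using r by blast
  qed simp
  have xm: "x \<in> borel_measurable (mu t)"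
    by (intro measurable_mu_continuous holomorphic_on_imp_continuous_on hol)
  have Xm: "X n \<in> borel_measurable (mu t)" for n using X by (simp add: Bergman_def)
  \<comment> \<open>Letting \<open>m\<close> tend to infinity inside the integral gives
    square-integrability and the norm bound together. The former puts the limit into the space,
    since \<open>x = X M - (X M - x)\<close>.\<close>
  have fatou: "X n - x \<in> L2 t \<and> nrm t (X n - x) \<le> \<epsilon>"
    if \<epsilon>: "\<epsilon> > 0" and M: "\<And>m. m \<ge> M \<Longrightarrow> nrm t (X n - X m) < \<epsilon>" for n \<epsilon> M
  proof -
    have dm: "(\<lambda>z. X n z - x z) \<in> borel_measurable (mu t)" by (intro borel_measurable_diff Xm xm)
    have "(\<integral>\<^sup>+z. ennreal ((cmod (X n z - x z))\<^sup>2) \<partial>mu t)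
        = (\<integral>\<^sup>+z. liminf (\<lambda>m. ennreal ((cmod (X n z - X m z))\<^sup>2)) \<partial>mu t)"
    proof (rule nn_integral_cong)
      fix z assume "z \<in> space (mu t)"
      then have "cmod z < 1" by simp
      then have "(\<lambda>m. ennreal ((cmod (X n z - X m z))\<^sup>2)) \<longlonglongrightarrow> ennreal ((cmod (X n z - x z))\<^sup>2)"
        by (intro tendsto_ennrealI tendsto_intros lim)
      then show "ennreal ((cmod (X n z - x z))\<^sup>2) = liminf (\<lambda>m. ennreal ((cmod (X n z - X m z))\<^sup>2))"
        using lim_imp_Liminf[OF sequentially_bot] by metis
    qed
    also have "\<dots> \<le> liminf (\<lambda>m. \<integral>\<^sup>+z. ennreal ((cmod (X n z - X m z))\<^sup>2) \<partial>mu t)"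
    proof (rule nn_integral_liminf)
      show "(\<lambda>z. ennreal ((cmod (X n z - X m z))\<^sup>2)) \<in> borel_measurable (mu t)" for m
        using borel_measurable_diff[OF Xm[of n] Xm[of m]] by simp
    qed
    also have "\<dots> \<le> ennreal (\<epsilon>\<^sup>2)"
    proof -
      have "(\<integral>\<^sup>+z. ennreal ((cmod (X n z - X m z))\<^sup>2) \<partial>mu t) \<le> ennreal (\<epsilon>\<^sup>2)" if "m \<ge> M" for m
      proof -
        have L: "X n - X m \<in> L2 t" by (intro Bergman_L2 Bergman_diff X)
        have "(\<integral>\<^sup>+z. ennreal ((cmod (X n z - X m z))\<^sup>2) \<partial>mu t) = ennreal ((nrm t (X n - X m))\<^sup>2)"
          using L unfolding nrm_square by (subst nn_integral_eq_integral[symmetric]) (auto simp: L2_def)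
        also have "\<dots> \<le> ennreal (\<epsilon>\<^sup>2)"
          using M[OF that] L2.nm_ge0[OF L] by (intro ennreal_leI power_mono) (auto simp: nm_eq_nrm)
        finally show ?thesis .
      qed
      then have "liminf (\<lambda>m. \<integral>\<^sup>+z. ennreal ((cmod (X n z - X m z))\<^sup>2) \<partial>mu t) \<le> liminf (\<lambda>m. ennreal (\<epsilon>\<^sup>2))"
        by (intro Liminf_mono) (auto simp: eventually_sequentially)
      then show ?thesis by (simp add: Liminf_const)
    qed
    finally have le: "(\<integral>\<^sup>+z. ennreal ((cmod (X n z - x z))\<^sup>2) \<partial>mu t) \<le> ennreal (\<epsilon>\<^sup>2)" .
    have int: "integrable (mu t) (\<lambda>z. (cmod (X n z - x z))\<^sup>2)"
      using dm le by (intro integrableI_bounded) (auto simp: le_less_trans)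
    then have L: "X n - x \<in> L2 t" using dm by (simp add: L2_def fun_diff_def)
    have "ennreal ((nrm t (X n - x))\<^sup>2) \<le> ennreal (\<epsilon>\<^sup>2)"
      using le nn_integral_eq_integral[OF int] by (simp add: nrm_square)
    then have "(nrm t (X n - x))\<^sup>2 \<le> \<epsilon>\<^sup>2" by (simp add: ennreal_le_iff)
    then have "nrm t (X n - x) \<le> \<epsilon>" by (rule power2_le_imp_le) (use \<epsilon> in simp)
    with L show ?thesis by simp
  qed
  have "x \<in> Bergman t"
  proof -
    obtain M where M: "\<And>m n. m \<ge> M \<Longrightarrow> n \<ge> M \<Longrightarrow> nrm t (X m - X n) < 1" using cauchy[of 1] by auto
    have "X M - x \<in> L2 t" using fatou[of 1 M M] M by simp
    then have "X M - (X M - x) \<in> L2 t" by (rule L2.V_closed(3)[OF Bergman_L2[OF X]])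
    moreover have "X M - (X M - x) = x" by (simp add: fun_eq_iff)
    ultimately show ?thesis using hol by (simp add: Bergman_iff x_def)
  qed
  moreover have "(\<lambda>n. nrm t (X n - x)) \<longlonglongrightarrow> 0"
  proof (rule LIMSEQ_I)
    fix \<epsilon> :: real assume \<epsilon>: "\<epsilon> > 0"
    obtain M where M: "\<And>m n. m \<ge> M \<Longrightarrow> n \<ge> M \<Longrightarrow> nrm t (X m - X n) < \<epsilon> / 2" using cauchy[of "\<epsilon> / 2"] \<epsilon> by auto
    have "norm (nrm t (X n - x) - 0) < \<epsilon>" if "n \<ge> M" for n
      using fatou[of "\<epsilon> / 2" M n] M that \<epsilon> L2.nm_ge0[of "X n - x" t] by (auto simp: nm_eq_nrm)
    then show "\<exists>M. \<forall>n\<ge>M. norm (nrm t (X n - x) - 0) < \<epsilon>" by blast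
  qed
  ultimately show ?thesis by blast
qed

sublocale H: chilbert_space fscale "Bergman t" "ip t"
proof
  show "fun_vs.subspace (Bergman t)" by (rule subspace_Bergman)
next
  fix x assume x: "x \<in> Bergman t" "ip t x x = 0"
  show "x = 0"
  proof
    fix z
    have "nrm t x = 0" using x by (simp add: nrm_def)
    then have "x z = 0" if "cmod z < 1"
      using eval_le[OF x(1), of z "cmod z"] that by simp
    then show "x z = 0 z" using x(1) by (cases "cmod z < 1") (auto simp: Bergman_iff)
  qed
next
  fix X :: "nat \<Rightarrow> complex \<Rightarrow> complex"
  assume "\<And>n. X n \<in> Bergman t" "\<And>\<epsilon>. \<epsilon> > 0 \<Longrightarrow> \<exists>M. \<forall>m\<ge>M. \<forall>n\<ge>M. cip_space.nm (ip t) (X m - X n) < \<epsilon>"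
  then show "\<exists>x\<in>Bergman t. (\<lambda>n. cip_space.nm (ip t) (X n - x)) \<longlonglongrightarrow> 0"
    using Bergman_complete unfolding nm_eq_nrm by blast
next
  fix x y z :: "complex \<Rightarrow> complex" and c
  assume x: "x \<in> Bergman t"
  then show "0 \<le> Re (ip t x x)" by (intro L2.inn_self_ge0 Bergman_L2)
  assume y: "y \<in> Bergman t"
  show "ip t y x = cnj (ip t x y)" using x y by (intro L2.inn_cnj Bergman_L2)
  show "ip t (fscale c x) y = c * ip t x y" using x y by (intro L2.inn_scale_left Bergman_L2)
  assume z: "z \<in> Bergman t"
  show "ip t (x + y) z = ip t x z + ip t y z" using x y z by (intro L2.inn_add_left Bergman_L2)
qed

lemma orthonormal_iff: "H.orthonormal e \<longleftrightarrow> orthonormal_seq t e"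
  by (simp add: H.orthonormal_def orthonormal_seq_def)

lemma orthonormal_basis_iff: "H.orthonormal_basis e \<longleftrightarrow> onb t e"
  by (simp add: H.orthonormal_basis_def onb_def orthonormal_iff zero_fun_def)

section \<open>Orthonormal monomials and the orthogonal projection\<close>

definition monom_basis :: "nat \<Rightarrow> complex \<Rightarrow> complex" where
  "monom_basis n z = (if cmod z < 1 then z ^ n / of_real (sqrt (moment t n)) else 0)"

lemma monom_basis_Bergman: "monom_basis n \<in> Bergman t"
proof -
  have "(\<lambda>z. z ^ n / of_real (sqrt (moment t n))) holomorphic_on ball 0 1"
    using moment_pos[OF t_gt1, of n] by (intro holomorphic_intros) auto
  then have hol: "monom_basis n holomorphic_on ball 0 1"
    by (rule holomorphic_transform) (simp add: monom_basis_def)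
  have "monom_basis n \<in> L2 t"
  proof (rule L2_bounded)
    show "monom_basis n \<in> borel_measurable (mu t)"
      by (intro measurable_mu_continuous holomorphic_on_imp_continuous_on hol)
    show "cmod (monom_basis n w) \<le> 1 / sqrt (moment t n)" if "w \<in> ball 0 1" for w
      using that moment_pos[OF t_gt1, of n]
      by (auto simp: monom_basis_def norm_divide norm_power intro!: divide_right_mono power_le_one)
  qed
  with hol show ?thesis by (simp add: Bergman_iff monom_basis_def)
qed

lemma ip_monom_basis:
  assumes "h \<in> Bergman t"
  shows "ip t h (monom_basis n) = (deriv ^^ n) h 0 / fact n * of_real (sqrt (moment t n))"
proof -
  have m: "moment t n > 0" by (rule moment_pos[OF t_gt1])
  have "ip t h (monom_basis n) = (\<integral>w. 1 / of_real (sqrt (moment t n)) * (h w * cnj w ^ n) \<partial>mu t)"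
    unfolding ip_def by (intro Bochner_Integration.integral_cong refl) (auto simp: monom_basis_def)
  also have "\<dots> = 1 / of_real (sqrt (moment t n)) * (\<integral>w. h w * cnj w ^ n \<partial>mu t)"
    by (rule integral_mult_right_zero)
  also have "\<dots> = (deriv ^^ n) h 0 / fact n * (of_real (moment t n) / of_real (sqrt (moment t n)))"
    by (simp add: taylor_coeff_integral[OF assms])
  also have "of_real (moment t n) / of_real (sqrt (moment t n)) = (of_real (sqrt (moment t n)) :: complex)"
    using m by (simp add: real_div_sqrt flip: of_real_divide)
  finally show ?thesis .
qed

text \<open>Fourier coefficients are multiples of Taylor coefficients, so a function orthogonal to
  all monomials vanishes. Apart from giving the projection, this basis shows that the choice in the
  definition of \<open>trace\<close> is not void.\<close>

lemma monom_basis_onb: "H.orthonormal_basis monom_basis"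
proof -
  have m: "moment t n > 0" for n by (rule moment_pos[OF t_gt1])
  have "ip t (monom_basis k) (monom_basis n) = (if k = n then 1 else 0)" for k n
  proof (cases "k = n")
    case True
    have "(\<integral>w. (cmod (monom_basis n w))\<^sup>2 \<partial>mu t) = (\<integral>w. 1 / moment t n * cmod w ^ (2 * n) \<partial>mu t)"
      using m[of n] by (intro Bochner_Integration.integral_cong refl)
        (auto simp: monom_basis_def norm_divide norm_power power_divide mult.commute power_mult[symmetric])
    then show ?thesis using True m[of n] by (simp add: ip_self integral_moment)
  next
    case False
    have "(\<integral>w. indicator (ball 0 1) w * (w ^ k * cnj w ^ n) \<partial>mu t) = 0"
      by (rule moment_disc_orthogonal[OF False])
    moreover have "ip t (monom_basis k) (monom_basis n)
       = (\<integral>w. 1 / of_real (sqrt (moment t k) * sqrt (moment t n)) * (indicator (ball 0 1) w * (w ^ k * cnj w ^ n)) \<partial>mu t)"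
      unfolding ip_def by (intro Bochner_Integration.integral_cong refl) (auto simp: monom_basis_def)
    ultimately show ?thesis using False by simp
  qed
  then have "H.orthonormal monom_basis"
    by (simp add: H.orthonormal_def monom_basis_Bergman)
  moreover have "h = 0" if h: "h \<in> Bergman t" and 0: "\<forall>n. ip t h (monom_basis n) = 0" for h
  proof
    fix z
    have hol: "h holomorphic_on ball 0 1" using h by (simp add: Bergman_iff)
    have "(deriv ^^ n) h 0 = 0" for n
      using 0[rule_format, of n] m[of n] unfolding ip_monom_basis[OF h] by simp
    then have "h z = 0" if "cmod z < 1"
      using holomorphic_power_series[OF hol, of z] that by (simp add: sums_iff)
    then show "h z = 0 z" using h by (cases "cmod z < 1") (auto simp: Bergman_iff)
  qed
  ultimately show ?thesis by (simp add: H.orthonormal_basis_def)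
qed

text \<open>The projection is the Fourier series of \<open>\<phi>\<close> in the monomials. Bessel
  is applied in \<open>L2 t\<close>, where \<open>\<phi>\<close> lives, and completeness in the
  Bergman space, where the partial sums live. Agreement on the basis extends to every
  \<open>k\<close> by continuity.\<close>

lemma projection_exists:
  assumes \<phi>: "\<phi> \<in> L2 t"
  shows "\<exists>!u. u \<in> Bergman t \<and> (\<forall>k\<in>Bergman t. ip t u k = ip t \<phi> k)"
proof (rule ex_ex1I)
  let ?e = monom_basis
  let ?S = "\<lambda>n. \<Sum>i<n. fscale (ip t \<phi> (?e i)) (?e i)"
  have on: "H.orthonormal ?e" using monom_basis_onb by (simp add: H.orthonormal_basis_def)
  have on2: "L2.orthonormal t ?e"
    using on by (auto simp: H.orthonormal_def L2.orthonormal_def intro: Bergman_L2)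
  have SV: "?S n \<in> Bergman t" for n
    by (intro H.V_sum H.V_closed monom_basis_Bergman)
  obtain u where u: "u \<in> Bergman t" "(\<lambda>n. nrm t (?S n - u)) \<longlonglongrightarrow> 0"
    using Bergman_complete[of ?S, OF SV] L2.Bessel_tail_Cauchy[OF on2 \<phi>] unfolding nm_eq_nrm by blast
  have ue: "ip t u (?e j) = ip t \<phi> (?e j)" for j
    using H.fourier_limit[OF on u(1), of "\<lambda>i. ip t \<phi> (?e i)"] u(2) by (simp add: nm_eq_nrm)
  have "ip t u k = ip t \<phi> k" if k: "k \<in> Bergman t" for k
  proof -
    let ?T = "\<lambda>n. \<Sum>i<n. fscale (ip t k (?e i)) (?e i)"
    have TV: "?T n \<in> L2 t" for n
      by (intro Bergman_L2 H.V_sum H.V_closed monom_basis_Bergman)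
    have Tlim: "(\<lambda>n. nrm t (?T n - k)) \<longlonglongrightarrow> 0"
      using H.fourier_expansion[OF monom_basis_onb k] by (simp add: nm_eq_nrm)
    have "(\<lambda>n. ip t u (?T n)) \<longlonglongrightarrow> ip t u k" "(\<lambda>n. ip t \<phi> (?T n)) \<longlonglongrightarrow> ip t \<phi> k"
      using Tlim TV Bergman_L2[OF k] Bergman_L2[OF u(1)] \<phi>
      by (auto intro!: L2.tendsto_inn_right simp: nm_eq_nrm)
    moreover have "ip t u (?T n) = ip t \<phi> (?T n)" for n
      using Bergman_L2[OF monom_basis_Bergman] Bergman_L2[OF u(1)] \<phi>
      by (simp add: L2.inn_sum_right L2.inn_scale_right ue)
    ultimately show ?thesis using LIMSEQ_unique by simp
  qed
  then show "\<exists>u. u \<in> Bergman t \<and> (\<forall>k\<in>Bergman t. ip t u k = ip t \<phi> k)" using u by blast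
  fix u v
  assume "u \<in> Bergman t \<and> (\<forall>k\<in>Bergman t. ip t u k = ip t \<phi> k)"
    "v \<in> Bergman t \<and> (\<forall>k\<in>Bergman t. ip t v k = ip t \<phi> k)"
  then show "u = v" by (intro H.eq_if_inn_eq) auto
qed

end

section \<open>Toeplitz operators with separated symbols\<close>

context disc_weight
begin

definition proj :: "(complex \<Rightarrow> complex) \<Rightarrow> complex \<Rightarrow> complex" where
  "proj \<phi> = (THE u. u \<in> Bergman t \<and> (\<forall>k\<in>Bergman t. ip t u k = ip t \<phi> k))"

lemma
  assumes "\<phi> \<in> L2 t"
  shows proj_Bergman: "proj \<phi> \<in> Bergman t"
    and ip_proj: "k \<in> Bergman t \<Longrightarrow> ip t (proj \<phi>) k = ip t \<phi> k"
  using theI'[OF projection_exists[OF assms]] by (auto simp: proj_def)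

lemma proj_eqI:
  assumes "\<phi> \<in> L2 t" "u \<in> Bergman t" "\<And>k. k \<in> Bergman t \<Longrightarrow> ip t u k = ip t \<phi> k"
  shows "proj \<phi> = u"
  using assms by (intro H.eq_if_inn_eq proj_Bergman) (auto simp: ip_proj)

lemma proj_eval: "\<phi> \<in> L2 t \<Longrightarrow> cmod z < 1 \<Longrightarrow> proj \<phi> z = (\<integral>w. kern t z w * \<phi> w \<partial>mu t)"
  using eval_eq_ip[OF proj_Bergman, of \<phi> z] ip_proj[of \<phi> "kfun z"] kfun_Bergman[of z] ip_kfun[of z \<phi>] by simp

lemma nrm_proj_le:
  assumes \<phi>: "\<phi> \<in> L2 t"
  shows "nrm t (proj \<phi>) \<le> nrm t \<phi>"
proof -
  let ?u = "proj \<phi>"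
  have u: "?u \<in> Bergman t" "?u \<in> L2 t" using proj_Bergman[OF \<phi>] Bergman_L2 by auto
  have "(nrm t ?u)\<^sup>2 = Re (ip t \<phi> ?u)"
    using L2.nm_square[OF u(2)] ip_proj[OF \<phi> u(1)] by (simp add: nm_eq_nrm)
  also have "\<dots> \<le> nrm t \<phi> * nrm t ?u"
    using L2.Cauchy_Schwarz[OF \<phi> u(2)] complex_Re_le_cmod[of "ip t \<phi> ?u"] by (simp add: nm_eq_nrm)
  finally have "nrm t ?u * nrm t ?u \<le> nrm t \<phi> * nrm t ?u" by (simp add: power2_eq_square)
  moreover have "0 \<le> nrm t ?u" "0 \<le> nrm t \<phi>" using L2.nm_ge0[OF u(2)] L2.nm_ge0[OF \<phi>] by (auto simp: nm_eq_nrm)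
  ultimately show ?thesis by (cases "nrm t ?u = 0") auto
qed

lemma Toeplitz_eq_proj: "Toeplitz t f h = proj (\<lambda>z. f z * h z)"
  by (simp add: Toeplitz_def proj_def ip_def)

text \<open>The bound holds everywhere, not only almost everywhere, so that the kernel estimates can
  be pointwise; \<open>ex_symbol_version\<close> reduces essentially bounded functions to this
  case.\<close>

definition symbol :: "(complex \<Rightarrow> complex) \<Rightarrow> bool" where
  "symbol f \<longleftrightarrow> f \<in> borel_measurable (mu t) \<and> (\<exists>B. \<forall>z. cmod (f z) \<le> B)"

lemma symbol_mult: "symbol f \<Longrightarrow> h \<in> Bergman t \<Longrightarrow> (\<lambda>z. f z * h z) \<in> L2 t"
  unfolding symbol_def using L2_bounded_mult[OF Bergman_L2] by blast

lemma symbol_cnj: "symbol f \<Longrightarrow> symbol (\<lambda>z. cnj (f z))"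
  by (simp add: symbol_def borel_measurable_cnj)

lemma Toeplitz_Bergman [simp]: "symbol f \<Longrightarrow> h \<in> Bergman t \<Longrightarrow> Toeplitz t f h \<in> Bergman t"
  by (simp add: Toeplitz_eq_proj proj_Bergman symbol_mult)

lemma ip_Toeplitz:
  "symbol f \<Longrightarrow> h \<in> Bergman t \<Longrightarrow> k \<in> Bergman t \<Longrightarrow> ip t (Toeplitz t f h) k = (\<integral>z. f z * h z * cnj (k z) \<partial>mu t)"
  unfolding Toeplitz_eq_proj by (subst ip_proj) (auto simp: symbol_mult ip_def)

lemma Toeplitz_adjoint:
  assumes "symbol f" "h \<in> Bergman t" "k \<in> Bergman t"
  shows "ip t (Toeplitz t f h) k = ip t h (Toeplitz t (\<lambda>z. cnj (f z)) k)"
proof -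
  have "ip t h (Toeplitz t (\<lambda>z. cnj (f z)) k) = cnj (ip t (Toeplitz t (\<lambda>z. cnj (f z)) k) h)"
    using assms by (intro H.inn_cnj) (auto simp: symbol_cnj)
  also have "\<dots> = cnj (\<integral>z. cnj (f z) * k z * cnj (h z) \<partial>mu t)"
    using assms by (simp add: ip_Toeplitz symbol_cnj)
  also have "\<dots> = (\<integral>z. cnj (cnj (f z) * k z * cnj (h z)) \<partial>mu t)"
    by (rule Bochner_Integration.integral_cnj[symmetric])
  also have "\<dots> = ip t (Toeplitz t f h) k"
    using assms by (simp add: ip_Toeplitz mult_ac)
  finally show ?thesis ..
qed

lemma Toeplitz_add_symbol:
  assumes f: "symbol f1" "symbol f2" and h: "h \<in> Bergman t"
  shows "Toeplitz t (\<lambda>z. f1 z + f2 z) h = Toeplitz t f1 h + Toeplitz t f2 h"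
proof -
  have L: "(\<lambda>z. f1 z * h z) \<in> L2 t" "(\<lambda>z. f2 z * h z) \<in> L2 t" using f h by (simp_all add: symbol_mult)
  have eq: "(\<lambda>z. (f1 z + f2 z) * h z) = (\<lambda>z. f1 z * h z) + (\<lambda>z. f2 z * h z)"
    by (simp add: fun_eq_iff distrib_right)
  show ?thesis
    unfolding Toeplitz_eq_proj eq
    using L by (intro proj_eqI) (auto simp: proj_Bergman ip_proj H.inn_add_left L2.inn_add_left Bergman_L2 L2_add)
qed

lemma Toeplitz_add_arg:
  assumes f: "symbol f" and h: "h1 \<in> Bergman t" "h2 \<in> Bergman t"
  shows "Toeplitz t f (h1 + h2) = Toeplitz t f h1 + Toeplitz t f h2"
proof -
  have L: "(\<lambda>z. f z * h1 z) \<in> L2 t" "(\<lambda>z. f z * h2 z) \<in> L2 t" using f h by (simp_all add: symbol_mult)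
  have eq: "(\<lambda>z. f z * (h1 + h2) z) = (\<lambda>z. f z * h1 z) + (\<lambda>z. f z * h2 z)"
    by (simp add: fun_eq_iff distrib_left)
  show ?thesis
    unfolding Toeplitz_eq_proj eq
    using L by (intro proj_eqI) (auto simp: proj_Bergman ip_proj H.inn_add_left L2.inn_add_left Bergman_L2 L2_add)
qed

lemma proj_zero: "proj (\<lambda>z. 0) = 0"
  using L2.V_closed(1)[of t] Bergman_L2 by (intro proj_eqI) (auto simp: zero_fun_def[symmetric])

end

text \<open>Both arguments are smaller than \<open>pi / 2\<close> in modulus, hence the principal
  logarithm is additive here.\<close>

lemma powr_times_Re_pos:
  fixes u v s :: complex
  assumes "0 < Re u" "0 < Re v"
  shows "(u * v) powr s = u powr s * v powr s"
proof -
  have nz: "u \<noteq> 0" "v \<noteq> 0" using assms by auto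
  have "\<bar>Im (Ln u)\<bar> < pi / 2" "\<bar>Im (Ln v)\<bar> < pi / 2" using assms Re_Ln_pos_lt[OF nz(1)] Re_Ln_pos_lt[OF nz(2)] by blast+
  then have "Ln (u * v) = Ln u + Ln v" using nz by (intro Ln_times_simple) auto
  then show ?thesis using nz by (simp add: powr_def exp_add distrib_left)
qed

text \<open>The \<open>i\<close>-th Taylor coefficient at \<open>z = a\<close> of the kernel as a
  function of \<open>z\<close>.\<close>

definition kern_coeff :: "real \<Rightarrow> complex \<Rightarrow> nat \<Rightarrow> complex \<Rightarrow> complex" where
  "kern_coeff t a i w = of_real ((t - 1) / pi * (pochhammer t i / fact i)) *
     cnj w ^ i * (1 - a * cnj w) powr (- of_real t) / (1 - a * cnj w) ^ i"

text \<open>With \<open>u = 1 - a * cnj w\<close> one has \<open>1 - z * cnj w = u * (1 - x)\<close>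
  for \<open>x = (z - a) * cnj w / u\<close>, and \<open>|x| < 1\<close> by assumption. Both factors
  lie in the right half-plane, so the power splits and the binomial series applies to the second
  one. The centre \<open>a\<close> may lie on the unit circle.\<close>

lemma kern_local_sums:
  assumes a: "cmod a \<le> 1" and w: "cmod w < 1" and za: "cmod (z - a) < cmod (1 - a * cnj w)"
  shows "(\<lambda>i. (z - a) ^ i * kern_coeff t a i w) sums kern t z w"
proof -
  define u where "u = 1 - a * cnj w"
  have u: "0 < Re u" unfolding u_def by (rule Re_kernel_pos[OF a w])
  then have u0: "u \<noteq> 0" by auto
  define x where "x = (z - a) * cnj w / u"
  have "cmod (z - a) * cmod w \<le> cmod (z - a) * 1" using w by (intro mult_left_mono) auto
  then have x: "cmod x < 1" using za u0 by (simp add: x_def u_def[symmetric] norm_mult norm_divide divide_less_eq)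
  then have "0 < Re (1 - x)" using complex_Re_le_cmod[of x] by simp
  moreover have "1 - z * cnj w = u * (1 - x)" using u0 by (simp add: x_def u_def field_simps)
  ultimately have "kern t z w = of_real ((t - 1) / pi) * u powr (- of_real t) * (1 - x) powr (- of_real t)"
    using u by (simp add: kern_def powr_times_Re_pos mult.assoc)
  moreover have "(\<lambda>i. of_real ((t - 1) / pi) * u powr (- of_real t) * (of_real (pochhammer t i / fact i) * x ^ i))
      sums (of_real ((t - 1) / pi) * u powr (- of_real t) * (1 - x) powr (- of_real t))"
    by (intro sums_mult binomial_series_neg x)
  moreover have "of_real ((t - 1) / pi) * u powr (- of_real t) * (of_real (pochhammer t i / fact i) * x ^ i)
      = (z - a) ^ i * kern_coeff t a i w" for i
    unfolding kern_coeff_def u_def[symmetric] x_def power_divide power_mult_distrib of_real_mult by (simp add: mult_ac)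
  ultimately show ?thesis by simp
qed

lemma kern_coeff_le:
  assumes t: "t > 1" and d: "d > 0" and w: "cmod w < 1" and dw: "d \<le> cmod (1 - a * cnj w)"
  shows "cmod (kern_coeff t a i w) \<le> (t - 1) / pi * (pochhammer t i / fact i) * d powr (- t) / d ^ i"
proof -
  have nz: "1 - a * cnj w \<noteq> 0" using d dw by auto
  have p: "0 \<le> pochhammer t i" using t by (simp add: pochhammer_nonneg)
  then have c: "0 \<le> (t - 1) / pi * (pochhammer t i / fact i)" using t by simp
  have "cmod (kern_coeff t a i w) = (t - 1) / pi * (pochhammer t i / fact i) * cmod w ^ i
      * cmod (1 - a * cnj w) powr (- t) / cmod (1 - a * cnj w) ^ i"
    unfolding kern_coeff_def norm_mult norm_divide norm_power norm_of_real abs_of_nonneg[OF c]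
    using cmod_powr_of_real[OF nz, of "- t"] by simp
  also have "\<dots> \<le> (t - 1) / pi * (pochhammer t i / fact i) * 1 * d powr (- t) / d ^ i"
    using p d dw w t by (intro frac_le mult_mono powr_mono2' power_mono power_le_one mult_nonneg_nonneg) auto
  finally show ?thesis by simp
qed

section \<open>One disc: expansion of the product and its trace\<close>

context disc_weight
begin

context
  fixes f g :: "complex \<Rightarrow> complex" and a :: complex and d :: real
  assumes f: "symbol f" and g: "symbol g" and a: "cmod a \<le> 1" and d: "d > 0"
    and f_supp: "\<And>z. f z \<noteq> 0 \<Longrightarrow> cmod z < 1 \<and> cmod (z - a) < d"
    and g_supp: "\<And>w. g w \<noteq> 0 \<Longrightarrow> cmod w < 1 \<and> 2 * d \<le> cmod (w - a)"
begin

definition "f_piece i z = f z * (z - a) ^ i"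
definition "g_piece i w = g w * kern_coeff t a i w"
definition "f_vec i = proj (f_piece i)"
text \<open>The conjugate compensates for the conjugate linearity of \<open>ip\<close> in its second
  argument: \<open>ip t h (g_vec i)\<close> is the integral of
  \<open>g_piece i w * h w\<close>.\<close>

definition "g_vec i = proj (\<lambda>w. cnj (g_piece i w))"
text \<open>Bounds the \<open>i\<close>-th coefficient on the support of \<open>g\<close>, where
  \<open>|1 - a * cnj w|\<close> is at least \<open>2 * d\<close>. Together with
  \<open>|z - a| < d\<close> on the support of \<open>f\<close>, the powers combine to
  \<open>(1 / 2) ^ i\<close>.\<close>

definition "coeff_bound i = (t - 1) / pi * (pochhammer t i / fact i) * (2 * d) powr (- t) / (2 * d) ^ i"

lemma coeff_bound_nonneg: "0 \<le> coeff_bound i"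
  using t_gt1 d by (simp add: coeff_bound_def pochhammer_nonneg)

lemma summable_coeff_bound: "summable (\<lambda>i. d ^ i * coeff_bound i)"
proof -
  have "(\<lambda>i. d ^ i * coeff_bound i) = (\<lambda>i. (t - 1) / pi * (2 * d) powr (- t) * (pochhammer t i / fact i * (1 / 2) ^ i))"
    using d by (simp add: coeff_bound_def fun_eq_iff power_mult_distrib power_divide)
  moreover have "summable (\<lambda>i. (t - 1) / pi * (2 * d) powr (- t) * (pochhammer t i / fact i * (1 / 2) ^ i))"
    by (intro summable_mult summable_pochhammer) auto
  ultimately show ?thesis by simp
qed

lemma g_supp_kernel: "g w \<noteq> 0 \<Longrightarrow> 2 * d \<le> cmod (1 - a * cnj w)"
  using g_supp[of w] cmod_diff_le_kernel[OF a, of w] by (simp add: norm_minus_commute)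

lemma kern_coeff_bound: "g w \<noteq> 0 \<Longrightarrow> cmod (kern_coeff t a i w) \<le> coeff_bound i"
  unfolding coeff_bound_def using g_supp[of w] g_supp_kernel[of w] d t_gt1 by (intro kern_coeff_le) auto

lemma f_power_bound: "f z \<noteq> 0 \<Longrightarrow> cmod (z - a) ^ i \<le> d ^ i"
  using f_supp[of z] by (intro power_mono) auto

lemma kern_piece_sums:
  assumes "f z \<noteq> 0" "g w \<noteq> 0"
  shows "(\<lambda>i. (z - a) ^ i * kern_coeff t a i w) sums kern t z w"
  using f_supp[OF assms(1)] g_supp[OF assms(2)] g_supp_kernel[OF assms(2)] d by (intro kern_local_sums a) auto

text \<open>By the triangle inequality, points of the two supports are at least
  \<open>2 * d - d\<close> apart.\<close>

lemma kern_piece_bound: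
  assumes "f z \<noteq> 0" "g w \<noteq> 0"
  shows "cmod (kern t w z) \<le> (t - 1) / pi * d powr (- t)"
proof (rule kern_cmod_le[OF t_gt1 d])
  have "2 * d \<le> cmod (w - z) + cmod (z - a)"
    using g_supp[OF assms(2)] norm_triangle_ineq[of "w - z" "z - a"] by simp
  then have "d \<le> cmod (w - z)" using f_supp[OF assms(1)] by simp
  also have "\<dots> \<le> cmod (1 - w * cnj z)"
    using f_supp[OF assms(1)] g_supp[OF assms(2)] by (intro cmod_diff_le_kernel) auto
  finally show "d \<le> cmod (1 - w * cnj z)" .
qed

lemma kern_coeff_measurable: "kern_coeff t a i \<in> borel_measurable (mu t)"
proof (rule measurable_mu_continuous)
  have pos: "0 < Re (1 - a * cnj w)" if "w \<in> ball 0 1" for w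
    using that by (intro Re_kernel_pos a) auto
  then have nz: "1 - a * cnj w \<noteq> 0" if "w \<in> ball 0 1" for w using that by fastforce
  show "continuous_on (ball 0 1) (kern_coeff t a i)"
    unfolding kern_coeff_def
    by (intro continuous_intros) (use nz in auto, use pos in fastforce)
qed

lemma f_measurable: "f \<in> borel_measurable (mu t)" and g_measurable: "g \<in> borel_measurable (mu t)"
  using f g by (auto simp: symbol_def)

lemma f_piece_measurable: "f_piece i \<in> borel_measurable (mu t)"
  unfolding f_piece_def
  by (intro borel_measurable_times f_measurable borel_measurable_mu borel_measurable_continuous_onI continuous_intros)

lemma g_piece_measurable: "g_piece i \<in> borel_measurable (mu t)"
  unfolding g_piece_def by (intro borel_measurable_times g_measurable kern_coeff_measurable)

lemma pieces_bounded:
  obtains Bf Bg where "0 \<le> Bf" "0 \<le> Bg" "\<And>z. cmod (f z) \<le> Bf" "\<And>w. cmod (g w) \<le> Bg"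
    "\<And>i z. cmod (f_piece i z) \<le> Bf * d ^ i" "\<And>i w. cmod (g_piece i w) \<le> Bg * coeff_bound i"
proof -
  obtain Bf Bg where B: "\<And>z. cmod (f z) \<le> Bf" "\<And>w. cmod (g w) \<le> Bg"
    using f g by (auto simp: symbol_def)
  have nn: "0 \<le> Bf" "0 \<le> Bg" using order_trans[OF norm_ge_zero B(1)] order_trans[OF norm_ge_zero B(2)] by blast+
  have 1: "cmod (f_piece i z) \<le> Bf * d ^ i" for i z
  proof (cases "f z = 0")
    case False
    then show ?thesis
      unfolding f_piece_def norm_mult norm_power using B nn f_power_bound by (intro mult_mono) auto
  qed (use nn d in \<open>simp add: f_piece_def\<close>)
  have 2: "cmod (g_piece i w) \<le> Bg * coeff_bound i" for i w
  proof (cases "g w = 0")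
    case False
    then show ?thesis
      unfolding g_piece_def norm_mult using B nn kern_coeff_bound by (intro mult_mono) auto
  qed (use nn coeff_bound_nonneg in \<open>simp add: g_piece_def\<close>)
  show thesis by (rule that[OF nn B 1 2])
qed

lemma f_piece_L2: "f_piece i \<in> L2 t"
  using pieces_bounded L2_bounded(1)[OF f_piece_measurable] by metis

lemma g_piece_L2: "g_piece i \<in> L2 t"
  using pieces_bounded L2_bounded(1)[OF g_piece_measurable] by metis

lemma f_vec_Bergman: "f_vec i \<in> Bergman t" and g_vec_Bergman: "g_vec i \<in> Bergman t"
  by (simp_all add: f_vec_def g_vec_def proj_Bergman f_piece_L2 L2_cnj g_piece_L2)

lemma ip_g_vec:
  assumes h: "h \<in> Bergman t"
  shows "ip t h (g_vec i) = (\<integral>w. g_piece i w * h w \<partial>mu t)"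
proof -
  have "ip t h (g_vec i) = cnj (ip t (g_vec i) h)"
    by (rule H.inn_cnj[OF g_vec_Bergman h])
  also have "\<dots> = cnj (\<integral>w. cnj (g_piece i w) * cnj (h w) \<partial>mu t)"
    using ip_proj[OF L2_cnj[OF g_piece_L2] h, of i]
    by (simp only: g_vec_def ip_def[of t "\<lambda>w. cnj (g_piece i w)"])
  also have "\<dots> = (\<integral>w. cnj (cnj (g_piece i w) * cnj (h w)) \<partial>mu t)"
    by (rule Bochner_Integration.integral_cnj[symmetric])
  finally show ?thesis by simp
qed

text \<open>Where \<open>f z\<close> is nonzero, the kernel expansion about \<open>a\<close> holds
  for every \<open>w\<close> with \<open>g w\<close> nonzero, so it can be integrated termwise. Such
  \<open>z\<close> suffice, since the result is multiplied by \<open>f\<close> afterwards.\<close>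

lemma Toeplitz_eval_sums:
  assumes h: "h \<in> Bergman t" and z: "f z \<noteq> 0"
  shows "(\<lambda>i. (z - a) ^ i * ip t h (g_vec i)) sums Toeplitz t g h z"
proof -
  obtain Bf Bg where B: "0 \<le> Bg" "\<And>i w. cmod (g_piece i w) \<le> Bg * coeff_bound i"
    using pieces_bounded by metis
  have hL: "h \<in> L2 t" by (rule Bergman_L2[OF h])
  have "(\<lambda>i. \<integral>w. (z - a) ^ i * (g_piece i w * h w) \<partial>mu t) sums (\<integral>w. kern t z w * (g w * h w) \<partial>mu t)"
  proof (rule sums_integral_dominated[where k = "\<lambda>w. Bg * cmod (h w)", OF _ _ summable_coeff_bound])
    show "(\<lambda>w. (z - a) ^ i * (g_piece i w * h w)) \<in> borel_measurable (mu t)" for i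
      by (intro borel_measurable_times borel_measurable_const g_piece_measurable L2_measurable[OF hL])
    show "integrable (mu t) (\<lambda>w. Bg * cmod (h w))"
      using L2_integrable[OF hL] by simp
    fix w
    show "cmod ((z - a) ^ i * (g_piece i w * h w)) \<le> d ^ i * coeff_bound i * (Bg * cmod (h w))" for i
    proof -
      have "cmod (z - a) ^ i * cmod (g_piece i w) \<le> d ^ i * (Bg * coeff_bound i)"
        using f_power_bound[OF z] B d by (intro mult_mono) auto
      from mult_right_mono[OF this norm_ge_zero[of "h w"]] show ?thesis
        by (simp add: norm_mult norm_power mult_ac)
    qed
    show "(\<lambda>i. (z - a) ^ i * (g_piece i w * h w)) sums (kern t z w * (g w * h w))"
    proof (cases "g w = 0")
      case False
      from sums_mult2[OF kern_piece_sums[OF z False], of "g w * h w"] show ?thesis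
        by (simp add: g_piece_def mult_ac)
    qed (simp add: g_piece_def)
  qed
  moreover have "Toeplitz t g h z = (\<integral>w. kern t z w * (g w * h w) \<partial>mu t)"
    unfolding Toeplitz_eq_proj using f_supp[OF z] by (intro proj_eval symbol_mult g h) auto
  ultimately show ?thesis by (simp add: ip_g_vec[OF h])
qed

lemma ip_g_vec_le:
  assumes h: "h \<in> Bergman t" and B: "\<And>i w. cmod (g_piece i w) \<le> Bg * coeff_bound i"
  shows "cmod (ip t h (g_vec i)) \<le> Bg * coeff_bound i * (\<integral>w. cmod (h w) \<partial>mu t)"
proof -
  have hi: "integrable (mu t) h" by (rule L2_integrable[OF Bergman_L2[OF h]])
  have "cmod (ip t h (g_vec i)) \<le> (\<integral>w. cmod (g_piece i w * h w) \<partial>mu t)"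
    unfolding ip_g_vec[OF h] by (rule integral_norm_bound)
  also have "\<dots> \<le> (\<integral>w. Bg * coeff_bound i * cmod (h w) \<partial>mu t)"
  proof (rule integral_mono)
    have "integrable (mu t) (\<lambda>w. h w * cnj (cnj (g_piece i w)))"
      by (intro L2_integrable_mult Bergman_L2 h L2_cnj g_piece_L2)
    then show "integrable (mu t) (\<lambda>w. cmod (g_piece i w * h w))" by (simp add: mult.commute)
    show "integrable (mu t) (\<lambda>w. Bg * coeff_bound i * cmod (h w))" using hi by simp
    show "cmod (g_piece i w * h w) \<le> Bg * coeff_bound i * cmod (h w)" for w
      unfolding norm_mult using B by (intro mult_right_mono) auto
  qed
  finally show ?thesis by simp
qed

text \<open>Projections do not increase norms, so the norms of the vectors inherit the summable
  bounds of the pieces. The matrix coefficients come from integrating the pointwise expansion of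
  \<open>Toeplitz t g h\<close> against \<open>f z * cnj (k z)\<close>.\<close>

lemma nuclear_piece: "H.nuclear (\<lambda>h. Toeplitz t f (Toeplitz t g h)) g_vec f_vec"
  unfolding H.nuclear_def
proof (intro conjI ballI allI)
  obtain Bf Bg where B: "0 \<le> Bf" "0 \<le> Bg"
    "\<And>i z. cmod (f_piece i z) \<le> Bf * d ^ i" "\<And>i w. cmod (g_piece i w) \<le> Bg * coeff_bound i"
    using pieces_bounded by metis
  show "Toeplitz t f (Toeplitz t g h) \<in> Bergman t" if "h \<in> Bergman t" for h
    using that f g by simp
  show "g_vec i \<in> Bergman t" "f_vec i \<in> Bergman t" for i
    by (rule g_vec_Bergman f_vec_Bergman)+
  define m where "m = sqrt (measure (mu t) (ball 0 1))"
  have m: "0 \<le> m" by (simp add: m_def)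
  have "nrm t (g_vec i) * nrm t (f_vec i) \<le> (Bg * Bf * m\<^sup>2) * (d ^ i * coeff_bound i)" for i
  proof -
    have "nrm t (g_vec i) \<le> nrm t (\<lambda>w. cnj (g_piece i w))"
      unfolding g_vec_def by (intro nrm_proj_le L2_cnj g_piece_L2)
    also have "\<dots> \<le> Bg * coeff_bound i * m"
      unfolding m_def using B by (intro L2_bounded) (auto intro: borel_measurable_cnj g_piece_measurable)
    finally have 1: "nrm t (g_vec i) \<le> Bg * coeff_bound i * m" .
    have "nrm t (f_vec i) \<le> nrm t (f_piece i)"
      unfolding f_vec_def by (intro nrm_proj_le f_piece_L2)
    also have "\<dots> \<le> Bf * d ^ i * m"
      unfolding m_def using B by (intro L2_bounded f_piece_measurable) auto
    finally have 2: "nrm t (f_vec i) \<le> Bf * d ^ i * m" .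
    have "nrm t (g_vec i) * nrm t (f_vec i) \<le> (Bg * coeff_bound i * m) * (Bf * d ^ i * m)"
      using 1 2 H.nm_ge0[OF f_vec_Bergman, of i] B coeff_bound_nonneg m
      by (intro mult_mono) (auto simp: nm_eq_nrm)
    then show ?thesis by (simp add: power2_eq_square mult_ac)
  qed
  then show "summable (\<lambda>i. L2.nm t (g_vec i) * L2.nm t (f_vec i))"
    unfolding nm_eq_nrm
    using H.nm_ge0[OF f_vec_Bergman] H.nm_ge0[OF g_vec_Bergman]
    by (intro summable_comparison_test'[OF summable_mult[OF summable_coeff_bound]]) (auto simp: nm_eq_nrm abs_mult)
  fix h k assume h: "h \<in> Bergman t" and k: "k \<in> Bergman t"
  define N where "N = (\<integral>w. cmod (h w) \<partial>mu t)"
  have kL: "k \<in> L2 t" by (rule Bergman_L2[OF k])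
  have "(\<lambda>i. \<integral>z. ip t h (g_vec i) * (f_piece i z * cnj (k z)) \<partial>mu t) sums (\<integral>z. f z * Toeplitz t g h z * cnj (k z) \<partial>mu t)"
  proof (rule sums_integral_dominated[where k = "\<lambda>z. Bf * Bg * N * cmod (k z)", OF _ _ summable_coeff_bound])
    show "(\<lambda>z. ip t h (g_vec i) * (f_piece i z * cnj (k z))) \<in> borel_measurable (mu t)" for i
      by (intro borel_measurable_times borel_measurable_const f_piece_measurable borel_measurable_cnj L2_measurable[OF kL])
    show "integrable (mu t) (\<lambda>z. Bf * Bg * N * cmod (k z))"
      using L2_integrable[OF kL] by simp
    fix z
    show "cmod (ip t h (g_vec i) * (f_piece i z * cnj (k z))) \<le> d ^ i * coeff_bound i * (Bf * Bg * N * cmod (k z))" for i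
    proof -
      have "cmod (ip t h (g_vec i)) * cmod (f_piece i z) \<le> (Bg * coeff_bound i * N) * (Bf * d ^ i)"
        unfolding N_def using ip_g_vec_le[OF h B(4)] B coeff_bound_nonneg
        by (intro mult_mono) (auto intro!: mult_nonneg_nonneg)
      from mult_right_mono[OF this norm_ge_zero[of "k z"]] show ?thesis
        by (simp add: norm_mult mult_ac)
    qed
    show "(\<lambda>i. ip t h (g_vec i) * (f_piece i z * cnj (k z))) sums (f z * Toeplitz t g h z * cnj (k z))"
    proof (cases "f z = 0")
      case False
      from sums_mult2[OF Toeplitz_eval_sums[OF h False], of "f z * cnj (k z)"] show ?thesis
        by (simp add: f_piece_def mult_ac)
    qed (simp add: f_piece_def)
  qed
  moreover have "(\<integral>z. ip t h (g_vec i) * (f_piece i z * cnj (k z)) \<partial>mu t) = ip t h (g_vec i) * ip t (f_vec i) k" for i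
  proof -
    have "ip t (f_vec i) k = (\<integral>z. f_piece i z * cnj (k z) \<partial>mu t)"
      using ip_proj[OF f_piece_L2 k, of i] by (simp only: f_vec_def ip_def[of t "f_piece i"])
    then show ?thesis by (simp only: integral_mult_right_zero)
  qed
  ultimately show "(\<lambda>i. ip t h (g_vec i) * ip t (f_vec i) k) sums ip t (Toeplitz t f (Toeplitz t g h)) k"
    by (simp only: ip_Toeplitz[OF f Toeplitz_Bergman[OF g h] k])
qed

text \<open>The factor \<open>kern t w z\<close> comes from evaluating the projection
  \<open>f_vec i\<close> at \<open>w\<close>. Summation over \<open>i\<close> then reassembles
  \<open>kern t z w\<close> from \<open>kern_coeff t a i w\<close> and the power of
  \<open>z - a\<close> inside \<open>f_piece i\<close>.\<close>

lemma trace_piece: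
  "(\<lambda>i. ip t (f_vec i) (g_vec i)) sums (\<integral>w. g w * (\<integral>z. f z * kern t w z * kern t z w \<partial>mu t) \<partial>mu t)"
proof -
  obtain Bf Bg where B: "0 \<le> Bf" "0 \<le> Bg" "\<And>z. cmod (f z) \<le> Bf" "\<And>w. cmod (g w) \<le> Bg"
    "\<And>i z. cmod (f_piece i z) \<le> Bf * d ^ i" "\<And>i w. cmod (g_piece i w) \<le> Bg * coeff_bound i"
    using pieces_bounded by blast
  define K where "K = (t - 1) / pi * d powr (- t)"
  define N where "N = measure (mu t) (ball 0 1)"
  have K: "0 \<le> K" using t_gt1 by (simp add: K_def)
  have eval: "f_vec i w = (\<integral>z. kern t w z * f_piece i z \<partial>mu t)" if "cmod w < 1" for i w
    unfolding f_vec_def by (intro proj_eval f_piece_L2 that)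
  have kf: "cmod (kern t w z * f_piece i z) \<le> K * (Bf * d ^ i)" if w: "g w \<noteq> 0" for w z i
  proof (cases "f z = 0")
    case True
    then show ?thesis using K B d by (simp add: f_piece_def)
  next
    case False
    then show ?thesis unfolding norm_mult using kern_piece_bound[OF False w] B K
      by (intro mult_mono) (auto simp: K_def)
  qed
  have kf_meas: "(\<lambda>z. kern t w z * f_piece i z) \<in> borel_measurable (mu t)" if "cmod w < 1" for w i
  \<comment> \<open>For \<open>w\<close> in the disc, \<open>kern t w z\<close> is the conjugate of
    \<open>kfun w z\<close>, which reduces measurability in \<open>z\<close> to that of an element
    of the Bergman space.\<close>
  proof -
    have "(\<lambda>z. cnj (kfun w z) * f_piece i z) \<in> borel_measurable (mu t)"
      using kfun_Bergman[OF that] by (intro borel_measurable_times borel_measurable_cnj f_piece_measurable) (simp add: Bergman_def)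
    then show ?thesis
      by (rule measurable_cong[THEN iffD1, rotated]) (use that in \<open>simp add: kfun_def cnj_kern\<close>)
  qed
  have inner: "(\<lambda>i. kern_coeff t a i w * f_vec i w) sums (\<integral>z. f z * kern t w z * kern t z w \<partial>mu t)" if w: "g w \<noteq> 0" for w
  proof -
    have w1: "cmod w < 1" using g_supp[OF w] by simp
    have "(\<lambda>i. \<integral>z. kern_coeff t a i w * (kern t w z * f_piece i z) \<partial>mu t) sums (\<integral>z. f z * kern t w z * kern t z w \<partial>mu t)"
    proof (rule sums_integral_dominated[where k = "\<lambda>_. K * Bf", OF _ _ summable_coeff_bound])
      show "(\<lambda>z. kern_coeff t a i w * (kern t w z * f_piece i z)) \<in> borel_measurable (mu t)" for i
        by (intro borel_measurable_times[OF borel_measurable_const] kf_meas w1)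
      fix z
      show "cmod (kern_coeff t a i w * (kern t w z * f_piece i z)) \<le> d ^ i * coeff_bound i * (K * Bf)" for i
      proof -
        have "cmod (kern_coeff t a i w) * cmod (kern t w z * f_piece i z) \<le> coeff_bound i * (K * (Bf * d ^ i))"
          using kern_coeff_bound[OF w] kf[OF w] coeff_bound_nonneg by (intro mult_mono) auto
        then show ?thesis by (simp add: norm_mult mult_ac)
      qed
      show "(\<lambda>i. kern_coeff t a i w * (kern t w z * f_piece i z)) sums (f z * kern t w z * kern t z w)"
      proof (cases "f z = 0")
        case False
        from sums_mult2[OF kern_piece_sums[OF False w], of "f z * kern t w z"] show ?thesis
          by (simp add: f_piece_def mult_ac)
      qed (simp add: f_piece_def)
    qed simp
    then show ?thesis by (simp add: eval[OF w1])
  qed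
  have f_vec_le: "cmod (f_vec i w) \<le> K * (Bf * d ^ i) * N" if w: "g w \<noteq> 0" for i w
  proof -
    have w1: "cmod w < 1" using g_supp[OF w] by simp
    have "cmod (f_vec i w) \<le> (\<integral>z. cmod (kern t w z * f_piece i z) \<partial>mu t)"
      unfolding eval[OF w1] by (rule integral_norm_bound)
    also have "\<dots> \<le> (\<integral>z. K * (Bf * d ^ i) \<partial>mu t)"
    proof (rule integral_mono)
      have "integrable (mu t) (\<lambda>z. kern t w z * f_piece i z)"
        using kf[OF w] by (intro integrable_mu_bounded[OF kf_meas[OF w1]])
      then show "integrable (mu t) (\<lambda>z. cmod (kern t w z * f_piece i z))" by (rule integrable_norm)
      show "cmod (kern t w z * f_piece i z) \<le> K * (Bf * d ^ i)" for z by (rule kf[OF w])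
    qed simp
    finally show ?thesis by (simp add: N_def mult_ac)
  qed
  have "(\<lambda>i. \<integral>w. g_piece i w * f_vec i w \<partial>mu t) sums (\<integral>w. g w * (\<integral>z. f z * kern t w z * kern t z w \<partial>mu t) \<partial>mu t)"
  proof (rule sums_integral_dominated[where k = "\<lambda>_. Bg * K * Bf * N", OF _ _ summable_coeff_bound])
    show "(\<lambda>w. g_piece i w * f_vec i w) \<in> borel_measurable (mu t)" for i
      by (intro borel_measurable_times g_piece_measurable L2_measurable Bergman_L2 f_vec_Bergman)
    fix w
    show "cmod (g_piece i w * f_vec i w) \<le> d ^ i * coeff_bound i * (Bg * K * Bf * N)" for i
    proof (cases "g w = 0")
      case True
      then show ?thesis using d coeff_bound_nonneg B K by (simp add: g_piece_def N_def)
    next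
      case False
      have "cmod (g_piece i w) * cmod (f_vec i w) \<le> (Bg * coeff_bound i) * (K * (Bf * d ^ i) * N)"
        using B(6) f_vec_le[OF False] B(2) coeff_bound_nonneg by (intro mult_mono) auto
      then show ?thesis by (simp add: norm_mult mult_ac)
    qed
    show "(\<lambda>i. g_piece i w * f_vec i w) sums (g w * (\<integral>z. f z * kern t w z * kern t z w \<partial>mu t))"
    proof (cases "g w = 0")
      case False
      from sums_mult[OF inner[OF False], of "g w"] show ?thesis
        by (simp add: g_piece_def mult_ac)
    qed (simp add: g_piece_def)
  qed simp
  then show ?thesis by (simp add: ip_g_vec[OF f_vec_Bergman])
qed

lemma diagonal_sums_piece:
  assumes "onb t e"
  shows "(\<lambda>n. ip t (Toeplitz t f (Toeplitz t g (e n))) (e n))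
     sums (\<integral>w. g w * (\<integral>z. f z * kern t w z * kern t z w \<partial>mu t) \<partial>mu t)"
  using H.nuclear_trace[OF nuclear_piece, of e] assms sums_unique[OF trace_piece] by (simp add: orthonormal_basis_iff)

end

text \<open>Taking adjoints, the diagonal entries of the reversed product are the conjugates of
  those for the conjugate symbols in the original order. Conjugation exchanges the two kernel
  factors and hence preserves their product, so the same iterated integral appears, with
  \<open>w\<close> outside and \<open>z\<close> inside in both cases.\<close>

lemma commutator_diagonal_piece:
  assumes f: "symbol f" and g: "symbol g" and a: "cmod a \<le> 1" and d: "d > 0"
    and f_supp: "\<And>z. f z \<noteq> 0 \<Longrightarrow> cmod z < 1 \<and> cmod (z - a) < d"
    and g_supp: "\<And>w. g w \<noteq> 0 \<Longrightarrow> cmod w < 1 \<and> 2 * d \<le> cmod (w - a)"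
    and e: "onb t e"
  shows "(\<lambda>n. ip t (Toeplitz t f (Toeplitz t g (e n))) (e n) - ip t (Toeplitz t g (Toeplitz t f (e n))) (e n)) sums 0"
proof -
  define f' g' where "f' z = cnj (f z)" and "g' z = cnj (g z)" for z
  have sym: "symbol f'" "symbol g'" using f g by (simp_all add: f'_def[abs_def] g'_def[abs_def] symbol_cnj)
  define S where "S = (\<integral>w. g w * (\<integral>z. f z * kern t w z * kern t z w \<partial>mu t) \<partial>mu t)"
  have e_V: "e n \<in> Bergman t" for n using e by (simp add: onb_def orthonormal_seq_def)
  have fg: "(\<lambda>n. ip t (Toeplitz t f (Toeplitz t g (e n))) (e n)) sums S"
    unfolding S_def by (rule diagonal_sums_piece[OF f g a d f_supp g_supp e])
  have "(\<lambda>n. ip t (Toeplitz t f' (Toeplitz t g' (e n))) (e n))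
      sums (\<integral>w. g' w * (\<integral>z. f' z * kern t w z * kern t z w \<partial>mu t) \<partial>mu t)"
    by (rule diagonal_sums_piece[OF sym a d _ _ e]) (use f_supp g_supp in \<open>auto simp: f'_def g'_def\<close>)
  also have "(\<integral>w. g' w * (\<integral>z. f' z * kern t w z * kern t z w \<partial>mu t) \<partial>mu t) = cnj S"
  proof -
    have inner: "(\<integral>z. f' z * kern t w z * kern t z w \<partial>mu t) = cnj (\<integral>z. f z * kern t w z * kern t z w \<partial>mu t)"
      if "cmod w < 1" for w
    proof -
      have "(\<integral>z. f' z * kern t w z * kern t z w \<partial>mu t) = (\<integral>z. cnj (f z * kern t w z * kern t z w) \<partial>mu t)"
        using that by (intro Bochner_Integration.integral_cong refl) (simp add: f'_def cnj_kern mult_ac)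
      then show ?thesis by (simp only: Bochner_Integration.integral_cnj)
    qed
    have "(\<integral>w. g' w * (\<integral>z. f' z * kern t w z * kern t z w \<partial>mu t) \<partial>mu t)
        = (\<integral>w. cnj (g w * (\<integral>z. f z * kern t w z * kern t z w \<partial>mu t)) \<partial>mu t)"
      by (intro Bochner_Integration.integral_cong refl) (simp add: inner g'_def)
    then show ?thesis unfolding S_def by (simp only: Bochner_Integration.integral_cnj)
  qed
  finally have "(\<lambda>n. cnj (ip t (Toeplitz t f' (Toeplitz t g' (e n))) (e n))) sums cnj (cnj S)"
    by (simp only: sums_cnj)
  moreover have "cnj (ip t (Toeplitz t f' (Toeplitz t g' (e n))) (e n)) = ip t (Toeplitz t g (Toeplitz t f (e n))) (e n)" for n
  proof -
    have "ip t (Toeplitz t g (Toeplitz t f (e n))) (e n) = ip t (Toeplitz t f (e n)) (Toeplitz t g' (e n))"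
      unfolding g'_def using f g e_V by (intro Toeplitz_adjoint) auto
    also have "\<dots> = ip t (e n) (Toeplitz t f' (Toeplitz t g' (e n)))"
      unfolding f'_def using f sym e_V by (intro Toeplitz_adjoint) auto
    also have "\<dots> = cnj (ip t (Toeplitz t f' (Toeplitz t g' (e n))) (e n))"
      using sym e_V by (intro H.inn_cnj) auto
    finally show ?thesis ..
  qed
  ultimately have "(\<lambda>n. ip t (Toeplitz t g (Toeplitz t f (e n))) (e n)) sums S" by simp
  from sums_diff[OF fg this] show ?thesis by simp
qed

text \<open>Induction on the centres: \<open>f\<close> is split into its part \<open>f1\<close>
  inside the disc about \<open>c\<close> and the rest \<open>f2\<close>, whose points are covered by
  the remaining centres. Nuclearity and the vanishing of the summed commutator diagonal are both
  additive in \<open>f\<close>, while \<open>g\<close> stays fixed throughout.\<close>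

lemma separated_symbols:
  assumes "finite C" "symbol f" "symbol g" "d > 0" "C \<subseteq> cball 0 1"
    and "\<And>z. f z \<noteq> 0 \<Longrightarrow> cmod z < 1 \<and> (\<exists>c\<in>C. cmod (z - c) < d)"
    and "\<And>w. g w \<noteq> 0 \<Longrightarrow> cmod w < 1 \<and> (\<forall>c\<in>C. 2 * d \<le> cmod (w - c))"
  shows "(\<exists>a b. H.nuclear (\<lambda>h. Toeplitz t f (Toeplitz t g h)) a b) \<and>
    (\<forall>e. onb t e \<longrightarrow> (\<lambda>n. ip t (Toeplitz t f (Toeplitz t g (e n))) (e n) - ip t (Toeplitz t g (Toeplitz t f (e n))) (e n)) sums 0)"
  using assms
proof (induction C arbitrary: f rule: finite_induct)
  case empty
  then have "f = (\<lambda>z. 0)" by auto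
  then have Tf: "Toeplitz t f h = 0" for h by (simp add: Toeplitz_eq_proj proj_zero)
  have Tg: "Toeplitz t g 0 = 0" by (simp add: Toeplitz_eq_proj proj_zero)
  have "H.nuclear (\<lambda>h. Toeplitz t f (Toeplitz t g h)) (\<lambda>_. 0) (\<lambda>_. 0)"
    by (simp add: H.nuclear_def Tf)
  moreover have "(\<lambda>n. ip t (Toeplitz t f (Toeplitz t g (e n))) (e n) - ip t (Toeplitz t g (Toeplitz t f (e n))) (e n)) sums 0"
    if "onb t e" for e
    using that by (simp add: Tf Tg onb_def orthonormal_seq_def)
  ultimately show ?case by blast
next
  case (insert c C)
  define f1 where "f1 z = f z * indicator (ball c d) z" for z
  define f2 where "f2 z = f z * indicator (- ball c d) z" for z
  have f12: "f = (\<lambda>z. f1 z + f2 z)" by (auto simp: f1_def f2_def indicator_def)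
  have sym_ind: "symbol (\<lambda>z. f z * indicator X z)" if "X \<in> sets borel" for X
  proof -
    obtain B where B: "\<And>z. cmod (f z) \<le> B" using insert.prems(1) by (auto simp: symbol_def)
    have "0 \<le> B" using order_trans[OF norm_ge_zero B] .
    then have "cmod (f z * indicator X z) \<le> B" for z using B[of z] by (auto simp: indicator_def)
    moreover have "(\<lambda>z. f z * indicator X z) \<in> borel_measurable (mu t)"
      using insert.prems(1) that by (intro borel_measurable_times borel_measurable_mu[OF borel_measurable_indicator]) (auto simp: symbol_def)
    ultimately show ?thesis by (auto simp: symbol_def)
  qed
  have f1: "symbol f1" and f2: "symbol f2" unfolding f1_def f2_def by (auto intro!: sym_ind)
  have g: "symbol g" by (rule insert.prems(2))
  have f1_supp: "cmod z < 1 \<and> cmod (z - c) < d" if "f1 z \<noteq> 0" for z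
    using that insert.prems(5)[of z] by (auto simp: f1_def indicator_def dist_norm norm_minus_commute split: if_splits)
  have g_supp: "cmod w < 1 \<and> 2 * d \<le> cmod (w - c)" if "g w \<noteq> 0" for w
    using insert.prems(6)[OF that] by simp
  have c: "cmod c \<le> 1" using insert.prems(4) by simp
  have 1: "\<exists>a b. H.nuclear (\<lambda>h. Toeplitz t f1 (Toeplitz t g h)) a b"
    using nuclear_piece[OF f1 g c insert.prems(3) f1_supp g_supp] by blast
  have diag1: "(\<lambda>n. ip t (Toeplitz t f1 (Toeplitz t g (e n))) (e n) - ip t (Toeplitz t g (Toeplitz t f1 (e n))) (e n)) sums 0"
    if "onb t e" for e
    by (rule commutator_diagonal_piece[OF f1 g c insert.prems(3) f1_supp g_supp that])
  have f2_supp: "cmod z < 1 \<and> (\<exists>c\<in>C. cmod (z - c) < d)" if "f2 z \<noteq> 0" for z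
    using that insert.prems(5)[of z] by (auto simp: f2_def indicator_def dist_norm norm_minus_commute split: if_splits)
  have IH: "(\<exists>a b. H.nuclear (\<lambda>h. Toeplitz t f2 (Toeplitz t g h)) a b) \<and>
    (\<forall>e. onb t e \<longrightarrow> (\<lambda>n. ip t (Toeplitz t f2 (Toeplitz t g (e n))) (e n) - ip t (Toeplitz t g (Toeplitz t f2 (e n))) (e n)) sums 0)"
    by (rule insert.IH[OF f2 g insert.prems(3) _ f2_supp]) (use insert.prems(4,6) in auto)
  have Tf: "Toeplitz t f h = Toeplitz t f1 h + Toeplitz t f2 h" if "h \<in> Bergman t" for h
    unfolding f12 by (rule Toeplitz_add_symbol[OF f1 f2 that])
  obtain a1 b1 a2 b2 where "H.nuclear (\<lambda>h. Toeplitz t f1 (Toeplitz t g h)) a1 b1"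
    "H.nuclear (\<lambda>h. Toeplitz t f2 (Toeplitz t g h)) a2 b2" using 1 IH by blast
  then have "\<exists>a b. H.nuclear (\<lambda>h. Toeplitz t f (Toeplitz t g h)) a b"
    by (rule H.nuclear_sum) (simp add: Tf g)
  moreover have "(\<lambda>n. ip t (Toeplitz t f (Toeplitz t g (e n))) (e n) - ip t (Toeplitz t g (Toeplitz t f (e n))) (e n)) sums 0"
    if e: "onb t e" for e
  proof -
    have e_V: "e n \<in> Bergman t" for n using e by (simp add: onb_def orthonormal_seq_def)
    have "(\<lambda>n. (ip t (Toeplitz t f1 (Toeplitz t g (e n))) (e n) - ip t (Toeplitz t g (Toeplitz t f1 (e n))) (e n))
        + (ip t (Toeplitz t f2 (Toeplitz t g (e n))) (e n) - ip t (Toeplitz t g (Toeplitz t f2 (e n))) (e n))) sums (0 + 0)"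
      using diag1[OF e] IH e by (intro sums_add) auto
    then show ?thesis
      using e_V f1 f2 g by (simp add: Tf Toeplitz_add_arg H.inn_add_left algebra_simps)
  qed
  ultimately show ?case by blast
qed

text \<open>Agreement on \<open>Bergman t\<close> suffices, as \<open>trace_class\<close> looks at
  the operator only there. The monomials supply the orthonormal sequence that the Schmidt
  decomposition asks for.\<close>

lemma trace_class_if_nuclear:
  assumes nuc: "H.nuclear B a b" and eq: "\<And>h. h \<in> Bergman t \<Longrightarrow> A h = B h"
  shows "trace_class t A"
proof -
  have w: "H.orthonormal monom_basis" using monom_basis_onb by (simp add: H.orthonormal_basis_def)
  obtain u v and s :: "nat \<Rightarrow> real" where uvs: "H.orthonormal u" "H.orthonormal v" "\<And>n. 0 \<le> s n" "summable s"
    "\<And>h. h \<in> Bergman t \<Longrightarrow>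
      (\<lambda>N. L2.nm t (B h - (\<Sum>n<N. fscale (of_real (s n) * ip t h (u n)) (v n)))) \<longlonglongrightarrow> 0"
    by (rule H.nuclear_Schmidt_decomposition[OF nuc w]) (rule that)
  have "(\<lambda>z. A h z - (\<Sum>n<N. of_real (s n) * ip t h (u n) * v n z))
      = B h - (\<Sum>n<N. fscale (of_real (s n) * ip t h (u n)) (v n))" if "h \<in> Bergman t" for h N
    using eq[OF that] by (simp add: fun_eq_iff sum_fun_apply)
  then have "\<forall>h\<in>Bergman t. (\<lambda>N. nrm t (\<lambda>z. A h z - (\<Sum>n<N. of_real (s n) * ip t h (u n) * v n z))) \<longlonglongrightarrow> 0"
    using uvs(5) by (simp add: nm_eq_nrm)
  moreover have "A h \<in> Bergman t" if "h \<in> Bergman t" for h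
    using nuc eq that by (simp add: H.nuclear_def)
  ultimately show ?thesis
    unfolding trace_class_def using uvs(1-4) unfolding orthonormal_iff by blast
qed

text \<open>The defining description of the operator sees the symbol only through integrals.\<close>

lemma Toeplitz_cong_AE:
  assumes "symbol f'" "f \<in> borel_measurable (mu t)" "AE z in mu t. f z = f' z" "h \<in> Bergman t"
  shows "Toeplitz t f h = Toeplitz t f' h"
proof -
  have "(\<integral>z. f z * h z * cnj (k z) \<partial>mu t) = (\<integral>z. f' z * h z * cnj (k z) \<partial>mu t)" if k: "k \<in> Bergman t" for k
  proof (rule integral_cong_AE)
    show "AE z in mu t. f z * h z * cnj (k z) = f' z * h z * cnj (k z)"
      using assms(3) by eventually_elim simp
  qed (use assms k in \<open>auto intro!: borel_measurable_times borel_measurable_cnj simp: Bergman_def symbol_def\<close>)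
  then show ?thesis unfolding Toeplitz_def by (metis (no_types, lifting))
qed

end

section \<open>Essential supports\<close>

text \<open>If \<open>f\<close> vanished almost everywhere near the limit \<open>z\<close>, it would
  do so on a ball of half the radius about some \<open>x n\<close>.\<close>

lemma closed_supp: "closed (supp f)"
proof -
  have "z \<in> supp f" if z: "\<And>n. x n \<in> supp f" "x \<longlonglongrightarrow> z" for x :: "nat \<Rightarrow> complex" and z
  proof -
    have "x n \<in> cball 0 1" for n using z(1)[of n] unfolding supp_def by blast
    then have "z \<in> cball 0 1" by (rule closed_sequentially[OF closed_cball _ z(2)])
    moreover have "\<not> (AE w in lebesgue_on (cball 0 1 \<inter> ball z e). f w = 0)" if e: "e > 0" for e
    proof
      assume AE: "AE w in lebesgue_on (cball 0 1 \<inter> ball z e). f w = 0"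
      obtain n where n: "dist (x n) z < e / 2"
        using z(2) e half_gt_zero[OF e] unfolding lim_sequentially by blast
      have sub: "ball (x n) (e / 2) \<subseteq> ball z e"
        using n e by (simp add: ball_subset_ball_iff)
      have "AE w in lebesgue. w \<in> cball 0 1 \<inter> ball z e \<longrightarrow> f w = 0"
        using AE by (subst (asm) AE_restrict_space_iff) auto
      then have "AE w in lebesgue. w \<in> cball 0 1 \<inter> ball (x n) (e / 2) \<longrightarrow> f w = 0"
        by (rule eventually_mono) (use sub in blast)
      then have "AE w in lebesgue_on (cball 0 1 \<inter> ball (x n) (e / 2)). f w = 0"
        by (subst AE_restrict_space_iff) auto
      then show False using z(1)[of n] half_gt_zero[OF e] unfolding supp_def by blast
    qed
    ultimately show ?thesis unfolding supp_def by blast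
  qed
  then show ?thesis unfolding closed_sequential_limits by blast
qed

text \<open>By Lindelof, countably many balls on which \<open>f\<close> vanishes almost everywhere
  cover the complement of the support within the closed disc, so only countably many null sets have
  to be united.\<close>

lemma AE_zero_off_supp: "AE z in lebesgue_on (cball 0 1). z \<notin> supp f \<longrightarrow> f z = 0"
proof -
  define F where "F = {ball z e | z e. z \<in> cball 0 1 \<and> e > 0 \<and> (AE w in lebesgue_on (cball 0 1 \<inter> ball z e). f w = 0)}"
  obtain F' where F': "F' \<subseteq> F" "countable F'" "\<Union>F' = \<Union>F"
    using Lindelof[of F] by (auto simp: F_def)
  have "AE w in lebesgue. w \<in> cball 0 1 \<inter> U \<longrightarrow> f w = 0" if U: "U \<in> F'" for U
  proof -
    obtain z e where "U = ball z e" "AE w in lebesgue_on (cball 0 1 \<inter> ball z e). f w = 0"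
      using U F'(1) unfolding F_def by blast
    then show ?thesis by (subst (asm) AE_restrict_space_iff) auto
  qed
  then have "AE w in lebesgue. \<forall>U\<in>F'. w \<in> cball 0 1 \<inter> U \<longrightarrow> f w = 0"
    by (intro AE_ball_countable[OF F'(2), THEN iffD2] ballI)
  then have "AE w in lebesgue. w \<in> cball 0 1 \<longrightarrow> w \<notin> supp f \<longrightarrow> f w = 0"
  proof eventually_elim
    case (elim w)
    show ?case
    proof (intro impI)
      assume w: "w \<in> cball 0 1" "w \<notin> supp f"
      then obtain e where e: "e > 0" "AE y in lebesgue_on (cball 0 1 \<inter> ball w e). f y = 0"
        by (auto simp: supp_def)
      then have "ball w e \<in> F" unfolding F_def using w(1) by blast
      moreover have "w \<in> ball w e" using e(1) by simp
      ultimately have "w \<in> \<Union>F'" unfolding F'(3) by blast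
      then show "f w = 0" using elim w(1) by blast
    qed
  qed
  then show ?thesis by (subst AE_restrict_space_iff) auto
qed

context disc_weight
begin

lemma ex_symbol_version:
  assumes "Linf_cdisc f"
  obtains f' where "symbol f'" "\<And>z. f' z \<noteq> 0 \<Longrightarrow> cmod z < 1 \<and> z \<in> supp f"
    "\<And>h. h \<in> Bergman t \<Longrightarrow> Toeplitz t f h = Toeplitz t f' h"
proof -
  obtain B where fm: "f \<in> borel_measurable (lebesgue_on (cball 0 1))"
    and B: "AE z in lebesgue_on (cball 0 1). cmod (f z) \<le> B"
    using assms by (auto simp: Linf_cdisc_def)
  \<comment> \<open>Off the unit circle, \<open>f\<close> is changed only where the essential bound
    fails or off the support, that is, on a null set. Afterwards support and bound hold
    pointwise.\<close>
  define f' where "f' z = (if cmod z < 1 \<and> z \<in> supp f \<and> cmod (f z) \<le> B then f z else 0)" for z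
  have fm': "f \<in> borel_measurable (mu t)"
    unfolding measurable_mu using fm by (rule measurable_restrict_mono) auto
  have "f' \<in> borel_measurable (mu t)"
  proof -
    have sm: "supp f \<in> sets borel" by (simp add: closed_supp borel_closed)
    have "(\<lambda>z. f z * indicator (supp f \<inter> ball 0 1) z * (if cmod (f z) \<le> B then 1 else 0)) \<in> borel_measurable (mu t)"
    proof (intro borel_measurable_times fm' borel_measurable_mu[OF borel_measurable_indicator] measurable_If)
      show "supp f \<inter> ball 0 1 \<in> sets borel" using sm by auto
      show "{z \<in> space (mu t). cmod (f z) \<le> B} \<in> sets (mu t)"
        using measurable_compose[OF fm' borel_measurable_norm] by (intro borel_measurable_le) auto
    qed auto
    moreover have "(\<lambda>z. f z * indicator (supp f \<inter> ball 0 1) z * (if cmod (f z) \<le> B then 1 else 0)) = f'"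
      by (auto simp: f'_def indicator_def fun_eq_iff)
    ultimately show ?thesis by simp
  qed
  moreover have "cmod (f' z) \<le> \<bar>B\<bar>" for z by (auto simp: f'_def)
  ultimately have sym: "symbol f'" unfolding symbol_def by blast
  moreover have "cmod z < 1 \<and> z \<in> supp f" if "f' z \<noteq> 0" for z
    using that by (auto simp: f'_def split: if_splits)
  moreover have "Toeplitz t f h = Toeplitz t f' h" if h: "h \<in> Bergman t" for h
  proof (rule Toeplitz_cong_AE[OF sym fm' _ h])
    have "AE z in lebesgue_on (cball 0 1). cmod (f z) \<le> B \<and> (z \<notin> supp f \<longrightarrow> f z = 0)"
      using B AE_zero_off_supp[of f] by eventually_elim simp
    then have "AE z in lebesgue. z \<in> cball 0 1 \<longrightarrow> cmod (f z) \<le> B \<and> (z \<notin> supp f \<longrightarrow> f z = 0)"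
      by (subst (asm) AE_restrict_space_iff) auto
    then have "AE z in lebesgue. z \<in> ball 0 1 \<longrightarrow> f z = f' z"
      by eventually_elim (auto simp: f'_def)
    then show "AE z in mu t. f z = f' z"
      unfolding AE_mu_iff by (subst AE_restrict_space_iff) auto
  qed
  ultimately show thesis by (rule that)
qed

lemma separated_nuclear:
  assumes f: "symbol f" "\<And>z. f z \<noteq> 0 \<Longrightarrow> cmod z < 1 \<and> z \<in> S"
    and g: "symbol g" "\<And>w. g w \<noteq> 0 \<Longrightarrow> cmod w < 1 \<and> (\<forall>z\<in>S. \<epsilon> < cmod (z - w))"
    and S: "compact S" "S \<subseteq> cball 0 1" and \<epsilon>: "\<epsilon> > 0"
  shows "(\<exists>a b. H.nuclear (\<lambda>h. Toeplitz t f (Toeplitz t g h)) a b) \<and>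
    (\<forall>e. onb t e \<longrightarrow> (\<lambda>n. ip t (Toeplitz t f (Toeplitz t g (e n))) (e n) - ip t (Toeplitz t g (Toeplitz t f (e n))) (e n)) sums 0)"
proof -
  have "S \<subseteq> (\<Union>c\<in>S. ball c (\<epsilon> / 2))" using \<epsilon> by auto
  then obtain C where C: "C \<subseteq> S" "finite C" "S \<subseteq> (\<Union>c\<in>C. ball c (\<epsilon> / 2))"
    using compactE_image[OF S(1), of S "\<lambda>c. ball c (\<epsilon> / 2)"] by auto
  show ?thesis
  \<comment> \<open>With radius \<open>\<epsilon> / 2\<close> the required distance
    \<open>2 * d\<close> is exactly the separation \<open>\<epsilon>\<close>.\<close>
  proof (rule separated_symbols[OF C(2) f(1) g(1), of "\<epsilon> / 2"])
    show "cmod z < 1 \<and> (\<exists>c\<in>C. cmod (z - c) < \<epsilon> / 2)" if "f z \<noteq> 0" for z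
      using f(2)[OF that] C(3) by (force simp: dist_norm norm_minus_commute)
    show "cmod w < 1 \<and> (\<forall>c\<in>C. 2 * (\<epsilon> / 2) \<le> cmod (w - c))" if "g w \<noteq> 0" for w
      using g(2)[OF that] C(1) by (force simp: norm_minus_commute)
  qed (use C S \<epsilon> in auto)
qed

end

theorem theorem2:
  fixes t :: real and f g :: "complex \<Rightarrow> complex"
  assumes "t > 5"
    and "Linf_cdisc f" and "Linf_cdisc g"
    and "Cinf_cdisc g"
    and "\<exists>\<epsilon>>0. \<forall>z \<in> supp f. \<forall>\<xi> \<in> supp g. \<epsilon> < cmod (z - \<xi>)"
  shows "trace_class t (Toeplitz t f \<circ> Toeplitz t g) \<and>
         trace_class t (Toeplitz t g \<circ> Toeplitz t f) \<and>
         trace t (commutator (Toeplitz t f) (Toeplitz t g)) = 0"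
proof -
  interpret disc_weight t using assms(1) by unfold_locales simp
  obtain \<epsilon> where \<epsilon>: "\<epsilon> > 0" and sep: "\<And>z \<xi>. z \<in> supp f \<Longrightarrow> \<xi> \<in> supp g \<Longrightarrow> \<epsilon> < cmod (z - \<xi>)"
    using assms(5) by blast
  obtain f' where f': "symbol f'" "\<And>z. f' z \<noteq> 0 \<Longrightarrow> cmod z < 1 \<and> z \<in> supp f"
    "\<And>h. h \<in> Bergman t \<Longrightarrow> Toeplitz t f h = Toeplitz t f' h"
    using ex_symbol_version[OF assms(2)] by blast
  obtain g' where g': "symbol g'" "\<And>z. g' z \<noteq> 0 \<Longrightarrow> cmod z < 1 \<and> z \<in> supp g"
    "\<And>h. h \<in> Bergman t \<Longrightarrow> Toeplitz t g h = Toeplitz t g' h"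
    using ex_symbol_version[OF assms(3)] by blast
  have sub: "supp f \<subseteq> cball 0 1" "supp g \<subseteq> cball 0 1" by (auto simp: supp_def)
  have compact: "compact (supp f)" "compact (supp g)"
    using sub closed_supp by (auto simp: compact_eq_bounded_closed intro: bounded_subset[OF bounded_cball])
  have fg: "(\<exists>a b. H.nuclear (\<lambda>h. Toeplitz t f' (Toeplitz t g' h)) a b) \<and>
    (\<forall>e. onb t e \<longrightarrow> (\<lambda>n. ip t (Toeplitz t f' (Toeplitz t g' (e n))) (e n) - ip t (Toeplitz t g' (Toeplitz t f' (e n))) (e n)) sums 0)"
    using g'(2) sep by (intro separated_nuclear[OF f'(1,2) g'(1) _ compact(1) sub(1) \<epsilon>]) blast+
  \<comment> \<open>The hypothesis on the supports is symmetric, so the roles of the symbols can be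
    exchanged to obtain nuclearity of the reversed product.\<close>
  have gf: "\<exists>a b. H.nuclear (\<lambda>h. Toeplitz t g' (Toeplitz t f' h)) a b"
    using f'(2) sep
    by (intro separated_nuclear[OF g'(1,2) f'(1) _ compact(2) sub(2) \<epsilon>, THEN conjunct1])
      (auto simp: norm_minus_commute)
  have eq: "Toeplitz t f (Toeplitz t g h) = Toeplitz t f' (Toeplitz t g' h)"
    "Toeplitz t g (Toeplitz t f h) = Toeplitz t g' (Toeplitz t f' h)" if "h \<in> Bergman t" for h
    using that f' g' by simp_all
  have "trace_class t (Toeplitz t f \<circ> Toeplitz t g)"
    using fg eq by (auto intro!: trace_class_if_nuclear)
  moreover have "trace_class t (Toeplitz t g \<circ> Toeplitz t f)"
    using gf eq by (auto intro!: trace_class_if_nuclear)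
  moreover have "trace t (commutator (Toeplitz t f) (Toeplitz t g)) = 0"
  proof -
    define e where "e = (SOME e. onb t e)"
    \<comment> \<open>The monomials witness that an orthonormal basis exists, so the chosen
      \<open>e\<close> is one; the diagonal sum is already known for every basis.\<close>
    have e: "onb t e"
      unfolding e_def using monom_basis_onb by (intro someI[of "onb t"]) (simp add: orthonormal_basis_iff)
    then have e_V: "e n \<in> Bergman t" for n by (simp add: onb_def orthonormal_seq_def)
    have "commutator (Toeplitz t f) (Toeplitz t g) (e n)
        = Toeplitz t f' (Toeplitz t g' (e n)) - Toeplitz t g' (Toeplitz t f' (e n))" for n
      by (simp add: commutator_def fun_diff_def eq[OF e_V])
    then have "ip t (commutator (Toeplitz t f) (Toeplitz t g) (e n)) (e n)
        = ip t (Toeplitz t f' (Toeplitz t g' (e n))) (e n) - ip t (Toeplitz t g' (Toeplitz t f' (e n))) (e n)" for n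
      using e_V f'(1) g'(1) by (simp add: H.inn_diff_left)
    then show ?thesis
      using fg e by (simp add: trace_def e_def[symmetric] sums_iff)
  qed
  ultimately show ?thesis by blast
qed

end
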